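(* Let $V,W$ be complex vector spaces with $\dim(\mathbb{P}(V))=N\ge M=\dim(\mathbb{P}(W))$, let $1\le r\le M$, and let $X_r\subset\mathbb{P}(V^*\otimes W)$ denote the projective variety of linear maps $f\colon V\to W$ of rank at most $r$. Let $\mathbb{P}(L_1)\subset\mathbb{P}(V)$, $\mathbb{P}(L_2)\subset\mathbb{P}(W)$ be linear subspaces of dimensions $\ell_1$ and $\ell_2$, and consider $Z=X_r\cap\mathbb{P}(L_1^*\otimes L_2)$. (i) If $\min\{\ell_1,\ell_2\}<r-1$, then $(X_r)_Z^\vee=\emptyset$. (ii) If instead $\min\{\ell_1,\ell_2\}\ge r-1$, then $$\mathrm{def}(X_r,Z)=r\,\max\{\ell_1-M,0\}+r^2-1.$$ As a consequence, $$\mathrm{codim}_{X_r^\vee}((X_r)_Z^\vee)=r(2M-\ell_1-\ell_2)+r\,\max\{\ell_1-M,0\}.$$ In particular $(X_r)_Z^\vee=X_r^\vee$ if and only if $\min\{\ell_1,\ell_2\}\ge M$.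
   Context: After fixing bases, $V^*\otimes W\cong\mathrm{Hom}(V,W)$ is the space of $(M+1)\times(N+1)$ complex matrices, and $L_1^*\otimes L_2$ is the subspace of matrices $A$ whose column span is contained in $L_2$ and whose row span (the range of $A^{T}$) is contained in $L_1$ (using the bases to identify $V\cong V^*$). For projective varieties $Z\subset X\subset\mathbb{P}^m$, with $T_xX$ the embedded projective tangent space at $x\in X_{\rm sm}$: the conormal variety is $W_X=\overline{\{(x,H)\in\mathbb{P}^m\times(\mathbb{P}^m)^\vee\mid x\in X_{\rm sm},\ H\supset T_xX\}}$, the dual variety is $X^\vee=\mathrm{pr}_2(W_X)$; the conormal variety of $X$ relative to $Z$ is $W_{X,Z}=\overline{\{(x,H)\mid x\in X_{\rm sm}\cap Z,\ H\supset T_xX\}}$ and the dual variety of $X$ relative to $Z$ is $X_Z^\vee=\mathrm{pr}_2(W_{X,Z})$ (both empty if $Z\subset X_{\rm sing}$). The relative dual defect $\mathrm{def}(X,Z)$ is the dimension of $\mathrm{Cont}(H,X,Z)=\mathrm{pr}_1(\mathrm{pr}_2^{-1}(H)\cap W_{X,Z})$ for generic $H\in X_Z^\vee$. *)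

theory Defs
  imports "HOL-Analysis.Analysis"
begin

section \<open>Projective space and its Zariski topology\<close>

text \<open>
  A point of the projective space of \<open>\<complex>^k\<close> is a one-dimensional linear subspace of
  \<open>complex ^ 'k\<close>; thus \<open>proj UNIV\<close> is the projective space of dimension \<open>CARD('k) - 1\<close>, and
  \<open>proj L\<close> is the projective linear subspace \<open>P(L)\<close> when \<open>L\<close> is a linear subspace.
\<close>

type_synonym 'k point = "(complex ^ 'k) set"

definition proj :: "(complex ^ 'k::finite) set \<Rightarrow> 'k point set" where
  "proj L = {p. vec.subspace p \<and> vec.dim p = 1 \<and> p \<subseteq> L}"

definition monom_fun :: "('k::finite \<Rightarrow> nat) \<Rightarrow> complex ^ 'k \<Rightarrow> complex" where
  "monom_fun a v = (\<Prod>i\<in>UNIV. (v $ i) ^ a i)"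

text \<open>
  Polynomials are identified with polynomial functions (the field is infinite). For each degree
  there are only finitely many exponent vectors, so the sums below are finite.
\<close>

definition form :: "nat \<Rightarrow> (complex ^ 'k::finite \<Rightarrow> complex) \<Rightarrow> bool" where
  "form d F \<longleftrightarrow> (\<exists>c. F = (\<lambda>v. \<Sum>a | (\<Sum>i\<in>UNIV. a i) = d. c a * monom_fun a v))"

definition biform :: "nat \<Rightarrow> nat \<Rightarrow> (complex ^ 'k::finite \<Rightarrow> complex ^ 'l::finite \<Rightarrow> complex) \<Rightarrow> bool" where
  "biform d e G \<longleftrightarrow> (\<exists>c. G = (\<lambda>v w.
     \<Sum>a | (\<Sum>i\<in>UNIV. a i) = d. \<Sum>b | (\<Sum>j\<in>UNIV. b j) = e.
       c a b * monom_fun a v * monom_fun b w))"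

text \<open>
  The principal open sets form a base, so the closed sets of the following two topologies are
  exactly the common zero loci of families of (bi)homogeneous polynomials.
\<close>

definition zariski :: "'k::finite point topology" where
  "zariski = topology_generated_by
     {{p \<in> proj UNIV. \<exists>v\<in>p. F v \<noteq> 0} | d F. form d F}"

definition zariski2 :: "('k::finite point \<times> 'l::finite point) topology" where
  "zariski2 = topology_generated_by
     {{(p, q) \<in> proj UNIV \<times> proj UNIV. \<exists>v\<in>p. \<exists>w\<in>q. G v w \<noteq> 0} | d e G. biform d e G}"

section \<open>Dimension\<close>

definition irreducible_in :: "'a topology \<Rightarrow> 'a set \<Rightarrow> bool" where
  "irreducible_in T S \<longleftrightarrow> S \<subseteq> topspace T \<and> S \<noteq> {} \<and>
     (\<forall>A B. closedin T A \<and> closedin T B \<and> S \<subseteq> A \<union> B \<longrightarrow> S \<subseteq> A \<or> S \<subseteq> B)"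

text \<open>
  Krull dimension: a chain of \<open>n\<close> sets has length \<open>n - 1\<close>, and the empty space has
  dimension \<open>-1\<close>. The supremum is taken over \<open>nat\<close>; for subspaces of projective space the chain
  lengths are bounded, so it is a maximum.
\<close>

definition krull_dim :: "'a topology \<Rightarrow> int" where
  "krull_dim T = int (Sup {length C | C. sorted_wrt (\<subset>) C \<and>
     (\<forall>S\<in>set C. closedin T S \<and> irreducible_in T S)}) - 1"

definition zdim :: "'k::finite point set \<Rightarrow> int" where
  "zdim S = krull_dim (subtopology zariski S)"

definition local_zdim :: "'k::finite point set \<Rightarrow> 'k point \<Rightarrow> int" where
  "local_zdim X p = Sup {zdim Y | Y. closedin (subtopology zariski X) Y \<and>
     irreducible_in zariski Y \<and> p \<in> Y}"

section \<open>Tangent spaces, conormal and dual varieties\<close>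

text \<open>
  The linear subspace of \<open>complex ^ 'k\<close> whose projectivization is the embedded projective tangent
  space of \<open>X\<close> at \<open>p\<close>; the derivative is \<open>\<Sum>i. \<partial>F/\<partial>x\<^sub>i(v) * y\<^sub>i\<close>, and \<open>F\<close> ranges over all forms
  in the (radical) homogeneous ideal of \<open>X\<close>.
\<close>

definition tangent_cone_space :: "'k::finite point set \<Rightarrow> 'k point \<Rightarrow> (complex ^ 'k) set" where
  "tangent_cone_space X p = {y. \<forall>d F. form d F \<and> (\<forall>q\<in>X. \<forall>w\<in>q. F w = 0) \<longrightarrow>
     (\<forall>v\<in>p - {0}. deriv (\<lambda>t. F (v + t *s y)) 0 = 0)}"

definition tangent_space :: "'k::finite point set \<Rightarrow> 'k point \<Rightarrow> 'k point set" where
  "tangent_space X p = proj (tangent_cone_space X p)"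

definition smooth_locus :: "'k::finite point set \<Rightarrow> 'k point set" where
  "smooth_locus X = {p \<in> X. zdim (tangent_space X p) = local_zdim X p}"

text \<open>
  The dual projective space is represented by homogeneous coordinates of hyperplanes: a point
  \<open>h\<close> stands for the following hyperplane.
\<close>

definition hyperplane :: "'k::finite point \<Rightarrow> 'k point set" where
  "hyperplane h = proj {v. \<forall>w\<in>h. (\<Sum>i\<in>UNIV. w $ i * v $ i) = 0}"

definition rel_conormal :: "'k::finite point set \<Rightarrow> 'k point set \<Rightarrow> ('k point \<times> 'k point) set" where
  "rel_conormal X Z = zariski2 closure_of
     {(x, h). x \<in> smooth_locus X \<inter> Z \<and> h \<in> proj UNIV \<and> tangent_space X x \<subseteq> hyperplane h}"

definition rel_dual :: "'k::finite point set \<Rightarrow> 'k point set \<Rightarrow> 'k point set" where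
  "rel_dual X Z = snd ` rel_conormal X Z"

definition conormal :: "'k::finite point set \<Rightarrow> ('k point \<times> 'k point) set" where
  "conormal X = zariski2 closure_of
     {(x, h). x \<in> smooth_locus X \<and> h \<in> proj UNIV \<and> tangent_space X x \<subseteq> hyperplane h}"

definition dual_variety :: "'k::finite point set \<Rightarrow> 'k point set" where
  "dual_variety X = snd ` conormal X"

definition contact_locus :: "'k::finite point \<Rightarrow> 'k point set \<Rightarrow> 'k point set \<Rightarrow> 'k point set" where
  "contact_locus h X Z = fst ` (snd -` {h} \<inter> rel_conormal X Z)"

text \<open>
  Generic means: on a dense Zariski-open subset. If the relative dual variety is nonempty there is
  at most one such \<open>d\<close>, since two dense open subsets of it meet; if it is empty, the defect is
  unspecified.
\<close>

definition rel_dual_defect :: "'k::finite point set \<Rightarrow> 'k point set \<Rightarrow> int" where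
  "rel_dual_defect X Z = (THE d.
     \<exists>U. openin (subtopology zariski (rel_dual X Z)) U \<and>
         rel_dual X Z \<subseteq> zariski closure_of U \<and>
         (\<forall>h\<in>U. zdim (contact_locus h X Z) = d))"

definition zcodim :: "'k::finite point set \<Rightarrow> 'k point set \<Rightarrow> int" where
  "zcodim X Y = zdim X - zdim Y"

section \<open>Determinantal varieties\<close>

text \<open>
  \<open>Hom(\<complex>^n, \<complex>^m)\<close> is the space of \<open>m \<times> n\<close> matrices, with coordinates indexed by pairs (row, column).
\<close>

definition mat_of :: "complex ^ ('m::finite \<times> 'n::finite) \<Rightarrow> complex ^ 'n ^ 'm" where
  "mat_of v = (\<chi> i j. v $ (i, j))"

definition determinantal :: "nat \<Rightarrow> ('m::finite \<times> 'n::finite) point set" where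
  "determinantal r = proj {v. rank (mat_of v) \<le> r}"

definition tensor_subspace ::
    "(complex ^ 'n::finite) set \<Rightarrow> (complex ^ 'm::finite) set \<Rightarrow> (complex ^ ('m \<times> 'n)) set" where
  "tensor_subspace L1 L2 = {v. range ((*v) (mat_of v)) \<subseteq> L2 \<and>
     range ((*v) (transpose (mat_of v))) \<subseteq> L1}"

end

theory Submission
  imports Defs "HOL-Computational_Algebra.Polynomial"
begin

text \<open>
  By the minors of size \<open>r + 1\<close>, the tangent space at a matrix \<open>A\<close> of rank \<open>r\<close> consists of the \<open>B\<close>
  with \<open>B (ker A) \<subseteq> im A\<close>, while at smaller rank it is everything. So \<open>H\<close> is conormal at \<open>A\<close> iff
  \<open>A\<^sup>T H = 0\<close> and \<open>A H\<^sup>T = 0\<close>. Taking \<open>A\<close> of rank \<open>r\<close> in \<open>L1 \<otimes> L2\<close>, the relative dual variety is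
  the locus of the \<open>H\<close> for which both \<open>ker H \<inter> L1\<close> and \<open>ker H\<^sup>T \<inter> L2\<close> have dimension at least
  \<open>r\<close>, and for generic \<open>H\<close> the contact locus is the projective space of the tensor product of
  these two kernels. \<open>X\<close> itself is such a locus for the full spaces and \<open>M + 1 - r\<close>.

  The dimension of such a locus is read off from charts: choose \<open>r\<close> coordinates of \<open>L1\<close> and \<open>r\<close> of
  \<open>L2\<close>, and express the corresponding columns and rows through the others. A chain of \<open>s\<close>
  irreducible closed sets yields \<open>s\<close> algebraically independent forms, and counting monomials bounds
  \<open>s\<close> by the number of parameters; a flag of coordinate subspaces of a chart attains the bound.
\<close>

section \<open>Linear algebra over the complex numbers\<close>

text \<open>Smoothness is defined by a local dimension at every point of \<open>X\<close>, and the
  defect by a dense open set. So the argument runs chart by chart: every point of a degeneracy locus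
  lies in the closure of a chart of full dimension, and every chart contains a point whose two
  kernels are as small as possible, given by a partial permutation matrix.

  The asymmetry between l1 and l2 comes from M \<le> N. If the left kernel of H meets
  \<open>L2\<close> in dimension at least r, then H has rank at most M + 1 - r, and the kernel of H
  is forced to meet \<open>L1\<close> in dimension at least r + (l1 - M). For l1 \<ge> M the
  condition on \<open>L1\<close> thus follows from the one on \<open>L2\<close>, and the parameters
  of the charts would be too many. Therefore \<open>L1\<close> is first replaced by a subspace of
  dimension at most M + 1. The excess l1 - M returns in the kernel of a generic H on the whole of
  \<open>L1\<close>, whose dimension is r + max(l1 - M, 0); multiplied by r this is the defect plus
  one.\<close>

declare transpose_matrix_vector [simp del]

definition coord_space :: "'k set \<Rightarrow> (complex ^ 'k::finite) set" where
  "coord_space I = {x. \<forall>i. i \<notin> I \<longrightarrow> x $ i = 0}"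

lemma dim_coord_space: "vec.dim (coord_space I) = card I"
  unfolding coord_space_def by (rule dim_substandard_cart)

lemma subspace_coord_space: "vec.subspace (coord_space I)"
  by (simp add: coord_space_def vec.subspace_def)

lemma axis_in_coord_space_iff: "axis i 1 \<in> coord_space I \<longleftrightarrow> i \<in> I"
  by (auto simp: coord_space_def axis_def)

text \<open>A basis of \<open>V\<close> is extended to one of \<open>L\<close> and then to one of
  the whole space. With these vectors as the columns of \<open>F\<close>, both subspaces become
  coordinate subspaces, and questions about them become questions about index sets.\<close>

lemma flag_normal_form:
  fixes V L :: "(complex ^ 'k::finite) set"
  assumes V: "vec.subspace V" and L: "vec.subspace L" and VL: "V \<subseteq> L"
  obtains F F' :: "complex ^ 'k ^ 'k" and I0 I1 where
    "F ** F' = mat 1" "F' ** F = mat 1" "I0 \<subseteq> I1"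
    "V = (*v) F ` coord_space I0" "L = (*v) F ` coord_space I1"
    "card I0 = vec.dim V" "card I1 = vec.dim L"
proof -
  obtain B0 where B0: "B0 \<subseteq> V" "vec.independent B0" "V \<subseteq> vec.span B0" "card B0 = vec.dim V"
    by (rule vec.basis_exists[of V])
  have "B0 \<subseteq> L" using B0 VL by blast
  then obtain B1 where B1: "B0 \<subseteq> B1" "B1 \<subseteq> L" "vec.independent B1" "L \<subseteq> vec.span B1"
    by (rule vec.maximal_independent_subset_extend[OF _ B0(2)])
  obtain B where B: "B1 \<subseteq> B" "vec.independent B" "UNIV \<subseteq> vec.span B"
    by (rule vec.maximal_independent_subset_extend[OF subset_UNIV B1(3)])
  have spV: "vec.span B0 = V" using B0(3) vec.span_minimal[OF B0(1) V] by (rule subset_antisym[rotated])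
  have spL: "vec.span B1 = L" using B1(4) vec.span_minimal[OF B1(2) L] by (rule subset_antisym[rotated])
  have cB: "card B = CARD('k)"
  proof -
    have "vec.span B = UNIV" using B(3) by blast
    then show ?thesis using vec.dim_eq_card_independent[OF B(2)] vec.dim_span[of B]
      by (metis vec_dim_card)
  qed
  have fB: "finite B" using B(2) vec.finiteI_independent by blast
  obtain f where f: "bij_betw f (UNIV :: 'k set) B"
    using cB fB finite_same_card_bij[of "UNIV :: 'k set" B] by auto
  define F :: "complex ^ 'k ^ 'k" where "F = (\<chi> i j. f j $ i)"
  have col: "column j F = f j" for j
    by (simp add: F_def column_def vec_eq_iff)
  have Fx: "F *v x = (\<Sum>j\<in>UNIV. x $ j *s f j)" for x
    by (simp add: matrix_mult_sum col)
  have "columns F = B"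
    using f by (auto simp: columns_def col bij_betw_def)
  then obtain F' where F': "F ** F' = mat 1"
    using B(3) matrix_right_invertible_span_columns[of F] by auto
  then have F'2: "F' ** F = mat 1" by (simp add: matrix_left_right_inverse)
  have inj: "inj f" using f bij_betw_def by blast
  have img: "(*v) F ` coord_space (f -` C) = vec.span C" if C: "C \<subseteq> B" for C
  proof -
    have fC: "finite C" using C fB finite_subset by blast
    have im: "f ` (f -` C) = C" using C f by (auto simp: bij_betw_def)
    have sums: "(\<Sum>v\<in>C. u v *s v) = (\<Sum>j\<in>f -` C. u (f j) *s f j)" for u
      using sum.reindex[OF inj_on_subset[OF inj subset_UNIV], of "\<lambda>v. u v *s v" "f -` C"] unfolding im
      by (simp add: o_def)
    show ?thesis
    proof (intro set_eqI iffI)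
      fix y assume "y \<in> (*v) F ` coord_space (f -` C)"
      then obtain x where x: "x \<in> coord_space (f -` C)" "y = F *v x" by auto
      have "y = (\<Sum>j\<in>f -` C. x $ j *s f j)"
        unfolding x(2) Fx using x(1) by (intro sum.mono_neutral_right) (auto simp: coord_space_def)
      also have "\<dots> \<in> vec.span C" by (intro vec.span_sum vec.span_scale vec.span_base) auto
      finally show "y \<in> vec.span C" .
    next
      fix y assume "y \<in> vec.span C"
      then obtain u where "y = (\<Sum>v\<in>C. u v *s v)" using vec.span_finite[OF fC] by auto
      then have y: "y = (\<Sum>j\<in>f -` C. u (f j) *s f j)" using sums by simp
      define x where "x = (\<chi> j. if f j \<in> C then u (f j) else 0)"
      have "F *v x = (\<Sum>j\<in>f -` C. x $ j *s f j)"
        unfolding Fx by (intro sum.mono_neutral_right) (auto simp: x_def)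
      also have "\<dots> = y" unfolding y by (intro sum.cong) (auto simp: x_def)
      finally show "y \<in> (*v) F ` coord_space (f -` C)"
        by (intro image_eqI[of _ _ x]) (auto simp: coord_space_def x_def)
    qed
  qed
  have crd: "card (f -` C) = card C" if "C \<subseteq> B" for C
    using f that by (intro card_vimage_inj inj) (auto simp: bij_betw_def)
  show thesis
  proof (rule that[OF F' F'2])
    show "f -` B0 \<subseteq> f -` B1" using B1 by auto
    show "V = (*v) F ` coord_space (f -` B0)" using img[of B0] B1 B spV by blast
    show "L = (*v) F ` coord_space (f -` B1)" using img[of B1] B1 B spL by blast
    show "card (f -` B0) = vec.dim V" using crd[of B0] B1 B B0 by auto
    show "card (f -` B1) = vec.dim L"
      using crd[of B1] B vec.dim_eq_card_independent[OF B1(3)] vec.dim_span[of B1] spL by auto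
  qed
qed

lemma inj_matrix_of_left_inverse:
  fixes F :: "complex ^ 'k::finite ^ 'k"
  assumes "F' ** F = mat 1"
  shows "inj ((*v) F)"
  by (metis assms injI matrix_vector_mul_assoc matrix_vector_mul_lid)

lemma subspace_normal_form:
  fixes L :: "(complex ^ 'k::finite) set"
  assumes L: "vec.subspace L"
  obtains F F' :: "complex ^ 'k ^ 'k" and I where
    "F ** F' = mat 1" "F' ** F = mat 1" "L = (*v) F ` coord_space I" "card I = vec.dim L"
  using flag_normal_form[OF L L subset_refl] by metis

lemma dim_inj_image:
  fixes f :: "complex ^ 'k::finite \<Rightarrow> complex ^ 'l::finite"
  assumes "Vector_Spaces.linear (*s) (*s) f" "inj_on f V" "vec.subspace V"
  shows "vec.dim (f ` V) = vec.dim V"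
  using vec.dim_image_eq[OF assms(1), of V] assms(2,3) vec.span_eq_iff[of V] by metis

lemma linear_inj_on_subspace:
  fixes f :: "complex ^ 'k::finite \<Rightarrow> complex ^ 'l::finite"
  assumes "Vector_Spaces.linear (*s) (*s) f" "vec.subspace V" "\<And>x. x \<in> V \<Longrightarrow> f x = 0 \<Longrightarrow> x = 0"
  shows "inj_on f V"
proof (rule inj_onI)
  interpret Vector_Spaces.linear "(*s)" "(*s)" f by fact
  fix x y assume "x \<in> V" "y \<in> V" "f x = f y"
  then have "f (x - y) = 0" by (simp add: diff)
  then show "x = y" using assms(3)[of "x - y"] vec.subspace_diff[OF assms(2)] \<open>x \<in> V\<close> \<open>y \<in> V\<close> by auto
qed

text \<open>In a basis adapted to both subspaces, the complement is spanned by the basis vectors of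
  \<open>L\<close> that do not belong to \<open>V\<close>.\<close>

lemma subspace_complement:
  fixes V L :: "(complex ^ 'k::finite) set"
  assumes V: "vec.subspace V" and L: "vec.subspace L" and VL: "V \<subseteq> L"
  obtains R where "vec.subspace R" "R \<subseteq> L" "R \<inter> V = {0}" "vec.dim R + vec.dim V = vec.dim L"
    "\<And>x. x \<in> L \<Longrightarrow> \<exists>y\<in>R. \<exists>z\<in>V. x = y + z"
proof -
  obtain F F' :: "complex ^ 'k ^ 'k" and I0 I1 where F:
    "F ** F' = mat 1" "F' ** F = mat 1" "I0 \<subseteq> I1"
    "V = (*v) F ` coord_space I0" "L = (*v) F ` coord_space I1"
    "card I0 = vec.dim V" "card I1 = vec.dim L" by (rule flag_normal_form[OF assms])
  have inj: "inj ((*v) F)" by (rule inj_matrix_of_left_inverse[OF F(2)])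
  define R where "R = (*v) F ` coord_space (I1 - I0)"
  have dR: "vec.dim R = card (I1 - I0)"
    unfolding R_def
    by (subst dim_inj_image) (auto simp: subspace_coord_space dim_coord_space matrix_vector_mul_linear_gen
        intro: inj_on_subset[OF inj])
  show thesis
  proof
    show "vec.subspace R" unfolding R_def
      by (intro vec.linear_subspace_image matrix_vector_mul_linear_gen subspace_coord_space)
    show "R \<subseteq> L" unfolding R_def F by (auto simp: coord_space_def)
    show "R \<inter> V = {0}"
    proof -
      have "coord_space (I1 - I0) \<inter> coord_space I0 = {0}"
        by (auto simp: coord_space_def vec_eq_iff) (metis (full_types))
      then show ?thesis unfolding R_def F image_Int[OF inj, symmetric] by simp
    qed
    show "vec.dim R + vec.dim V = vec.dim L"
      using dR F by (metis card_Diff_subset card_mono finite le_add_diff_inverse2)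
    fix x assume "x \<in> L"
    then obtain u where u: "u \<in> coord_space I1" "x = F *v u" using F by auto
    define u0 where "u0 = (\<chi> i. if i \<in> I0 then u $ i else 0)"
    have "u0 \<in> coord_space I0" "u - u0 \<in> coord_space (I1 - I0)" using u by (auto simp: u0_def coord_space_def)
    moreover have "x = F *v (u - u0) + F *v u0" using u by (simp add: matrix_vector_mult_diff_distrib)
    ultimately show "\<exists>y\<in>R. \<exists>z\<in>V. x = y + z" unfolding R_def F by blast
  qed
qed

lemma subspace_kernel_inter:
  fixes f :: "complex ^ 'k::finite \<Rightarrow> complex ^ 'l::finite"
  assumes f: "Vector_Spaces.linear (*s) (*s) f" and L: "vec.subspace L"
  shows "vec.subspace ({x. f x = 0} \<inter> L)"
  by (intro vec.subspace_inter vec.linear_subspace_kernel f L)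

text \<open>A complement of the kernel inside \<open>L\<close> is mapped isomorphically onto the
  image of \<open>L\<close>.\<close>

lemma rank_nullity_on:
  fixes f :: "complex ^ 'k::finite \<Rightarrow> complex ^ 'l::finite"
  assumes f: "Vector_Spaces.linear (*s) (*s) f" and L: "vec.subspace L"
  shows "vec.dim ({x. f x = 0} \<inter> L) + vec.dim (f ` L) = vec.dim L"
proof -
  interpret Vector_Spaces.linear "(*s)" "(*s)" f by fact
  have sub: "vec.subspace ({x. f x = 0} \<inter> L)" by (rule subspace_kernel_inter[OF assms])
  obtain R where R: "vec.subspace R" "R \<subseteq> L" "R \<inter> ({x. f x = 0} \<inter> L) = {0}"
    "vec.dim R + vec.dim ({x. f x = 0} \<inter> L) = vec.dim L"
    "\<And>x. x \<in> L \<Longrightarrow> \<exists>y\<in>R. \<exists>z\<in>{x. f x = 0} \<inter> L. x = y + z"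
    using subspace_complement[OF sub L] by blast
  have inj: "inj_on f R" using R by (intro linear_inj_on_subspace f) auto
  have "f ` L = f ` R"
  proof
    show "f ` L \<subseteq> f ` R"
    proof
      fix y assume "y \<in> f ` L"
      then obtain x where "x \<in> L" "y = f x" by auto
      then obtain u z where "u \<in> R" "f z = 0" "x = u + z" using R(5) by blast
      then have "y = f u" using \<open>y = f x\<close> add by simp
      then show "y \<in> f ` R" using \<open>u \<in> R\<close> by blast
    qed
  qed (use R in auto)
  then show ?thesis using dim_inj_image[OF f inj R(1)] R(4) by simp
qed

text \<open>Take a linear map with kernel \<open>B\<close> and compare rank-nullity on
  \<open>A\<close> with rank-nullity on \<open>L\<close>: the image of \<open>A\<close> lies in the
  image of \<open>L\<close>.\<close>

lemma dim_add_le_dim_inter: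
  fixes A B L :: "(complex ^ 'k::finite) set"
  assumes A: "vec.subspace A" and B: "vec.subspace B" and L: "vec.subspace L" and "A \<subseteq> L" "B \<subseteq> L"
  shows "vec.dim A + vec.dim B \<le> vec.dim L + vec.dim (A \<inter> B)"
proof -
  obtain F F' :: "complex ^ 'k ^ 'k" and I where F:
    "F ** F' = mat 1" "F' ** F = mat 1" "B = (*v) F ` coord_space I" "card I = vec.dim B"
    by (rule subspace_normal_form[OF B])
  \<comment> \<open>\<open>P\<close> deletes the coordinates in \<open>I\<close>; after the change
    of basis \<open>F'\<close> its kernel is \<open>B\<close>.\<close>
  define P :: "complex ^ 'k ^ 'k" where "P = (\<chi> i j. if i = j \<and> i \<notin> I then 1 else 0)"
  define f where "f x = (P ** F') *v x" for x
  have lf: "Vector_Spaces.linear (*s) (*s) f" unfolding f_def by (rule matrix_vector_mul_linear_gen)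
  have Pv: "(P *v y) $ i = (if i \<in> I then 0 else y $ i)" for y i
    by (auto simp: P_def matrix_vector_mult_def if_distrib if_distribR cong: if_cong)
  have P0: "P *v y = 0 \<longleftrightarrow> y \<in> coord_space I" for y
    by (auto simp: vec_eq_iff Pv coord_space_def)
  have ker: "{x. f x = 0} = B"
  proof (intro set_eqI iffI)
    fix x assume "x \<in> {x. f x = 0}"
    then have "F' *v x \<in> coord_space I" by (simp add: f_def P0 flip: matrix_vector_mul_assoc)
    then have "F *v (F' *v x) \<in> B" unfolding F by blast
    then show "x \<in> B" by (simp add: F matrix_vector_mul_assoc)
  next
    fix x assume "x \<in> B"
    then obtain u where u: "u \<in> coord_space I" "x = F *v u" using F by auto
    have "f x = P *v ((F' ** F) *v u)" by (simp add: f_def u matrix_vector_mul_assoc matrix_mul_assoc)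
    then show "x \<in> {x. f x = 0}" using u by (simp add: F P0)
  qed
  have "vec.dim (B \<inter> A) + vec.dim (f ` A) = vec.dim A" "vec.dim (B \<inter> L) + vec.dim (f ` L) = vec.dim L"
    using rank_nullity_on[OF lf] A L ker by metis+
  moreover have "vec.dim (f ` A) \<le> vec.dim (f ` L)" using \<open>A \<subseteq> L\<close> by (intro vec.dim_subset) auto
  moreover have "B \<inter> L = B" using \<open>B \<subseteq> L\<close> by blast
  ultimately show ?thesis by (simp add: Int_commute)
qed

text \<open>The pairing is bilinear without conjugation, as in \<open>hyperplane\<close>, so a
  subspace may meet its annihilator.\<close>

definition annihilator :: "(complex ^ 'k::finite) set \<Rightarrow> (complex ^ 'k) set" where
  "annihilator W = {y. \<forall>w\<in>W. (\<Sum>i\<in>UNIV. w $ i * y $ i) = 0}"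

lemma subspace_annihilator: "vec.subspace (annihilator W)"
  by (auto simp: annihilator_def vec.subspace_def algebra_simps sum.distrib simp flip: sum_distrib_left)

lemma dot_matrix_transpose:
  fixes F :: "complex ^ 'n::finite ^ 'm::finite"
  shows "(\<Sum>i\<in>UNIV. (F *v x) $ i * y $ i) = (\<Sum>j\<in>UNIV. x $ j * (transpose F *v y) $ j)"
  unfolding matrix_vector_mult_def transpose_def
  by (simp add: sum_distrib_right sum_distrib_left mult_ac) (rule sum.swap)

text \<open>The columns of \<open>transpose F'\<close> form the basis dual to the columns of
  \<open>F\<close>, so the annihilator takes the complementary indices.\<close>

lemma annihilator_coord_space_image:
  fixes F F' :: "complex ^ 'k::finite ^ 'k"
  assumes "F ** F' = mat 1" "F' ** F = mat 1"
  shows "annihilator ((*v) F ` coord_space I) = (*v) (transpose F') ` coord_space (- I)"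
proof -
  have *: "y \<in> annihilator ((*v) F ` coord_space I) \<longleftrightarrow> transpose F *v y \<in> coord_space (- I)" for y
  proof
    assume y: "y \<in> annihilator ((*v) F ` coord_space I)"
    have "(transpose F *v y) $ i = 0" if "i \<in> I" for i
    proof -
      have "(\<Sum>j\<in>UNIV. axis i 1 $ j * (transpose F *v y) $ j) = 0"
        using y that axis_in_coord_space_iff[of i I]
        unfolding annihilator_def dot_matrix_transpose[symmetric] by blast
      then show ?thesis by (simp add: axis_def if_distrib if_distribR cong: if_cong)
    qed
    then show "transpose F *v y \<in> coord_space (- I)" by (simp add: coord_space_def)
  next
    assume "transpose F *v y \<in> coord_space (- I)"
    then show "y \<in> annihilator ((*v) F ` coord_space I)"
      unfolding annihilator_def
      by (auto simp: dot_matrix_transpose coord_space_def intro!: sum.neutral) metis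
  qed
  have t: "transpose F ** transpose F' = mat 1" "transpose F' ** transpose F = mat 1"
    using assms by (metis matrix_transpose_mul transpose_mat)+
  show ?thesis
  proof (intro set_eqI iffI)
    fix y assume "y \<in> annihilator ((*v) F ` coord_space I)"
    then have "transpose F *v y \<in> coord_space (- I)" using * by blast
    moreover have "y = transpose F' *v (transpose F *v y)" by (simp add: matrix_vector_mul_assoc t)
    ultimately show "y \<in> (*v) (transpose F') ` coord_space (- I)" by blast
  next
    fix y assume "y \<in> (*v) (transpose F') ` coord_space (- I)"
    then show "y \<in> annihilator ((*v) F ` coord_space I)"
      unfolding * by (auto simp: matrix_vector_mul_assoc t)
  qed
qed

lemma dim_annihilator:
  fixes W :: "(complex ^ 'k::finite) set"
  assumes W: "vec.subspace W"
  shows "vec.dim (annihilator W) + vec.dim W = CARD('k)"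
proof -
  obtain F F' :: "complex ^ 'k ^ 'k" and I where F:
    "F ** F' = mat 1" "F' ** F = mat 1" "W = (*v) F ` coord_space I" "card I = vec.dim W"
    by (rule subspace_normal_form[OF W])
  have t: "transpose F ** transpose F' = mat 1"
    using F by (metis matrix_transpose_mul transpose_mat)
  have "vec.dim (annihilator W) = card (- I)"
    unfolding F annihilator_coord_space_image[OF F(1,2)]
    by (subst dim_inj_image) (auto simp: subspace_coord_space dim_coord_space matrix_vector_mul_linear_gen
        intro: inj_on_subset[OF inj_matrix_of_left_inverse[OF t]])
  moreover have "card I \<le> CARD('k)" by (intro card_mono) auto
  ultimately show ?thesis using F(4) by (simp add: Compl_eq_Diff_UNIV card_Diff_subset)
qed

text \<open>The double annihilator contains \<open>W\<close> and has the same dimension, hence it is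
  \<open>W\<close>.\<close>

lemma annihilator_separates:
  fixes W :: "(complex ^ 'k::finite) set"
  assumes W: "vec.subspace W" and "v \<notin> W"
  obtains u where "u \<in> annihilator W" "(\<Sum>i\<in>UNIV. u $ i * v $ i) \<noteq> 0"
proof -
  have "W \<subseteq> annihilator (annihilator W)" by (auto simp: annihilator_def mult.commute)
  moreover have "vec.dim (annihilator (annihilator W)) = vec.dim W"
    using dim_annihilator[OF W] dim_annihilator[OF subspace_annihilator, of W] by simp
  ultimately have "annihilator (annihilator W) = W"
    using vec.subspace_dim_equal[OF W subspace_annihilator, of "annihilator W"] by simp
  then have "v \<notin> annihilator (annihilator W)" using assms by simp
  then show thesis using that unfolding annihilator_def[of "annihilator W"] by blast
qed

lemma annihilator_span: "annihilator (vec.span S) = annihilator S"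
proof
  show "annihilator (vec.span S) \<subseteq> annihilator S"
    by (auto simp: annihilator_def vec.span_base)
  show "annihilator S \<subseteq> annihilator (vec.span S)"
  proof
    fix y assume y: "y \<in> annihilator S"
    have "S \<subseteq> annihilator {y}" using y by (auto simp: annihilator_def mult.commute)
    then have "vec.span S \<subseteq> annihilator {y}" by (rule vec.span_minimal[OF _ subspace_annihilator])
    then show "y \<in> annihilator (vec.span S)" by (auto simp: annihilator_def mult.commute)
  qed
qed

text \<open>Each \<open>u i\<close> annihilates the span of the other vectors but not
  \<open>w i\<close>, and is scaled to the value 1 there. It serves to make a minor equal to the
  identity matrix at a given point.\<close>

lemma dual_vectors:
  fixes w :: "'i \<Rightarrow> complex ^ 'k::finite"
  assumes inj: "inj_on w I" and ind: "vec.independent (w ` I)"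
  shows "\<exists>u. \<forall>i\<in>I. \<forall>j\<in>I. (\<Sum>k\<in>UNIV. u i $ k * w j $ k) = (if i = j then 1 else 0)"
proof -
  have "\<exists>u. \<forall>j\<in>I. (\<Sum>k\<in>UNIV. u $ k * w j $ k) = (if i = j then 1 else 0)" if i: "i \<in> I" for i
  proof -
    have "w i \<notin> vec.span (w ` I - {w i})" using ind i unfolding vec.dependent_def by blast
    then obtain u where u: "u \<in> annihilator (vec.span (w ` I - {w i}))" "(\<Sum>k\<in>UNIV. u $ k * w i $ k) \<noteq> 0"
      using annihilator_separates[OF vec.subspace_span] by blast
    define c where "c = (\<Sum>k\<in>UNIV. u $ k * w i $ k)"
    have "(\<Sum>k\<in>UNIV. ((1/c) *s u) $ k * w j $ k) = (if i = j then 1 else 0)" if j: "j \<in> I" for j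
    proof -
      have e: "(\<Sum>k\<in>UNIV. ((1/c) *s u) $ k * w j $ k) = (\<Sum>k\<in>UNIV. u $ k * w j $ k) / c"
        by (simp add: sum_divide_distrib)
      show ?thesis
      proof (cases "i = j")
        case True then show ?thesis using e u(2) by (simp add: c_def)
      next
        case False
        then have "w j \<in> w ` I - {w i}" using inj i j by (auto simp: inj_on_def)
        then have "(\<Sum>k\<in>UNIV. u $ k * w j $ k) = 0"
          using vec.span_base[of "w j" "w ` I - {w i}"] u(1) unfolding annihilator_def
          by (auto simp: mult.commute simp del: image_iff)
        then show ?thesis using e False by simp
      qed
    qed
    then show ?thesis by blast
  qed
  then show ?thesis by metis
qed

section \<open>Forms and the Zariski topology\<close>

text \<open>Polynomial functions in prescribed generators. The generators are kept as an argument
  because their number bounds the number of algebraically independent functions.\<close>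

inductive_set polyfuns :: "('t \<Rightarrow> complex) set \<Rightarrow> ('t \<Rightarrow> complex) set" for X where
  const: "(\<lambda>_. c) \<in> polyfuns X"
| gen: "f \<in> X \<Longrightarrow> f \<in> polyfuns X"
| add: "f \<in> polyfuns X \<Longrightarrow> g \<in> polyfuns X \<Longrightarrow> (\<lambda>x. f x + g x) \<in> polyfuns X"
| mult: "f \<in> polyfuns X \<Longrightarrow> g \<in> polyfuns X \<Longrightarrow> (\<lambda>x. f x * g x) \<in> polyfuns X"

lemma polyfuns_sum: "(\<And>i. i \<in> A \<Longrightarrow> f i \<in> polyfuns X) \<Longrightarrow> (\<lambda>x. \<Sum>i\<in>A. f i x) \<in> polyfuns X"
  by (induction A rule: infinite_finite_induct) (auto intro: polyfuns.intros)

lemma polyfuns_prod: "(\<And>i. i \<in> A \<Longrightarrow> f i \<in> polyfuns X) \<Longrightarrow> (\<lambda>x. \<Prod>i\<in>A. f i x) \<in> polyfuns X"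
  by (induction A rule: infinite_finite_induct) (auto intro: polyfuns.intros)

lemma polyfuns_power: "f \<in> polyfuns X \<Longrightarrow> (\<lambda>x. f x ^ n) \<in> polyfuns X"
  by (induction n) (auto intro: polyfuns.intros)

lemma polyfuns_mono: "f \<in> polyfuns X \<Longrightarrow> X \<subseteq> Y \<Longrightarrow> f \<in> polyfuns Y"
  by (induction rule: polyfuns.induct) (auto intro: polyfuns.intros)

lemma finite_exponents [simp]: "finite {a :: 'k::finite \<Rightarrow> nat. (\<Sum>i\<in>UNIV. a i) = d}"
proof (rule finite_subset)
  show "{a :: 'k \<Rightarrow> nat. (\<Sum>i\<in>UNIV. a i) = d} \<subseteq> PiE UNIV (\<lambda>_. {..d})"
  proof
    fix a :: "'k \<Rightarrow> nat" assume "a \<in> {a. (\<Sum>i\<in>UNIV. a i) = d}"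
    then show "a \<in> PiE UNIV (\<lambda>_. {..d})" using member_le_sum[of _ UNIV a] by auto
  qed
  show "finite (PiE (UNIV :: 'k set) (\<lambda>_. {..d}))" by (intro finite_PiE) auto
qed

lemma monom_fun_add: "monom_fun (\<lambda>i. a i + b i) v = monom_fun a v * monom_fun b v"
  by (simp add: monom_fun_def power_add prod.distrib)

lemma monom_fun_scale: "monom_fun a (c *s v) = c ^ (\<Sum>i\<in>UNIV. a i) * monom_fun a v"
  by (simp add: monom_fun_def power_mult_distrib prod.distrib power_sum)

lemma form_monom_fun: "(\<Sum>i\<in>UNIV. a i) = d \<Longrightarrow> form d (monom_fun a)"
  unfolding form_def
proof (intro exI[of _ "\<lambda>b. if b = a then 1 else 0"] ext)
  fix v assume "(\<Sum>i\<in>UNIV. a i) = d"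
  then show "monom_fun a v = (\<Sum>b | (\<Sum>i\<in>UNIV. b i) = d. (if b = a then 1 else 0) * monom_fun b v)"
    by (simp add: if_distrib if_distribR sum.delta cong: if_cong)
qed

lemma form_scale: "form d F \<Longrightarrow> form d (\<lambda>v. c * F v)"
proof -
  assume "form d F"
  then obtain b where "F = (\<lambda>v. \<Sum>a | (\<Sum>i\<in>UNIV. a i) = d. b a * monom_fun a v)" unfolding form_def by auto
  then show ?thesis unfolding form_def
    by (intro exI[of _ "\<lambda>a. c * b a"]) (simp add: sum_distrib_left mult.assoc)
qed

lemma form_add: "form d F \<Longrightarrow> form d G \<Longrightarrow> form d (\<lambda>v. F v + G v)"
proof -
  assume "form d F" "form d G"
  then obtain b c where "F = (\<lambda>v. \<Sum>a | (\<Sum>i\<in>UNIV. a i) = d. b a * monom_fun a v)"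
    "G = (\<lambda>v. \<Sum>a | (\<Sum>i\<in>UNIV. a i) = d. c a * monom_fun a v)" unfolding form_def by auto
  then show ?thesis unfolding form_def
    by (intro exI[of _ "\<lambda>a. b a + c a"]) (auto simp: sum.distrib algebra_simps)
qed

lemma form_zero: "form d (\<lambda>v. 0)"
  unfolding form_def by (intro exI[of _ "\<lambda>_. 0"]) auto

lemma form_sum: "(\<And>i. i \<in> A \<Longrightarrow> form d (f i)) \<Longrightarrow> form d (\<lambda>x. \<Sum>i\<in>A. f i x)"
  by (induction A rule: infinite_finite_induct) (auto intro: form_zero form_add)

lemma formE:
  assumes "form d F"
  obtains c where "F = (\<lambda>v. \<Sum>a | (\<Sum>i\<in>UNIV. a i) = d. c a * monom_fun a v)"
  using assms unfolding form_def by auto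

lemma form_mult: assumes "form d F" "form e G" shows "form (d + e) (\<lambda>v. F v * G v)"
proof -
  obtain b c where F: "F = (\<lambda>v. \<Sum>a | (\<Sum>i\<in>UNIV. a i) = d. b a * monom_fun a v)"
    and G: "G = (\<lambda>v. \<Sum>a | (\<Sum>i\<in>UNIV. a i) = e. c a * monom_fun a v)" using assms by (elim formE)
  have *: "(\<lambda>v. F v * G v) = (\<lambda>v. \<Sum>a | (\<Sum>i\<in>UNIV. a i) = d. \<Sum>a' | (\<Sum>i\<in>UNIV. a' i) = e.
      (b a * c a') * monom_fun (\<lambda>i. a i + a' i) v)"
    unfolding F G sum_product monom_fun_add by (simp add: mult_ac)
  show ?thesis unfolding * by (intro form_sum form_scale form_monom_fun) (auto simp: sum.distrib)
qed

lemma form_const: "form 0 (\<lambda>v. c)"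
  using form_scale[OF form_monom_fun[of "\<lambda>_. 0" 0], of c] by (simp add: monom_fun_def)

lemma form_coord: "form 1 (\<lambda>v :: complex ^ 'k::finite. v $ k)"
proof -
  have "monom_fun (\<lambda>i. if i = k then 1 else 0) v = v $ k" for v :: "complex ^ 'k"
    by (simp add: monom_fun_def if_distrib cong: if_cong)
  then have "monom_fun (\<lambda>i. if i = k then 1 else 0) = (\<lambda>v :: complex ^ 'k. v $ k)" by (rule ext)
  then show ?thesis using form_monom_fun[of "\<lambda>i. if i = k then 1 else 0" 1] by simp
qed

lemma form_linear: "form 1 (\<lambda>v. \<Sum>k\<in>UNIV. u k * v $ k)"
  by (intro form_sum form_scale form_coord)

lemma form_prod: "(\<And>i. i \<in> A \<Longrightarrow> form (d i) (f i)) \<Longrightarrow> form (\<Sum>i\<in>A. d i) (\<lambda>v. \<Prod>i\<in>A. f i v)"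
  by (induction A rule: infinite_finite_induct) (auto intro: form_const form_mult)

lemma form_power: "form d F \<Longrightarrow> form (d * n) (\<lambda>v. F v ^ n)"
  by (induction n) (auto intro: form_const form_mult)

lemma form_compose:
  assumes F: "form d F" and \<Phi>: "\<And>k. form 1 (\<lambda>v. \<Phi> v $ k)"
  shows "form d (\<lambda>v. F (\<Phi> v))"
proof -
  obtain c where c: "F = (\<lambda>v. \<Sum>a | (\<Sum>i\<in>UNIV. a i) = d. c a * monom_fun a v)" using F by (rule formE)
  have "form (\<Sum>i\<in>UNIV. 1 * a i) (\<lambda>v. monom_fun a (\<Phi> v))" for a
    unfolding monom_fun_def by (intro form_prod form_power \<Phi>)
  then show ?thesis unfolding c by (intro form_sum form_scale) auto
qed

lemma form_homogeneous: "form d F \<Longrightarrow> F (c *s v) = c ^ d * F v"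
  by (elim formE) (auto simp: monom_fun_scale sum_distrib_left intro!: sum.cong)

lemma form_in_polyfuns:
  assumes "form d F" and "\<And>k. (\<lambda>x. \<phi> x $ k) \<in> polyfuns X"
  shows "(\<lambda>x. F (\<phi> x)) \<in> polyfuns X"
  using assms(1) unfolding form_def monom_fun_def
  by (auto intro!: polyfuns_sum polyfuns.mult polyfuns.const polyfuns_prod polyfuns_power assms(2))

section \<open>Bihomogeneous polynomials\<close>

lemma biformE:
  assumes "biform d e G"
  obtains c where "G = (\<lambda>v w. \<Sum>a | (\<Sum>i\<in>UNIV. a i) = d. \<Sum>b | (\<Sum>j\<in>UNIV. b j) = e.
       c a b * monom_fun a v * monom_fun b w)"
  using assms unfolding biform_def by auto

lemma biform_monom_fun:
  "(\<Sum>i\<in>UNIV. a i) = d \<Longrightarrow> (\<Sum>i\<in>UNIV. b i) = e \<Longrightarrow> biform d e (\<lambda>v w. c * monom_fun a v * monom_fun b w)"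
  unfolding biform_def
proof (intro exI[of _ "\<lambda>a' b'. if a' = a then (if b' = b then c else 0) else 0"] ext)
  fix v :: "complex ^ 'a" and w :: "complex ^ 'b"
  assume *: "(\<Sum>i\<in>UNIV. a i) = d" "(\<Sum>i\<in>UNIV. b i) = e"
  have inner: "(\<Sum>b' | (\<Sum>j\<in>UNIV. b' j) = e.
        (if a' = a then if b' = b then c else 0 else 0) * monom_fun a' v * monom_fun b' w) =
      (if a' = a then c * monom_fun a v * monom_fun b w else 0)" (is "?l = ?r") for a'
  proof -
    have "?l = (\<Sum>b' | (\<Sum>j\<in>UNIV. b' j) = e. if b' = b then ?r else 0)" by (intro sum.cong) auto
    also have "\<dots> = ?r" unfolding sum.delta[OF finite_exponents] using * by simp
    finally show ?thesis .
  qed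
  show "c * monom_fun a v * monom_fun b w =
      (\<Sum>a' | (\<Sum>i\<in>UNIV. a' i) = d. \<Sum>b' | (\<Sum>j\<in>UNIV. b' j) = e.
        (if a' = a then if b' = b then c else 0 else 0) * monom_fun a' v * monom_fun b' w)"
    unfolding inner sum.delta[OF finite_exponents] using * by simp
qed

lemma biform_zero: "biform d e (\<lambda>v w. 0)"
  unfolding biform_def by (intro exI[of _ "\<lambda>_ _. 0"]) auto

lemma biform_add: assumes "biform d e F" "biform d e G" shows "biform d e (\<lambda>v w. F v w + G v w)"
proof -
  obtain b c where "F = (\<lambda>v w. \<Sum>a | (\<Sum>i\<in>UNIV. a i) = d. \<Sum>a' | (\<Sum>j\<in>UNIV. a' j) = e.
       b a a' * monom_fun a v * monom_fun a' w)"
    "G = (\<lambda>v w. \<Sum>a | (\<Sum>i\<in>UNIV. a i) = d. \<Sum>a' | (\<Sum>j\<in>UNIV. a' j) = e.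
       c a a' * monom_fun a v * monom_fun a' w)" using assms by (elim biformE)
  then show ?thesis unfolding biform_def
    by (intro exI[of _ "\<lambda>a a'. b a a' + c a a'"]) (auto simp: sum.distrib algebra_simps)
qed

lemma biform_sum: "(\<And>i. i \<in> A \<Longrightarrow> biform d e (f i)) \<Longrightarrow> biform d e (\<lambda>v w. \<Sum>i\<in>A. f i v w)"
  by (induction A rule: infinite_finite_induct) (auto intro: biform_zero biform_add)

lemma biform_times:
  assumes "form d F" "form e G" shows "biform d e (\<lambda>v w. F v * G w)"
proof -
  obtain b c where F: "F = (\<lambda>v. \<Sum>a | (\<Sum>i\<in>UNIV. a i) = d. b a * monom_fun a v)"
    and G: "G = (\<lambda>v. \<Sum>a | (\<Sum>i\<in>UNIV. a i) = e. c a * monom_fun a v)" using assms by (elim formE)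
  have *: "(\<lambda>v w. F v * G w) = (\<lambda>v w. \<Sum>a | (\<Sum>i\<in>UNIV. a i) = d. \<Sum>a' | (\<Sum>i\<in>UNIV. a' i) = e.
      (b a * c a') * monom_fun a v * monom_fun a' w)"
    unfolding F G sum_product by (simp add: mult_ac)
  show ?thesis unfolding * by (intro biform_sum biform_monom_fun) auto
qed

lemma biform_left: "form d F \<Longrightarrow> biform d 0 (\<lambda>v w. F v)"
  using biform_times[OF _ form_const[of 1]] by auto

lemma biform_right: "form e G \<Longrightarrow> biform 0 e (\<lambda>v w. G w)"
  using biform_times[OF form_const[of 1]] by auto

lemma biform_mult:
  assumes "biform d e F" "biform d' e' G" shows "biform (d + d') (e + e') (\<lambda>v w. F v w * G v w)"
proof -
  obtain b c where F: "F = (\<lambda>v w. \<Sum>a | (\<Sum>i\<in>UNIV. a i) = d. \<Sum>a' | (\<Sum>j\<in>UNIV. a' j) = e.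
       b a a' * monom_fun a v * monom_fun a' w)"
    and G: "G = (\<lambda>v w. \<Sum>a | (\<Sum>i\<in>UNIV. a i) = d'. \<Sum>a' | (\<Sum>j\<in>UNIV. a' j) = e'.
       c a a' * monom_fun a v * monom_fun a' w)" using assms by (elim biformE)
  have *: "(\<lambda>v w. F v w * G v w) = (\<lambda>v w. \<Sum>a0 | (\<Sum>i\<in>UNIV. a0 i) = d. \<Sum>a1 | (\<Sum>i\<in>UNIV. a1 i) = d'.
      \<Sum>b0 | (\<Sum>i\<in>UNIV. b0 i) = e. \<Sum>b1 | (\<Sum>i\<in>UNIV. b1 i) = e'.
      (b a0 b0 * c a1 b1) * monom_fun (\<lambda>i. a0 i + a1 i) v * monom_fun (\<lambda>i. b0 i + b1 i) w)"
    unfolding F G sum_product monom_fun_add by (simp add: mult_ac)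
  show ?thesis unfolding * by (intro biform_sum biform_monom_fun) (auto simp: sum.distrib)
qed

lemma biform_homogeneous: "biform d e G \<Longrightarrow> G (s *s v) (t *s w) = s ^ d * t ^ e * G v w"
  by (elim biformE) (auto simp: monom_fun_scale sum_distrib_left mult_ac intro!: sum.cong)

lemma form_of_biform: "biform d e G \<Longrightarrow> form d (\<lambda>v. G v w)"
  by (elim biformE) (auto intro!: form_sum form_scale form_monom_fun simp: mult.assoc mult.commute)

text \<open>For \<open>v = 0\<close> this is the zero space, which is not a point of projective
  space; hence the side conditions \<open>v \<noteq> 0\<close> below.\<close>

definition pt :: "complex ^ 'k::finite \<Rightarrow> 'k point" where
  "pt v = range (\<lambda>c. c *s v)"

lemma self_in_pt: "v \<in> pt v"
  unfolding pt_def by (rule range_eqI[of _ _ 1]) simp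

lemma pt_eq_span: "pt v = vec.span {v}"
  unfolding pt_def vec.span_singleton ..

lemma pt_subset_iff: assumes "vec.subspace L" shows "pt v \<subseteq> L \<longleftrightarrow> v \<in> L"
proof
  show "pt v \<subseteq> L \<Longrightarrow> v \<in> L" using self_in_pt by blast
  show "v \<in> L \<Longrightarrow> pt v \<subseteq> L" unfolding pt_eq_span by (rule vec.span_minimal) (auto simp: assms)
qed

lemma proj_eq:
  assumes "vec.subspace L" shows "proj L = {pt v | v. v \<noteq> 0 \<and> v \<in> L}"
proof (intro set_eqI iffI)
  fix p assume "p \<in> proj L"
  then have p: "vec.subspace p" "vec.dim p = 1" "p \<subseteq> L" by (auto simp: proj_def)
  obtain B where B: "B \<subseteq> p" "vec.independent B" "p \<subseteq> vec.span B" "card B = vec.dim p"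
    by (rule vec.basis_exists[of p])
  then obtain v where v: "B = {v}" using p by (auto simp: card_1_singleton_iff)
  have "p = pt v" using B(3) vec.span_minimal[OF B(1) p(1)] v by (simp add: pt_eq_span subset_antisym)
  moreover have "v \<noteq> 0" using B(2) v by simp
  moreover have "v \<in> L" using p(3) B(1) v by auto
  ultimately show "p \<in> {pt v | v. v \<noteq> 0 \<and> v \<in> L}" by blast
next
  fix p assume "p \<in> {pt v | v. v \<noteq> 0 \<and> v \<in> L}"
  then obtain v where v: "p = pt v" "v \<noteq> 0" "v \<in> L" by auto
  then show "p \<in> proj L" unfolding proj_def using pt_subset_iff[OF assms, of v]
    by (simp add: pt_eq_span)
qed

lemma proj_UNIV: "proj UNIV = {pt v | v. v \<noteq> 0}"
  using proj_eq[of UNIV] by simp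

lemma pt_in_proj_UNIV [simp]: "v \<noteq> 0 \<Longrightarrow> pt v \<in> proj UNIV"
  by (auto simp: proj_UNIV)

lemma pt_in_proj_iff: "vec.subspace L \<Longrightarrow> v \<noteq> 0 \<Longrightarrow> pt v \<in> proj L \<longleftrightarrow> v \<in> L"
  using pt_in_proj_UNIV[of v] pt_subset_iff[of L v] by (simp add: proj_def)

lemma pt_eqD:
  assumes "pt v = pt w" "v \<noteq> 0"
  obtains c where "c \<noteq> 0" "v = c *s w"
proof -
  have "v \<in> pt w" using assms(1) self_in_pt[of v] by simp
  then obtain c where "v = c *s w" unfolding pt_def by auto
  then show thesis using assms(2) that[of c] by auto
qed

text \<open>By homogeneity, the condition over a whole line in \<open>zariski\<close> reduces to one
  representative.\<close>

lemma form_nonzero_on_pt: "form d F \<Longrightarrow> (\<exists>u\<in>pt v. F u \<noteq> 0) \<longleftrightarrow> F v \<noteq> 0"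
proof
  assume F: "form d F"
  { assume "\<exists>u\<in>pt v. F u \<noteq> 0"
    then obtain s where "F (s *s v) \<noteq> 0" by (auto simp: pt_def)
    then show "F v \<noteq> 0" using form_homogeneous[OF F, of s v] by auto }
  show "F v \<noteq> 0 \<Longrightarrow> \<exists>u\<in>pt v. F u \<noteq> 0" by (intro bexI[OF _ self_in_pt])
qed

lemma form_zero_on_pt: "form d F \<Longrightarrow> (\<forall>u\<in>pt v. F u = 0) \<longleftrightarrow> F v = 0"
  using form_nonzero_on_pt by blast

lemma biform_nonzero_on_pt: "biform d e G \<Longrightarrow> (\<exists>u\<in>pt v. \<exists>u'\<in>pt w. G u u' \<noteq> 0) \<longleftrightarrow> G v w \<noteq> 0"
proof
  assume G: "biform d e G"
  { assume "\<exists>u\<in>pt v. \<exists>u'\<in>pt w. G u u' \<noteq> 0"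
    then obtain s t where "G (s *s v) (t *s w) \<noteq> 0" by (auto simp: pt_def)
    then show "G v w \<noteq> 0" using biform_homogeneous[OF G, of s v t w] by auto }
  show "G v w \<noteq> 0 \<Longrightarrow> \<exists>u\<in>pt v. \<exists>u'\<in>pt w. G u u' \<noteq> 0" by (intro bexI[OF _ self_in_pt])
qed

text \<open>Induction over the generation of \<open>U\<close>; closure under intersection settles
  the only case in which generators are combined with each other.\<close>

lemma openin_generated_by_base:
  assumes int: "\<And>A B. A \<in> \<B> \<Longrightarrow> B \<in> \<B> \<Longrightarrow> A \<inter> B \<in> \<B>"
    and U: "openin (topology_generated_by \<B>) U" and p: "p \<in> U"
  obtains B where "B \<in> \<B>" "p \<in> B" "B \<subseteq> U"
proof -
  have "generate_topology_on \<B> U" using U by (rule openin_topology_generated_by)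
  then have "\<forall>p\<in>U. \<exists>B\<in>\<B>. p \<in> B \<and> B \<subseteq> U"
  proof induction
    case (Int a b)
    show ?case
    proof
      fix p assume "p \<in> a \<inter> b"
      then obtain A B where "A \<in> \<B>" "p \<in> A" "A \<subseteq> a" "B \<in> \<B>" "p \<in> B" "B \<subseteq> b" using Int.IH by blast
      then show "\<exists>B\<in>\<B>. p \<in> B \<and> B \<subseteq> a \<inter> b" using int[of A B] by (intro bexI[of _ "A \<inter> B"]) auto
    qed
  next
    case (UN K)
    then show ?case by (meson Union_iff Union_upper subset_trans)
  qed auto
  then show thesis using p by (auto intro: that)
qed

section \<open>The Zariski topology of projective space\<close>

lemma openin_zariski_form: "form d F \<Longrightarrow> openin zariski {p \<in> proj UNIV. \<exists>v\<in>p. F v \<noteq> 0}"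
  unfolding zariski_def by (rule topology_generated_by_Basis) blast

lemma topspace_zariski [simp]: "topspace (zariski :: 'a::finite point topology) = proj UNIV"
proof
  have "p \<in> {p \<in> proj UNIV. \<exists>v\<in>p. (1::complex) \<noteq> 0}" if p: "p \<in> proj UNIV" for p :: "'a point"
  proof -
    obtain v where "p = pt v" using p by (auto simp: proj_UNIV)
    then show ?thesis using p by (auto intro: self_in_pt)
  qed
  then show "proj UNIV \<subseteq> topspace (zariski :: 'a point topology)"
    using openin_subset[OF openin_zariski_form[OF form_const[of 1]]] by blast
qed (auto simp: zariski_def)

lemma openin_zariski_base:
  fixes U :: "'a::finite point set"
  assumes U: "openin zariski U" and p: "pt v \<in> U" and v: "v \<noteq> 0"
  obtains d F where "form d F" "F v \<noteq> 0" "\<And>w. w \<noteq> 0 \<Longrightarrow> F w \<noteq> 0 \<Longrightarrow> pt w \<in> U"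
proof -
  let ?B = "{{p :: 'a point. p \<in> proj UNIV \<and> (\<exists>v\<in>p. F v \<noteq> 0)} | d F. form d F}"
  obtain B where B: "B \<in> ?B" "pt v \<in> B" "B \<subseteq> U"
  proof (rule openin_generated_by_base[of ?B U "pt v"])
    fix A A' assume "A \<in> ?B" "A' \<in> ?B"
    then obtain d F e G where *: "form d F" "form e G" "A = {p :: 'a point. p \<in> proj UNIV \<and> (\<exists>v\<in>p. F v \<noteq> 0)}"
      "A' = {p :: 'a point. p \<in> proj UNIV \<and> (\<exists>v\<in>p. G v \<noteq> 0)}"
      unfolding mem_Collect_eq by (elim exE conjE) (rule that)
    \<comment> \<open>Two basic open sets meet in the basic open set of the product of their
      forms.\<close>
    have "A \<inter> A' = {p \<in> proj UNIV. \<exists>v\<in>p. F v * G v \<noteq> 0}"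
    proof (intro set_eqI)
      fix x :: "'a point"
      show "x \<in> A \<inter> A' \<longleftrightarrow> x \<in> {p \<in> proj UNIV. \<exists>v\<in>p. F v * G v \<noteq> 0}"
      proof (cases "x \<in> proj UNIV")
        case True
        then obtain v where x: "x = pt v" by (auto simp: proj_UNIV)
        show ?thesis using True unfolding *(3,4) x
          using form_nonzero_on_pt[OF *(1), of v] form_nonzero_on_pt[OF *(2), of v]
            form_nonzero_on_pt[OF form_mult[OF *(1,2)], of v] by simp
      qed (auto simp: *)
    qed
    then show "A \<inter> A' \<in> ?B"
      by (intro CollectI exI[of _ "d + e"] exI[of _ "\<lambda>v. F v * G v"] conjI form_mult *(1,2))
  qed (use U p in \<open>auto simp: zariski_def\<close>)
  then obtain d F where F: "form d F" "B = {p :: 'a point. p \<in> proj UNIV \<and> (\<exists>v\<in>p. F v \<noteq> 0)}"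
    unfolding mem_Collect_eq by (elim exE conjE) (rule that)
  show thesis
  proof (rule that[OF F(1)])
    show "F v \<noteq> 0" using B(2) form_nonzero_on_pt[OF F(1), of v] unfolding F(2) by simp
    show "pt w \<in> U" if "w \<noteq> 0" "F w \<noteq> 0" for w
      using that B(3) form_nonzero_on_pt[OF F(1), of w] unfolding F(2) by auto
  qed
qed

lemma closedin_zariski_form: "form d F \<Longrightarrow> closedin zariski {p \<in> proj UNIV. \<forall>v\<in>p. F v = 0}"
proof -
  assume "form d F"
  moreover have "proj UNIV - {p \<in> proj UNIV. \<forall>v\<in>p. F v = 0} = {p \<in> proj UNIV. \<exists>v\<in>p. F v \<noteq> 0}" by auto
  ultimately show ?thesis unfolding closedin_def using openin_zariski_form by fastforce
qed

lemma closedin_zariski_separates: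
  assumes K: "closedin zariski K" and "pt v \<notin> K" "v \<noteq> 0"
  obtains d F where "form d F" "F v \<noteq> 0" "\<And>p u. p \<in> K \<Longrightarrow> u \<in> p \<Longrightarrow> F u = 0"
proof -
  have "openin zariski (proj UNIV - K)" "pt v \<in> proj UNIV - K" using assms by (auto simp: closedin_def)
  then obtain d F where F: "form d F" "F v \<noteq> 0" "\<And>w. w \<noteq> 0 \<Longrightarrow> F w \<noteq> 0 \<Longrightarrow> pt w \<in> proj UNIV - K"
    using openin_zariski_base \<open>v \<noteq> 0\<close> by metis
  show thesis
  proof (rule that[OF F(1,2)])
    fix p u assume p: "p \<in> K" "u \<in> p"
    then obtain w where w: "p = pt w" "w \<noteq> 0"
      using closedin_subset[OF K] by (auto simp: proj_UNIV)
    then have "F w = 0" using F(3)[of w] p by auto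
    then show "F u = 0" using form_zero_on_pt[OF F(1), of w] p w by auto
  qed
qed

lemma form_zero_on_closure:
  assumes "form d F" "\<And>p v. p \<in> S \<Longrightarrow> v \<in> p \<Longrightarrow> F v = 0" "p \<in> zariski closure_of S" "v \<in> p"
  shows "F v = 0"
proof -
  have "zariski closure_of (topspace zariski \<inter> S) \<subseteq> {p \<in> proj UNIV. \<forall>v\<in>p. F v = 0}"
    by (intro closure_of_minimal closedin_zariski_form[OF assms(1)]) (use assms(2) in auto)
  then show ?thesis using assms(3,4) unfolding closure_of_restrict[of zariski S] by blast
qed

section \<open>The Zariski topology of a product of two projective spaces\<close>

lemma openin_zariski2_biform:
  "biform d e G \<Longrightarrow> openin zariski2 {(p, q) \<in> proj UNIV \<times> proj UNIV. \<exists>v\<in>p. \<exists>w\<in>q. G v w \<noteq> 0}"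
  unfolding zariski2_def by (rule topology_generated_by_Basis) blast

lemma biform_basic_eq:
  fixes G :: "complex ^ 'a::finite \<Rightarrow> complex ^ 'b::finite \<Rightarrow> complex"
  assumes "biform d e G"
  shows "{(p, q) \<in> proj UNIV \<times> proj UNIV. \<exists>v\<in>p. \<exists>w\<in>q. G v w \<noteq> 0}
    = {(pt v, pt w) | v w. v \<noteq> 0 \<and> w \<noteq> 0 \<and> G v w \<noteq> 0}"
proof (intro set_eqI iffI)
  fix x :: "'a point \<times> 'b point"
  assume x: "x \<in> {(p, q) \<in> proj UNIV \<times> proj UNIV. \<exists>v\<in>p. \<exists>w\<in>q. G v w \<noteq> 0}"
  then obtain v w where "x = (pt v, pt w)" "v \<noteq> 0" "w \<noteq> 0" by (auto simp: proj_UNIV)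
  moreover have "G v w \<noteq> 0" using x calculation biform_nonzero_on_pt[OF assms, of v w] by auto
  ultimately show "x \<in> {(pt v, pt w) | v w. v \<noteq> 0 \<and> w \<noteq> 0 \<and> G v w \<noteq> 0}" by blast
next
  fix x :: "'a point \<times> 'b point"
  assume "x \<in> {(pt v, pt w) | v w. v \<noteq> 0 \<and> w \<noteq> 0 \<and> G v w \<noteq> 0}"
  then obtain v w where "x = (pt v, pt w)" "v \<noteq> 0" "w \<noteq> 0" "G v w \<noteq> 0" by blast
  then show "x \<in> {(p, q) \<in> proj UNIV \<times> proj UNIV. \<exists>v\<in>p. \<exists>w\<in>q. G v w \<noteq> 0}"
    using biform_nonzero_on_pt[OF assms, of v w] by simp
qed

lemma topspace_zariski2 [simp]:
  "topspace (zariski2 :: ('a::finite point \<times> 'b::finite point) topology) = proj UNIV \<times> proj UNIV"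
proof
  have "{(p :: 'a point, q :: 'b point) \<in> proj UNIV \<times> proj UNIV. \<exists>v\<in>p. \<exists>w\<in>q. (1::complex) \<noteq> 0} = proj UNIV \<times> proj UNIV"
    unfolding biform_basic_eq[OF biform_left[OF form_const[of 1]]] by (auto simp: proj_UNIV)
  then show "proj UNIV \<times> proj UNIV \<subseteq> topspace (zariski2 :: ('a point \<times> 'b point) topology)"
    using openin_subset[OF openin_zariski2_biform[OF biform_left[OF form_const[of 1]]]]
    by (rule subst[where P = "\<lambda>s. s \<subseteq> _"])
qed (auto simp: zariski2_def)

lemma openin_zariski2_base:
  fixes U :: "('a::finite point \<times> 'b::finite point) set"
  assumes U: "openin zariski2 U" and p: "(pt v, pt w) \<in> U" and v: "v \<noteq> 0" "w \<noteq> 0"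
  obtains d e G where "biform d e G" "G v w \<noteq> 0"
    "\<And>v w. v \<noteq> 0 \<Longrightarrow> w \<noteq> 0 \<Longrightarrow> G v w \<noteq> 0 \<Longrightarrow> (pt v, pt w) \<in> U"
proof -
  let ?B = "{{(p :: 'a point, q :: 'b point) \<in> proj UNIV \<times> proj UNIV. \<exists>v\<in>p. \<exists>w\<in>q. G v w \<noteq> 0} | d e G. biform d e G}"
  obtain B where B: "B \<in> ?B" "(pt v, pt w) \<in> B" "B \<subseteq> U"
  proof (rule openin_generated_by_base[of ?B U "(pt v, pt w)"])
    fix A A' assume "A \<in> ?B" "A' \<in> ?B"
    then obtain d e F d' e' G where *: "biform d e F" "biform d' e' G"
      "A = {(p :: 'a point, q :: 'b point) \<in> proj UNIV \<times> proj UNIV. \<exists>v\<in>p. \<exists>w\<in>q. F v w \<noteq> 0}"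
      "A' = {(p :: 'a point, q :: 'b point) \<in> proj UNIV \<times> proj UNIV. \<exists>v\<in>p. \<exists>w\<in>q. G v w \<noteq> 0}"
      unfolding mem_Collect_eq by (elim exE conjE) (rule that)
    have "A \<inter> A' = {(p, q) \<in> proj UNIV \<times> proj UNIV. \<exists>v\<in>p. \<exists>w\<in>q. F v w * G v w \<noteq> 0}"
    proof (intro set_eqI)
      fix x :: "'a point \<times> 'b point"
      show "x \<in> A \<inter> A' \<longleftrightarrow> x \<in> {(p, q) \<in> proj UNIV \<times> proj UNIV. \<exists>v\<in>p. \<exists>w\<in>q. F v w * G v w \<noteq> 0}"
      proof (cases "x \<in> proj UNIV \<times> proj UNIV")
        case True
        then obtain v w where x: "x = (pt v, pt w)" by (auto simp: proj_UNIV)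
        show ?thesis using True unfolding *(3,4) x
          using biform_nonzero_on_pt[OF *(1), of v w] biform_nonzero_on_pt[OF *(2), of v w]
            biform_nonzero_on_pt[OF biform_mult[OF *(1,2)], of v w] by simp
      qed (auto simp: *)
    qed
    then show "A \<inter> A' \<in> ?B"
      by (intro CollectI exI[of _ "d + d'"] exI[of _ "e + e'"] exI[of _ "\<lambda>v w. F v w * G v w"] conjI biform_mult *(1,2))
  qed (use U p in \<open>auto simp: zariski2_def\<close>)
  then obtain d e G where G: "biform d e G"
    "B = {(p :: 'a point, q :: 'b point) \<in> proj UNIV \<times> proj UNIV. \<exists>v\<in>p. \<exists>w\<in>q. G v w \<noteq> 0}"
    unfolding mem_Collect_eq by (elim exE conjE) (rule that)
  show thesis
  proof (rule that[OF G(1)])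
    show "G v w \<noteq> 0" using B(2) biform_nonzero_on_pt[OF G(1), of v w] unfolding G(2) by auto
    show "(pt v, pt w) \<in> U" if "v \<noteq> 0" "w \<noteq> 0" "G v w \<noteq> 0" for v w
    proof (rule subsetD[OF B(3)])
      show "(pt v, pt w) \<in> B" unfolding G(2) using that biform_nonzero_on_pt[OF G(1), of v w] by simp
    qed
  qed
qed

lemma biform_zero_on_closure:
  assumes G: "biform d e G" and S: "\<And>v w. v \<noteq> 0 \<Longrightarrow> w \<noteq> 0 \<Longrightarrow> (pt v, pt w) \<in> S \<Longrightarrow> G v w = 0"
    and p: "(pt v, pt w) \<in> zariski2 closure_of S"
  shows "G v w = 0"
proof (rule ccontr)
  assume "G v w \<noteq> 0"
  let ?U = "{(p, q) \<in> proj UNIV \<times> proj UNIV. \<exists>v\<in>p. \<exists>w\<in>q. G v w \<noteq> 0}"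
  have "(pt v, pt w) \<in> proj UNIV \<times> proj UNIV" using subsetD[OF closure_of_subset_topspace p] by simp
  then have "(pt v, pt w) \<in> ?U" using \<open>G v w \<noteq> 0\<close> biform_nonzero_on_pt[OF G, of v w] by simp
  moreover have "\<forall>T. (pt v, pt w) \<in> T \<and> openin zariski2 T \<longrightarrow> (\<exists>y. y \<in> S \<and> y \<in> T)"
    using p by (simp add: in_closure_of)
  ultimately obtain y where y: "y \<in> S" "y \<in> ?U"
    using openin_zariski2_biform[OF G] by meson
  then obtain v' w' where "y = (pt v', pt w')" "v' \<noteq> 0" "w' \<noteq> 0" "G v' w' \<noteq> 0"
    unfolding biform_basic_eq[OF G] mem_Collect_eq by (elim exE conjE) (rule that)
  then show False using S[of v' w'] y(1) by simp
qed

section \<open>Irreducible sets and Krull dimension\<close>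

text \<open>Irreducibility does not depend on the ambient space, so chains in a subspace can be
  built from closures taken in projective space.\<close>

lemma irreducible_in_subtopology:
  "irreducible_in (subtopology T S) A \<longleftrightarrow> irreducible_in T A \<and> A \<subseteq> S"
proof
  assume A: "irreducible_in (subtopology T S) A"
  then have sub: "A \<subseteq> topspace T" "A \<subseteq> S" by (auto simp: irreducible_in_def)
  have "A \<subseteq> K \<or> A \<subseteq> K'" if "closedin T K" "closedin T K'" "A \<subseteq> K \<union> K'" for K K'
  proof -
    have "closedin (subtopology T S) (K \<inter> S)" "closedin (subtopology T S) (K' \<inter> S)"
      using that by (auto simp: closedin_subtopology)
    moreover have "A \<subseteq> (K \<inter> S) \<union> (K' \<inter> S)" using that(3) sub by blast
    ultimately have "A \<subseteq> K \<inter> S \<or> A \<subseteq> K' \<inter> S" using A unfolding irreducible_in_def by meson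
    then show ?thesis by blast
  qed
  then show "irreducible_in T A \<and> A \<subseteq> S" using A sub unfolding irreducible_in_def by meson
next
  assume A: "irreducible_in T A \<and> A \<subseteq> S"
  have "A \<subseteq> K \<or> A \<subseteq> K'"
    if K: "closedin (subtopology T S) K" "closedin (subtopology T S) K'" "A \<subseteq> K \<union> K'" for K K'
  proof -
    obtain C C' where C: "closedin T C" "K = C \<inter> S" "closedin T C'" "K' = C' \<inter> S"
      using K(1,2) unfolding closedin_subtopology by metis
    have "A \<subseteq> C \<union> C'" using K(3) C by blast
    then have "A \<subseteq> C \<or> A \<subseteq> C'" using A C(1,3) unfolding irreducible_in_def by meson
    then show ?thesis using A C by blast
  qed
  then show "irreducible_in (subtopology T S) A" using A unfolding irreducible_in_def by auto
qed

text \<open>A closed set that contains \<open>A\<close> contains its closure, so a covering of the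
  closure by two closed sets is decided on \<open>A\<close>.\<close>

lemma irreducible_in_closure:
  assumes "irreducible_in T A" "A \<subseteq> S" "S \<subseteq> topspace T"
  shows "irreducible_in T (S \<inter> T closure_of A)"
  unfolding irreducible_in_def
proof (intro conjI allI impI)
  have sub: "A \<subseteq> S \<inter> T closure_of A"
    using assms closure_of_subset[of A T] by blast
  then show "S \<inter> T closure_of A \<noteq> {}" using assms(1) unfolding irreducible_in_def by blast
  show "S \<inter> T closure_of A \<subseteq> topspace T" using assms(3) by blast
  fix K K' assume K: "closedin T K \<and> closedin T K' \<and> S \<inter> T closure_of A \<subseteq> K \<union> K'"
  then have "A \<subseteq> K \<or> A \<subseteq> K'" using assms(1) sub unfolding irreducible_in_def by (meson subset_trans)
  then have "T closure_of A \<subseteq> K \<or> T closure_of A \<subseteq> K'" using K closure_of_minimal by metis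
  then show "S \<inter> T closure_of A \<subseteq> K \<or> S \<inter> T closure_of A \<subseteq> K'" by blast
qed

lemma irreducible_in_finite_Union:
  assumes "finite I" "irreducible_in T A" "\<And>i. i \<in> I \<Longrightarrow> closedin T (K i)" "A \<subseteq> (\<Union>i\<in>I. K i)"
  shows "\<exists>i\<in>I. A \<subseteq> K i"
  using assms(1,3,4)
proof (induction I rule: finite_induct)
  case empty
  then show ?case using assms(2) unfolding irreducible_in_def by auto
next
  case (insert x F)
  have "closedin T (\<Union>i\<in>F. K i)" using insert by (intro closedin_Union) auto
  moreover have "A \<subseteq> K x \<union> (\<Union>i\<in>F. K i)" using insert by auto
  moreover have "closedin T (K x)" using insert by auto
  ultimately have "A \<subseteq> K x \<or> A \<subseteq> (\<Union>i\<in>F. K i)" using assms(2) unfolding irreducible_in_def by meson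
  then show ?case using insert by auto
qed

definition vanishes_on :: "(complex ^ 'k::finite \<Rightarrow> complex) \<Rightarrow> 'k point set \<Rightarrow> bool" where
  "vanishes_on F Y \<longleftrightarrow> (\<forall>p\<in>Y. \<forall>v\<in>p. F v = 0)"

text \<open>This is primeness of the homogeneous ideal of \<open>Y\<close>; it permits cancelling
  factors in relations and combining several open conditions.\<close>

lemma irreducible_vanishes_mult:
  fixes Y :: "'k::finite point set"
  assumes Y: "irreducible_in zariski Y" and F: "form d F" and G: "form e G"
    and FG: "vanishes_on (\<lambda>v. F v * G v) Y"
  shows "vanishes_on F Y \<or> vanishes_on G Y"
proof -
  have sub: "Y \<subseteq> proj UNIV" using Y by (simp add: irreducible_in_def)
  let ?Z = "\<lambda>F. {p :: 'k point. p \<in> proj UNIV \<and> (\<forall>v\<in>p. F v = 0)}"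
  have "Y \<subseteq> ?Z F \<union> ?Z G"
  proof
    fix p assume p: "p \<in> Y"
    then obtain v where v: "p = pt v" using sub by (auto simp: proj_UNIV)
    have "F v * G v = 0" using FG p v self_in_pt[of v] unfolding vanishes_on_def by blast
    then show "p \<in> ?Z F \<union> ?Z G" using p sub form_zero_on_pt[OF F, of v] form_zero_on_pt[OF G, of v] v by auto
  qed
  moreover have "closedin zariski (?Z F)" "closedin zariski (?Z G)"
    using closedin_zariski_form[OF F] closedin_zariski_form[OF G] by simp_all
  ultimately have "Y \<subseteq> ?Z F \<or> Y \<subseteq> ?Z G" using Y unfolding irreducible_in_def by meson
  then show ?thesis unfolding vanishes_on_def by blast
qed

lemma irreducible_vanishes_power:
  assumes Y: "irreducible_in zariski Y" and g: "form d g" and "vanishes_on (\<lambda>v. g v ^ n) Y"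
  shows "vanishes_on g Y"
proof (cases "n = 0")
  \<comment> \<open>For \<open>n = 0\<close> the hypothesis says that the constant 1 vanishes on
    \<open>Y\<close>, which is absurd because \<open>Y\<close> is nonempty.\<close>
  case True
  obtain p v where "p \<in> Y" "v \<in> p"
  proof -
    obtain p where p: "p \<in> Y" using Y by (auto simp: irreducible_in_def)
    then obtain v where "p = pt v" using Y by (auto simp: irreducible_in_def proj_UNIV)
    then show thesis using that[OF p] self_in_pt[of v] by simp
  qed
  then show ?thesis using assms(3) True unfolding vanishes_on_def by fastforce
next
  case False
  then show ?thesis using assms(3) unfolding vanishes_on_def by auto
qed

text \<open>Parameters with \<open>\<phi> x = 0\<close> are dropped, since they do not define a
  point.\<close>

definition pset :: "('t \<Rightarrow> complex ^ 'k::finite) \<Rightarrow> 't set \<Rightarrow> 'k point set" where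
  "pset \<phi> E = {pt (\<phi> x) | x. x \<in> E \<and> \<phi> x \<noteq> 0}"

lemma pset_subset_proj: "pset \<phi> E \<subseteq> proj UNIV"
  by (auto simp: pset_def)

lemma pset_mono: "E \<subseteq> E' \<Longrightarrow> pset \<phi> E \<subseteq> pset \<phi> E'"
  by (auto simp: pset_def)

abbreviation coords :: "'u set \<Rightarrow> (('u \<Rightarrow> complex) \<Rightarrow> complex) set" where
  "coords P \<equiv> (\<lambda>u x. x u) ` P"

lemma polyfuns_on_line:
  assumes "f \<in> polyfuns (coords UNIV)"
  shows "\<exists>p :: complex poly. \<forall>t. f (\<lambda>u. x u + t * (y u - x u)) = poly p t"
  using assms
proof induction
  case (const c)
  show ?case by (intro exI[of _ "[:c:]"]) simp
next
  case (gen f)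
  then obtain u where "f = (\<lambda>x. x u)" by auto
  then show ?case by (intro exI[of _ "[:x u, y u - x u:]"]) simp
next
  case (add f g)
  then obtain p q where "\<forall>t. f (\<lambda>u. x u + t * (y u - x u)) = poly p t"
    "\<forall>t. g (\<lambda>u. x u + t * (y u - x u)) = poly q t" by (elim exE)
  then show ?case by (intro exI[of _ "p + q"]) simp
next
  case (mult f g)
  then obtain p q where "\<forall>t. f (\<lambda>u. x u + t * (y u - x u)) = poly p t"
    "\<forall>t. g (\<lambda>u. x u + t * (y u - x u)) = poly q t" by (elim exE)
  then show ?case by (intro exI[of _ "p * q"]) simp
qed

text \<open>Two points of the parameter space lie on a line, on which everything is a polynomial in one variable.\<close>

lemma irreducible_pset:
  fixes \<phi> :: "('u \<Rightarrow> complex) \<Rightarrow> complex ^ 'k::finite"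
  assumes \<phi>: "\<And>k. (\<lambda>x. \<phi> x $ k) \<in> polyfuns (coords UNIV)"
    and E: "\<And>x y t. x \<in> E \<Longrightarrow> y \<in> E \<Longrightarrow> (\<lambda>u. x u + t * (y u - x u)) \<in> E"
    and ne: "x0 \<in> E" "\<phi> x0 \<noteq> 0"
  shows "irreducible_in zariski (pset \<phi> E)"
  unfolding irreducible_in_def
proof (intro conjI allI impI)
  show "pset \<phi> E \<subseteq> topspace zariski" using pset_subset_proj by simp
  show "pset \<phi> E \<noteq> {}" using ne by (auto simp: pset_def)
  fix A B assume AB: "closedin zariski A \<and> closedin zariski B \<and> pset \<phi> E \<subseteq> A \<union> B"
  show "pset \<phi> E \<subseteq> A \<or> pset \<phi> E \<subseteq> B"
  proof (rule ccontr)
    assume "\<not> ?thesis"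
    then obtain p q where pq: "p \<in> pset \<phi> E" "p \<notin> A" "q \<in> pset \<phi> E" "q \<notin> B" by blast
    then obtain x y where x: "p = pt (\<phi> x)" "x \<in> E" "\<phi> x \<noteq> 0" and y: "q = pt (\<phi> y)" "y \<in> E" "\<phi> y \<noteq> 0"
      unfolding pset_def mem_Collect_eq by (elim exE conjE) (rule that)
    obtain d F where F: "form d F" "F (\<phi> x) \<noteq> 0" "\<And>p u. p \<in> A \<Longrightarrow> u \<in> p \<Longrightarrow> F u = 0"
      using closedin_zariski_separates[of A "\<phi> x"] AB x pq by metis
    obtain e G where G: "form e G" "G (\<phi> y) \<noteq> 0" "\<And>p u. p \<in> B \<Longrightarrow> u \<in> p \<Longrightarrow> G u = 0"
      using closedin_zariski_separates[of B "\<phi> y"] AB y pq by metis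
    \<comment> \<open>A coordinate that is nonzero at \<open>x\<close> is carried along as a third
      polynomial, so that the point found on the line has \<open>\<phi>\<close> nonzero and belongs
      to \<open>pset\<close>.\<close>
    obtain k where k: "\<phi> x $ k \<noteq> 0" using x(3) by (auto simp: vec_eq_iff)
    define l where "l t = (\<lambda>u. x u + t * (y u - x u))" for t
    have l01: "l 0 = x" "l 1 = y" by (auto simp: l_def)
    obtain f where f: "\<And>t. F (\<phi> (l t)) = poly f t"
      using polyfuns_on_line[OF form_in_polyfuns[OF F(1) \<phi>], of x y] unfolding l_def by auto
    obtain g where g: "\<And>t. G (\<phi> (l t)) = poly g t"
      using polyfuns_on_line[OF form_in_polyfuns[OF G(1) \<phi>], of x y] unfolding l_def by auto
    obtain h where h: "\<And>t. \<phi> (l t) $ k = poly h t"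
      using polyfuns_on_line[OF \<phi>[of k], of x y] unfolding l_def by auto
    have "f \<noteq> 0" using f[of 0] F(2) l01 by auto
    moreover have "g \<noteq> 0" using g[of 1] G(2) l01 by auto
    moreover have "h \<noteq> 0" using h[of 0] k l01 by auto
    ultimately have "f * g * h \<noteq> 0" by simp
    then obtain t where "poly (f * g * h) t \<noteq> 0" using poly_all_0_iff_0 by blast
    then have t: "F (\<phi> (l t)) \<noteq> 0" "G (\<phi> (l t)) \<noteq> 0" "\<phi> (l t) \<noteq> 0" using f g h[of t] by auto
    have "l t \<in> E" using E[OF x(2) y(2)] by (simp add: l_def)
    then have "pt (\<phi> (l t)) \<in> A \<union> B" using AB t(3) by (auto simp: pset_def)
    then show False using F(3) G(3) t self_in_pt[of "\<phi> (l t)"] by blast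
  qed
qed

section \<open>Chains of irreducible sets and algebraically independent forms\<close>

primrec mon :: "('v \<Rightarrow> complex) list \<Rightarrow> nat list \<Rightarrow> 'v \<Rightarrow> complex" where
  "mon [] es v = 1"
| "mon (g # gs) es v = g v ^ hd es * mon gs (tl es) v"

text \<open>The degree of the form \<open>mon gs es\<close> when the forms \<open>gs\<close> have
  the degrees \<open>ds\<close>.\<close>

primrec wdeg :: "nat list \<Rightarrow> nat list \<Rightarrow> nat" where
  "wdeg [] es = 0"
| "wdeg (d # ds) es = d * hd es + wdeg ds (tl es)"

lemma form_mon: "list_all2 form ds gs \<Longrightarrow> form (wdeg ds es) (mon gs es)"
proof (induction ds gs arbitrary: es rule: list_all2_induct)
  case Nil
  show ?case using form_const[of 1] by simp
next
  case (Cons d ds g gs)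
  show ?case using form_mult[OF form_power[OF Cons(1), of "hd es"] Cons(3)[of "tl es"]] by simp
qed

text \<open>Algebraic independence of the restrictions of \<open>gs\<close> to \<open>Y\<close>,
  tested on relations of one weighted degree \<open>k\<close>. This keeps every relation a form, to
  which irreducibility of \<open>Y\<close> applies.\<close>

definition indep_mons :: "'k::finite point set \<Rightarrow> (complex ^ 'k \<Rightarrow> complex) list \<Rightarrow> nat list \<Rightarrow> bool" where
  "indep_mons Y gs ds \<longleftrightarrow> (\<forall>Es c k. finite Es \<longrightarrow> (\<forall>es\<in>Es. length es = length gs \<and> wdeg ds es = k) \<longrightarrow>
     vanishes_on (\<lambda>v. \<Sum>es\<in>Es. c es * mon gs es v) Y \<longrightarrow> (\<forall>es\<in>Es. c es = 0))"

lemma indep_monsD: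
  assumes "indep_mons Y gs ds" "finite Es" "\<And>es. es \<in> Es \<Longrightarrow> length es = length gs"
    "\<And>es. es \<in> Es \<Longrightarrow> wdeg ds es = k" "vanishes_on (\<lambda>v. \<Sum>es\<in>Es. c es * mon gs es v) Y" "es \<in> Es"
  shows "c es = 0"
  using assms unfolding indep_mons_def by blast

text \<open>Divide a relation on \<open>Y'\<close> by the power of \<open>g\<close> it contains and restrict it to \<open>Y\<close>.\<close>

lemma indep_mons_Cons:
  fixes Y :: "'k::finite point set"
  assumes ind: "indep_mons Y gs ds" and fs: "list_all2 form ds gs" and g: "form d g"
    and Y': "irreducible_in zariski Y'" and sub: "Y \<subseteq> Y'" and gY: "vanishes_on g Y" and gY': "\<not> vanishes_on g Y'"
  shows "indep_mons Y' (g # gs) (d # ds)"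
  unfolding indep_mons_def
proof (intro allI impI)
  fix Es :: "nat list set" and c k
  assume fin: "finite Es" and Es: "\<forall>es\<in>Es. length es = length (g # gs) \<and> wdeg (d # ds) es = k"
    and rel: "vanishes_on (\<lambda>v. \<Sum>es\<in>Es. c es * mon (g # gs) es v) Y'"
  have "\<forall>es\<in>Es. hd es = j \<longrightarrow> c es = 0" for j
  \<comment> \<open>Coefficients with a smaller exponent of \<open>g\<close> already vanish, so the
    relation has the factor \<open>g v ^ j\<close>, and \<open>R\<close> is the quotient.\<close>
  proof (induction j rule: less_induct)
    case (less j)
    define R where "R v = (\<Sum>es\<in>Es. if hd es \<ge> j then c es * (g v ^ (hd es - j) * mon gs (tl es) v) else 0)" for v
    have R: "(\<Sum>es\<in>Es. c es * mon (g # gs) es v) = g v ^ j * R v" for v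
      unfolding R_def sum_distrib_left
    proof (intro sum.cong refl)
      fix es assume es: "es \<in> Es"
      show "c es * mon (g # gs) es v = g v ^ j * (if j \<le> hd es then c es * (g v ^ (hd es - j) * mon gs (tl es) v) else 0)"
      proof (cases "j \<le> hd es")
        case True
        then have "g v ^ hd es = g v ^ j * g v ^ (hd es - j)" by (simp flip: power_add)
        then show ?thesis using True by simp
      next
        case False
        then have "c es = 0" using less.IH[of "hd es"] es by auto
        then show ?thesis by simp
      qed
    qed
    have fR: "form (k - d * j) R"
      unfolding R_def
    proof (rule form_sum)
      fix es assume es: "es \<in> Es"
      show "form (k - d * j) (\<lambda>v. if j \<le> hd es then c es * (g v ^ (hd es - j) * mon gs (tl es) v) else 0)"
      proof (cases "j \<le> hd es")
        case True
        have "form (d * (hd es - j) + wdeg ds (tl es)) (\<lambda>v. g v ^ (hd es - j) * mon gs (tl es) v)"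
          by (intro form_mult form_power g form_mon fs)
        moreover have "d * (hd es - j) + wdeg ds (tl es) = k - d * j"
          using Es es True by (auto simp: diff_mult_distrib2)
        ultimately have "form (k - d * j) (\<lambda>v. c es * (g v ^ (hd es - j) * mon gs (tl es) v))" by (intro form_scale) simp
        then show ?thesis using True by simp
      qed (simp add: form_zero)
    qed
    have "vanishes_on (\<lambda>v. g v ^ j * R v) Y'" using rel unfolding R .
    then have "vanishes_on (\<lambda>v. g v ^ j) Y' \<or> vanishes_on R Y'"
      by (rule irreducible_vanishes_mult[OF Y' form_power[OF g] fR])
    then have RY': "vanishes_on R Y'" using irreducible_vanishes_power[OF Y' g] gY' by blast
    \<comment> \<open>Where \<open>g\<close> vanishes, the quotient retains only the terms with
      exponent exactly \<open>j\<close>; \<open>Es1\<close> holds their exponents for the other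
      forms.\<close>
    define Es1 where "Es1 = {es. j # es \<in> Es}"
    have "Es1 \<subseteq> tl ` Es" by (force simp: Es1_def)
    then have fin1: "finite Es1" using fin finite_subset by blast
    have im: "(#) j ` Es1 = {es \<in> Es. hd es = j}"
    proof
      show "{es \<in> Es. hd es = j} \<subseteq> (#) j ` Es1"
      proof
        fix es assume es: "es \<in> {es \<in> Es. hd es = j}"
        then have "es \<noteq> []" using Es by auto
        then have "es = j # tl es" using es by (metis (mono_tags, lifting) list.collapse mem_Collect_eq)
        then show "es \<in> (#) j ` Es1" using es by (metis (mono_tags, lifting) Es1_def imageI mem_Collect_eq)
      qed
    qed (auto simp: Es1_def)
    have eq: "R v = (\<Sum>es\<in>Es1. c (j # es) * mon gs es v)" if "g v = 0" for v
    proof -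
      have "R v = (\<Sum>es\<in>{es \<in> Es. hd es = j}. c es * mon gs (tl es) v)"
        unfolding R_def
      proof (intro sum.mono_neutral_cong_right fin)
        show "\<forall>es\<in>Es - {es \<in> Es. hd es = j}. (if j \<le> hd es then c es * (g v ^ (hd es - j) * mon gs (tl es) v) else 0) = 0"
          using that by auto
      qed auto
      also have "\<dots> = (\<Sum>es\<in>Es1. c (j # es) * mon gs es v)"
        unfolding im[symmetric] by (subst sum.reindex) auto
      finally show ?thesis .
    qed
    have van: "vanishes_on (\<lambda>v. \<Sum>es\<in>Es1. c (j # es) * mon gs es v) Y"
      unfolding vanishes_on_def
    proof (intro ballI)
      fix p v assume p: "p \<in> Y" "v \<in> p"
      have "g v = 0" "R v = 0" using p gY RY' sub unfolding vanishes_on_def by blast+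
      then show "(\<Sum>es\<in>Es1. c (j # es) * mon gs es v) = 0" using eq by simp
    qed
    show ?case
    proof (intro ballI impI)
      fix es assume es: "es \<in> Es" "hd es = j"
      then have "es \<in> (#) j ` Es1" using im by simp
      then obtain es1 where es1: "es = j # es1" "es1 \<in> Es1" by blast
      have "c (j # es1) = 0"
      proof (rule indep_monsD[OF ind fin1 _ _ van es1(2)])
        fix es' assume "es' \<in> Es1"
        then have e: "length (j # es') = length (g # gs) \<and> wdeg (d # ds) (j # es') = k" using Es unfolding Es1_def by blast
        show "length es' = length gs" using e by simp
        have "d * j + wdeg ds es' = k" using e by simp
        then show "wdeg ds es' = k - d * j" by linarith
      qed
      then show "c es = 0" using es1 by simp
    qed
  qed
  then show "\<forall>es\<in>Es. c es = 0" by blast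
qed

text \<open>The bottom of a chain: for one form of degree 1, a fixed weight admits only one
  monomial.\<close>

lemma indep_mons_single:
  assumes Y: "irreducible_in zariski Y" and g: "form 1 g" and gY: "\<not> vanishes_on g Y"
  shows "indep_mons Y [g] [1]"
  unfolding indep_mons_def
proof (intro allI impI)
  fix Es :: "nat list set" and c k
  assume fin: "finite Es" and Es: "\<forall>es\<in>Es. length es = length [g] \<and> wdeg [1] es = k"
    and rel: "vanishes_on (\<lambda>v. \<Sum>es\<in>Es. c es * mon [g] es v) Y"
  have Esk: "es = [k]" if "es \<in> Es" for es
  proof -
    have "length es = 1" "hd es = k" using Es that by auto
    then show ?thesis by (cases es) auto
  qed
  show "\<forall>es\<in>Es. c es = 0"
  proof
    fix es assume es: "es \<in> Es"
    then have "Es = {[k]}" using Esk by blast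
    then have "vanishes_on (\<lambda>v. c [k] * g v ^ k) Y" using rel by simp
    moreover have "\<not> vanishes_on (\<lambda>v. g v ^ k) Y" using irreducible_vanishes_power[OF Y g] gY by blast
    ultimately show "c es = 0" using Esk[OF es] unfolding vanishes_on_def by auto
  qed
qed

definition zchain :: "'k::finite point set \<Rightarrow> 'k point set list \<Rightarrow> bool" where
  "zchain S C \<longleftrightarrow> sorted_wrt (\<subset>) C \<and>
     (\<forall>A\<in>set C. closedin (subtopology zariski S) A \<and> irreducible_in (subtopology zariski S) A)"

lemma zdim_eq_Sup: "zdim S = int (Sup {length C | C. zchain S C}) - 1"
  by (simp add: zdim_def krull_dim_def zchain_def)

text \<open>Going up the chain, each larger set contributes a form that vanishes on its predecessor
  but not on itself; the smallest set contributes a coordinate that does not vanish on it.\<close>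

lemma chain_indep_mons:
  assumes "sorted_wrt (\<lambda>A B. B \<subset> A) Ds" "Ds \<noteq> []"
    "\<forall>A\<in>set Ds. closedin (subtopology zariski S) A \<and> irreducible_in zariski A"
  shows "\<exists>gs ds. length gs = length Ds \<and> list_all2 form ds gs \<and> indep_mons (hd Ds) gs ds"
  using assms(2,1,3)
proof (induction Ds rule: list_nonempty_induct)
  case (single A)
  then have A: "irreducible_in zariski A" by simp
  then obtain p where "p \<in> A" "p \<in> proj UNIV" by (auto simp: irreducible_in_def)
  then obtain v where v: "pt v \<in> A" "v \<noteq> 0" by (auto simp: proj_UNIV)
  then obtain i where "v $ i \<noteq> 0" by (auto simp: vec_eq_iff)
  then have "\<not> vanishes_on (\<lambda>v. v $ i) A" unfolding vanishes_on_def using v self_in_pt[of v] by blast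
  then have "indep_mons A [\<lambda>v. v $ i] [1]" by (intro indep_mons_single A form_coord)
  then show ?case using form_coord by (intro exI[of _ "[\<lambda>v. v $ i]"] exI[of _ "[1]"]) auto
next
  case (cons A Ds)
  then obtain gs ds where IH: "length gs = length Ds" "list_all2 form ds gs" "indep_mons (hd Ds) gs ds" by auto
  have hd: "hd Ds \<in> set Ds" using cons by simp
  then have lt: "hd Ds \<subset> A" using cons by simp
  obtain p where p: "p \<in> A" "p \<notin> hd Ds" using lt by blast
  have A: "irreducible_in zariski A" using cons by simp
  then have "p \<in> proj UNIV" using p by (auto simp: irreducible_in_def)
  then obtain v where v: "p = pt v" "v \<noteq> 0" by (auto simp: proj_UNIV)
  have "closedin (subtopology zariski S) (hd Ds)" "closedin (subtopology zariski S) A" using cons hd by auto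
  then obtain K K' where K: "closedin zariski K" "hd Ds = K \<inter> S" "A = K' \<inter> S"
    unfolding closedin_subtopology by metis
  then have "p \<notin> K" using p by blast
  then obtain d g where g: "form d g" "g v \<noteq> 0" "\<And>p u. p \<in> K \<Longrightarrow> u \<in> p \<Longrightarrow> g u = 0"
    using closedin_zariski_separates[OF K(1), of v] v by metis
  have "indep_mons A (g # gs) (d # ds)"
  proof (rule indep_mons_Cons[OF IH(3,2) g(1) A])
    show "hd Ds \<subseteq> A" using lt by blast
    show "vanishes_on g (hd Ds)" unfolding vanishes_on_def using g(3) K(2) by blast
    show "\<not> vanishes_on g A" unfolding vanishes_on_def using g(2) p(1) v self_in_pt[of v] by blast
  qed
  then show ?case using IH g(1) by (intro exI[of _ "g # gs"] exI[of _ "d # ds"]) simp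
qed

text \<open>Elimination: the equation \<open>b\<close> is solved for the unknown \<open>e0\<close>,
  which turns the remaining equations into those with coefficients \<open>M'\<close>.\<close>

lemma nontrivial_solution:
  fixes M :: "'e \<Rightarrow> 'b \<Rightarrow> complex"
  assumes "finite B" "finite Es" "card B < card Es"
  shows "\<exists>c. (\<exists>e\<in>Es. c e \<noteq> 0) \<and> (\<forall>b\<in>B. (\<Sum>e\<in>Es. c e * M e b) = 0)"
  using assms
proof (induction B arbitrary: Es M rule: finite_induct)
  case empty
  then obtain e where "e \<in> Es" by (metis card.empty less_irrefl ex_in_conv)
  then show ?case by (intro exI[of _ "\<lambda>_. 1"]) auto
next
  case (insert b B)
  show ?case
  proof (cases "\<forall>e\<in>Es. M e b = 0")
    case True
    have "card B < card Es" using insert by simp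
    from insert.IH[OF insert.prems(1) this, of M] obtain c where
      "\<exists>e\<in>Es. c e \<noteq> 0" "\<forall>b\<in>B. (\<Sum>e\<in>Es. c e * M e b) = 0" by (elim exE conjE)
    then show ?thesis using True by (intro exI[of _ c]) auto
  next
    case False
    then obtain e0 where e0: "e0 \<in> Es" "M e0 b \<noteq> 0" by blast
    define M' where "M' e b' = M e b' - M e b / M e0 b * M e0 b'" for e b'
    have "card B < card (Es - {e0})" using insert e0 by simp
    from insert.IH[OF _ this, of M'] insert.prems(1) obtain c where
      c: "\<exists>e\<in>Es - {e0}. c e \<noteq> 0" "\<forall>b\<in>B. (\<Sum>e\<in>Es - {e0}. c e * M' e b) = 0" by auto
    define s where "s = (\<Sum>e\<in>Es - {e0}. c e * M e b) / M e0 b"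
    define c' where "c' e = (if e = e0 then - s else c e)" for e
    have sum: "(\<Sum>e\<in>Es. c' e * M e b') = (\<Sum>e\<in>Es - {e0}. c e * M e b') - s * M e0 b'" for b'
    proof -
      have "(\<Sum>e\<in>Es. c' e * M e b') = c' e0 * M e0 b' + (\<Sum>e\<in>Es - {e0}. c' e * M e b')"
        by (rule sum.remove[OF insert.prems(1) e0(1)])
      also have "(\<Sum>e\<in>Es - {e0}. c' e * M e b') = (\<Sum>e\<in>Es - {e0}. c e * M e b')"
        by (intro sum.cong) (auto simp: c'_def)
      finally show ?thesis by (simp add: c'_def)
    qed
    have "(\<Sum>e\<in>Es. c' e * M e b') = 0" if "b' \<in> insert b B" for b'
    proof (cases "b' = b")
      case True
      then show ?thesis using e0(2) by (simp add: sum s_def)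
    next
      case False
      then have "0 = (\<Sum>e\<in>Es - {e0}. c e * M' e b')" using c(2) that by simp
      also have "\<dots> = (\<Sum>e\<in>Es - {e0}. c e * M e b') - s * M e0 b'"
        by (simp add: M'_def s_def algebra_simps sum_subtractf sum_distrib_left sum_distrib_right sum_divide_distrib)
      finally show ?thesis by (simp add: sum)
    qed
    moreover have "\<exists>e\<in>Es. c' e \<noteq> 0" using c(1) by (auto simp: c'_def)
    ultimately show ?thesis by (intro exI[of _ c']) blast
  qed
qed

text \<open>Bounding the degree in each generator separately makes the exponents a product set, so
  there are \<open>(e + 1) ^ card X\<close> of them.\<close>

definition poly_box :: "('t \<Rightarrow> complex) set \<Rightarrow> nat \<Rightarrow> ('t \<Rightarrow> complex) \<Rightarrow> bool" where
  "poly_box X e f \<longleftrightarrow> (\<exists>c. \<forall>x. f x = (\<Sum>k\<in>PiE X (\<lambda>_. {..e}). c k * (\<Prod>h\<in>X. h x ^ k h)))"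

context
  fixes X :: "('t \<Rightarrow> complex) set"
  assumes fX: "finite X"
begin

lemma poly_box_monom:
  assumes "\<And>h. h \<in> X \<Longrightarrow> k h \<le> e"
  shows "poly_box X e (\<lambda>x. a * (\<Prod>h\<in>X. h x ^ k h))"
  unfolding poly_box_def
proof (intro exI allI)
  fix x
  let ?S = "PiE X (\<lambda>_. {..e})"
  \<comment> \<open>Members of \<open>PiE\<close> are undefined outside \<open>X\<close>, so the
    exponent has to be cut down by \<open>restrict\<close>.\<close>
  have "(\<Sum>k'\<in>?S. (if k' = restrict k X then a else 0) * (\<Prod>h\<in>X. h x ^ k' h)) =
      (\<Sum>k'\<in>?S. if k' = restrict k X then a * (\<Prod>h\<in>X. h x ^ k h) else 0)"
    by (intro sum.cong) (auto intro!: prod.cong)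
  also have "\<dots> = a * (\<Prod>h\<in>X. h x ^ k h)"
    using assms fX by (subst sum.delta) (auto intro!: finite_PiE)
  finally show "a * (\<Prod>h\<in>X. h x ^ k h) = (\<Sum>k'\<in>?S. (if k' = restrict k X then a else 0) * (\<Prod>h\<in>X. h x ^ k' h))" by simp
qed

lemma poly_box_add: assumes "poly_box X e f" "poly_box X e g" shows "poly_box X e (\<lambda>x. f x + g x)"
proof -
  obtain b c where "\<forall>x. f x = (\<Sum>k\<in>PiE X (\<lambda>_. {..e}). b k * (\<Prod>h\<in>X. h x ^ k h))"
    "\<forall>x. g x = (\<Sum>k\<in>PiE X (\<lambda>_. {..e}). c k * (\<Prod>h\<in>X. h x ^ k h))"
    using assms unfolding poly_box_def by (elim exE)
  then show ?thesis unfolding poly_box_def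
    by (intro exI[of _ "\<lambda>k. b k + c k"]) (simp add: sum.distrib algebra_simps)
qed

lemma poly_box_zero: "poly_box X e (\<lambda>x. 0)"
  unfolding poly_box_def by (intro exI[of _ "\<lambda>_. 0"]) simp

lemma poly_box_sum: "(\<And>i. i \<in> A \<Longrightarrow> poly_box X e (f i)) \<Longrightarrow> poly_box X e (\<lambda>x. \<Sum>i\<in>A. f i x)"
  by (induction A rule: infinite_finite_induct) (auto intro: poly_box_zero poly_box_add)

lemma poly_box_mono: assumes "poly_box X e f" "e \<le> e'" shows "poly_box X e' f"
proof -
  obtain c where "\<forall>x. f x = (\<Sum>k\<in>PiE X (\<lambda>_. {..e}). c k * (\<Prod>h\<in>X. h x ^ k h))"
    using assms unfolding poly_box_def by (elim exE)
  then have "f = (\<lambda>x. \<Sum>k\<in>PiE X (\<lambda>_. {..e}). c k * (\<Prod>h\<in>X. h x ^ k h))" by auto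
  then show ?thesis using assms(2) by (auto intro!: poly_box_sum poly_box_monom intro: order_trans[OF _ assms(2)] dest: PiE_mem)
qed

lemma poly_box_mult: assumes "poly_box X e f" "poly_box X e' g" shows "poly_box X (e + e') (\<lambda>x. f x * g x)"
proof -
  obtain b c where bc: "\<forall>x. f x = (\<Sum>k\<in>PiE X (\<lambda>_. {..e}). b k * (\<Prod>h\<in>X. h x ^ k h))"
    "\<forall>x. g x = (\<Sum>k\<in>PiE X (\<lambda>_. {..e'}). c k * (\<Prod>h\<in>X. h x ^ k h))"
    using assms unfolding poly_box_def by (elim exE)
  have "(\<lambda>x. f x * g x) = (\<lambda>x. \<Sum>k\<in>PiE X (\<lambda>_. {..e}). \<Sum>k'\<in>PiE X (\<lambda>_. {..e'}).
      (b k * c k') * (\<Prod>h\<in>X. h x ^ (k h + k' h)))"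
    by (simp add: bc sum_product power_add prod.distrib mult_ac)
  moreover have "poly_box X (e + e') \<dots>"
    by (intro poly_box_sum poly_box_monom add_mono) (auto dest: PiE_mem)
  ultimately show ?thesis by simp
qed

lemma poly_box_const: "poly_box X e (\<lambda>x. a)"
  using poly_box_monom[of "\<lambda>_. 0" e a] by simp

lemma poly_box_power: "poly_box X e f \<Longrightarrow> poly_box X (e * n) (\<lambda>x. f x ^ n)"
  by (induction n) (auto intro: poly_box_const poly_box_mult)

lemma poly_box_mon:
  "\<forall>g\<in>set gs. poly_box X e g \<Longrightarrow> length es = length gs \<Longrightarrow> poly_box X (e * sum_list es) (mon gs es)"
proof (induction gs arbitrary: es)
  case (Cons g gs)
  then obtain n es' where es: "es = n # es'" by (cases es) auto
  have "poly_box X (e * n + e * sum_list es') (\<lambda>x. g x ^ n * mon gs es' x)"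
    using Cons es by (intro poly_box_mult poly_box_power Cons.IH) auto
  moreover have "mon (g # gs) es = (\<lambda>x. g x ^ n * mon gs es' x)" by (simp add: es fun_eq_iff)
  ultimately show ?case by (simp add: es algebra_simps)
next
  case Nil
  then show ?case using poly_box_const[of 0 1] by simp
qed

lemma polyfuns_poly_box: "f \<in> polyfuns X \<Longrightarrow> \<exists>e. poly_box X e f"
proof (induction rule: polyfuns.induct)
  case (const c)
  show ?case using poly_box_const by blast
next
  case (gen f)
  have "poly_box X 1 (\<lambda>x. 1 * (\<Prod>h\<in>X. h x ^ (if h = f then 1 else 0)))"
    by (rule poly_box_monom) auto
  moreover have "(\<Prod>h\<in>X. h x ^ (if h = f then 1 else 0)) = f x" for x
  proof -
    have "(\<Prod>h\<in>X. h x ^ (if h = f then 1 else 0)) = (\<Prod>h\<in>X. if h = f then f x else 1)"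
      by (intro prod.cong) auto
    then show ?thesis using gen fX by simp
  qed
  ultimately show ?case by (intro exI[of _ 1]) simp
next
  case (add f g)
  then obtain e e' where "poly_box X e f" "poly_box X e' g" by blast
  then have "poly_box X (max e e') f" "poly_box X (max e e') g" by (auto intro: poly_box_mono)
  then show ?case using poly_box_add by blast
next
  case (mult f g)
  then show ?case using poly_box_mult by blast
qed

text \<open>There are \<open>t^s\<close> monomials in \<open>s\<close> functions with exponents below \<open>t\<close>, but they lie in a space of dimension \<open>O(t^card X)\<close>.\<close>

lemma algebraic_dependence:
  assumes gs: "\<forall>g\<in>set gs. g \<in> polyfuns X" and lt: "card X < length gs"
  obtains Es c where "finite Es" "\<And>es. es \<in> Es \<Longrightarrow> length es = length gs" "\<exists>es\<in>Es. c es \<noteq> 0"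
    "\<And>x. (\<Sum>es\<in>Es. c es * mon gs es x) = 0"
proof -
  have "\<exists>E. \<forall>g\<in>set gs. poly_box X E g" using gs
  proof (induction gs)
    case (Cons g gs)
    then obtain E e where "\<forall>g\<in>set gs. poly_box X E g" "poly_box X e g" using polyfuns_poly_box[of g] by auto
    then show ?case by (intro exI[of _ "max E e"]) (auto intro: poly_box_mono)
  qed simp
  then obtain E where E: "\<forall>g\<in>set gs. poly_box X E g" by blast
  define s D where "s = length gs" and "D = card X"
  \<comment> \<open>The choice of \<open>t\<close> gives (N + 1)^D \<le> (E s + 1)^D t^D < t^(D + 1)
    \<le> t^s. Here N bounds the degree in each generator: there are s exponents below t, and each
    function has degree at most E in every generator.\<close>
  define t where "t = (E * s + 1) ^ D + 1"
  define Es where "Es = {es. set es \<subseteq> {..<t} \<and> length es = s}"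
  define N where "N = E * (s * t)"
  let ?B = "PiE X (\<lambda>_. {..N})"
  have fEs: "finite Es" unfolding Es_def by (rule finite_lists_length_eq) simp
  have cEs: "card Es = t ^ s" unfolding Es_def by (subst card_lists_length_eq) auto
  have fB: "finite ?B" using fX by (intro finite_PiE) auto
  have cB: "card ?B = (N + 1) ^ D" using fX by (simp add: card_PiE D_def)
  have "(N + 1) ^ D < t ^ s"
  proof -
    have "1 \<le> t" by (simp add: t_def)
    then have "N + 1 \<le> (E * s + 1) * t" unfolding N_def by (simp add: algebra_simps)
    then have "(N + 1) ^ D \<le> ((E * s + 1) * t) ^ D" by (intro power_mono) auto
    also have "\<dots> = (E * s + 1) ^ D * t ^ D" by (rule power_mult_distrib)
    also have "\<dots> < t * t ^ D"
    proof (rule mult_strict_right_mono)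
      show "(E * s + 1) ^ D < t" "0 < t ^ D" by (simp_all add: t_def)
    qed
    also have "\<dots> = t ^ Suc D" by simp
    also have "\<dots> \<le> t ^ s"
    proof (rule power_increasing)
      show "Suc D \<le> s" using lt by (simp add: s_def D_def)
      show "1 \<le> t" by (simp add: t_def)
    qed
    finally show ?thesis .
  qed
  then have card: "card ?B < card Es" by (simp only: cEs cB)
  have "\<exists>b. \<forall>x. mon gs es x = (\<Sum>k\<in>?B. b k * (\<Prod>h\<in>X. h x ^ k h))" if "es \<in> Es" for es
  proof -
    have "sum_list es \<le> s * t"
    proof -
      have "\<forall>x\<in>set es. x \<le> t" using that by (auto simp: Es_def)
      then have "sum_list es \<le> length es * t" by (induction es) auto
      then show ?thesis using that by (simp add: Es_def)
    qed
    then have "poly_box X N (mon gs es)"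
      using poly_box_mono[OF poly_box_mon[OF E, of es]] that unfolding N_def Es_def s_def by simp
    then show ?thesis unfolding poly_box_def .
  qed
  then have "\<forall>es\<in>Es. \<exists>b. \<forall>x. mon gs es x = (\<Sum>k\<in>?B. b k * (\<Prod>h\<in>X. h x ^ k h))" by (rule ballI)
  from bchoice[OF this] obtain M where
    M: "\<And>es x. es \<in> Es \<Longrightarrow> mon gs es x = (\<Sum>k\<in>?B. M es k * (\<Prod>h\<in>X. h x ^ k h))"
    by (elim exE) (rule that, simp)
  obtain c where c: "\<exists>es\<in>Es. c es \<noteq> 0" "\<forall>k\<in>?B. (\<Sum>es\<in>Es. c es * M es k) = 0"
    using nontrivial_solution[OF fB fEs card, of M] by (elim exE conjE)
  show thesis
  proof (rule that[OF fEs _ c(1)])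
    show "length es = length gs" if "es \<in> Es" for es using that by (simp add: Es_def s_def)
    fix x
    have "(\<Sum>es\<in>Es. c es * mon gs es x) = (\<Sum>es\<in>Es. \<Sum>k\<in>?B. c es * M es k * (\<Prod>h\<in>X. h x ^ k h))"
      by (intro sum.cong) (auto simp: M sum_distrib_left mult.assoc)
    also have "\<dots> = (\<Sum>k\<in>?B. \<Sum>es\<in>Es. c es * M es k * (\<Prod>h\<in>X. h x ^ k h))" by (rule sum.swap)
    also have "\<dots> = (\<Sum>k\<in>?B. (\<Sum>es\<in>Es. c es * M es k) * (\<Prod>h\<in>X. h x ^ k h))"
      by (simp only: sum_distrib_right)
    also have "\<dots> = 0" using c(2) by simp
    finally show "(\<Sum>es\<in>Es. c es * mon gs es x) = 0" .
  qed
qed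

end

lemma mon_comp: "mon (map (\<lambda>g x. g (\<phi> x)) gs) es x = mon gs es (\<phi> x)"
  by (induction gs arbitrary: es) auto

lemma mon_scale:
  "list_all2 form ds gs \<Longrightarrow> mon gs es (s *s v) = s ^ wdeg ds es * mon gs es v"
  using form_homogeneous[OF form_mon] by blast

text \<open>The largest set of the chain is irreducible, hence lies in the closure of one chart.
  More than \<open>D\<close> forms pulled back to it satisfy a polynomial relation, and a
  homogeneous part of this relation contradicts \<open>chain_indep_mons\<close>.\<close>

lemma zchain_length_le:
  fixes S :: "'k::finite point set" and \<phi> :: "'i \<Rightarrow> 't \<Rightarrow> complex ^ 'k"
  assumes I: "finite I" and X: "\<And>i. i \<in> I \<Longrightarrow> finite (X i) \<and> card (X i) \<le> D"
    and poly: "\<And>i k. i \<in> I \<Longrightarrow> (\<lambda>x. \<phi> i x $ k) \<in> polyfuns (X i)"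
    and cone: "\<And>i x s. i \<in> I \<Longrightarrow> \<exists>x'. \<phi> i x' = s *s \<phi> i x"
    and S: "S \<subseteq> (\<Union>i\<in>I. pset (\<phi> i) UNIV)"
    and C: "zchain S C"
  shows "length C \<le> D"
proof (rule ccontr)
  assume "\<not> length C \<le> D"
  then have lt: "D < length C" by simp
  define Ds where "Ds = rev C"
  have Ds: "sorted_wrt (\<lambda>A B. B \<subset> A) Ds" "Ds \<noteq> []"
    "\<forall>A\<in>set Ds. closedin (subtopology zariski S) A \<and> irreducible_in zariski A"
    using C lt by (auto simp: Ds_def zchain_def sorted_wrt_rev irreducible_in_subtopology)
  define Y where "Y = hd Ds"
  obtain gs ds where gs: "length gs = length Ds" "list_all2 form ds gs" "indep_mons Y gs ds"
    using chain_indep_mons[OF Ds] unfolding Y_def by blast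
  have Ym: "Y \<in> set Ds" using Ds(2) by (simp add: Y_def)
  have Y: "irreducible_in zariski Y" using Ds(3) Ym by blast
  have "Y \<subseteq> S" using Ds(3) Ym by (auto simp: closedin_subtopology)
  also have "\<dots> \<subseteq> (\<Union>i\<in>I. zariski closure_of pset (\<phi> i) UNIV)"
  proof -
    have "pset (\<phi> i) UNIV \<subseteq> zariski closure_of pset (\<phi> i) UNIV" for i
      by (rule closure_of_subset) (simp add: pset_subset_proj)
    then show ?thesis using S by blast
  qed
  finally have "\<exists>i\<in>I. Y \<subseteq> zariski closure_of pset (\<phi> i) UNIV"
    by (rule irreducible_in_finite_Union[OF I Y closedin_closure_of])
  then obtain i where i: "i \<in> I" "Y \<subseteq> zariski closure_of pset (\<phi> i) UNIV" by blast
  have formgs: "\<exists>d. form d g" if "g \<in> set gs" for g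
    using gs(2) that by (metis in_set_conv_nth list_all2_conv_all_nth)
  define gs' where "gs' = map (\<lambda>g x. g (\<phi> i x)) gs"
  have "finite (X i)" using X[OF i(1)] by simp
  moreover have "\<forall>g\<in>set gs'. g \<in> polyfuns (X i)"
  proof
    fix g' assume "g' \<in> set gs'"
    then obtain g where g: "g \<in> set gs" "g' = (\<lambda>x. g (\<phi> i x))" by (auto simp: gs'_def)
    obtain d where "form d g" using formgs[OF g(1)] by blast
    then show "g' \<in> polyfuns (X i)" unfolding g(2) by (rule form_in_polyfuns[OF _ poly[OF i(1)]])
  qed
  moreover have "card (X i) < length gs'" using X[OF i(1)] lt gs(1) by (simp add: gs'_def Ds_def)
  ultimately obtain Es c where Es: "finite Es" "\<And>es. es \<in> Es \<Longrightarrow> length es = length gs'" "\<exists>es\<in>Es. c es \<noteq> 0"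
    "\<And>x. (\<Sum>es\<in>Es. c es * mon gs' es x) = 0"
    by (rule algebraic_dependence) blast
  obtain es0 where es0: "es0 \<in> Es" "c es0 \<noteq> 0" using Es(3) by blast
  define k where "k = wdeg ds es0"
  define Esk where "Esk = {es \<in> Es. wdeg ds es = k}"
  \<comment> \<open>The chart is stable under scaling, so the relation holds at every multiple of
    \<open>\<phi> i x\<close>. As a polynomial in the scalar it vanishes identically, and its
    coefficient at \<open>k\<close> is the part of weight \<open>k\<close>.\<close>
  have hom: "(\<Sum>es\<in>Esk. c es * mon gs es (\<phi> i x)) = 0" for x
  proof -
    define p :: "complex poly" where "p = (\<Sum>es\<in>Es. monom (c es * mon gs es (\<phi> i x)) (wdeg ds es))"
    have "poly p s = 0" for s
    proof -
      obtain x' where x': "\<phi> i x' = s *s \<phi> i x" using cone[OF i(1)] by blast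
      have "poly p s = (\<Sum>es\<in>Es. c es * mon gs es (\<phi> i x'))"
        unfolding p_def x' mon_scale[OF gs(2)] by (simp add: poly_sum poly_monom mult_ac)
      also have "\<dots> = 0" using Es(4)[of x'] unfolding gs'_def mon_comp .
      finally show ?thesis .
    qed
    then have "p = 0" using poly_all_0_iff_0 by blast
    then have "coeff p k = 0" by simp
    moreover have "coeff p k = (\<Sum>es\<in>Es. if wdeg ds es = k then c es * mon gs es (\<phi> i x) else 0)"
      unfolding p_def by (simp add: coeff_sum)
    moreover have "\<dots> = (\<Sum>es\<in>Esk. c es * mon gs es (\<phi> i x))"
      unfolding Esk_def using Es(1) by (subst sum.inter_filter) auto
    ultimately show ?thesis by simp
  qed
  define F where "F v = (\<Sum>es\<in>Esk. c es * mon gs es v)" for v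
  have fF: "form k F" unfolding F_def Esk_def
    by (intro form_sum form_scale) (use form_mon[OF gs(2)] in auto)
  have van: "vanishes_on F Y"
    unfolding vanishes_on_def
  proof (intro ballI)
    fix p v assume p: "p \<in> Y" "v \<in> p"
    show "F v = 0"
    proof (rule form_zero_on_closure[OF fF _ _ p(2)])
      show "p \<in> zariski closure_of pset (\<phi> i) UNIV" using i(2) p(1) by blast
      fix q u assume q: "q \<in> pset (\<phi> i) UNIV" "u \<in> q"
      then obtain x where "q = pt (\<phi> i x)" by (auto simp: pset_def)
      then show "F u = 0" using q(2) form_zero_on_pt[OF fF, of "\<phi> i x"] hom[of x] by (auto simp: F_def)
    qed
  qed
  have "c es0 = 0"
  proof (rule indep_monsD[OF gs(3), of Esk])
    show "finite Esk" using Es(1) by (simp add: Esk_def)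
    show "length es = length gs" if "es \<in> Esk" for es using that Es(2) by (auto simp: Esk_def gs'_def)
    show "wdeg ds es = k" if "es \<in> Esk" for es using that by (simp add: Esk_def)
    show "vanishes_on (\<lambda>v. \<Sum>es\<in>Esk. c es * mon gs es v) Y" using van unfolding F_def .
    show "es0 \<in> Esk" using es0 by (simp add: Esk_def k_def)
  qed
  then show False using es0 by simp
qed

lemma zdim_le_of_zchains:
  assumes "\<And>C. zchain S C \<Longrightarrow> length C \<le> D"
  shows "zdim S \<le> int D - 1"
proof -
  \<comment> \<open>The empty chain makes the set of lengths nonempty, as \<open>cSup_least\<close>
    requires.\<close>
  have "zchain S []" by (simp add: zchain_def)
  then have "Sup {length C | C. zchain S C} \<le> D" using assms by (intro cSup_least) auto
  then show ?thesis by (simp add: zdim_eq_Sup)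
qed

lemma zdim_eq_of_zchains:
  assumes le: "\<And>C. zchain S C \<Longrightarrow> length C \<le> D" and C: "zchain S C" "length C = D"
  shows "zdim S = int D - 1"
proof -
  have "Sup {length C | C. zchain S C} = D" using assms by (intro cSup_eq_maximum) auto
  then show ?thesis by (simp add: zdim_eq_Sup)
qed

section \<open>Chains from flags of coordinate subspaces of a chart\<close>

definition supp_in :: "'u set \<Rightarrow> ('u \<Rightarrow> complex) set" where
  "supp_in P = {x. \<forall>u. u \<notin> P \<longrightarrow> x u = 0}"

lemma supp_in_line: "x \<in> supp_in P \<Longrightarrow> y \<in> supp_in P \<Longrightarrow> (\<lambda>u. x u + t * (y u - x u)) \<in> supp_in P"
  by (auto simp: supp_in_def)

text \<open>Releasing the parameter \<open>u\<close> strictly enlarges the closure of the image, as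
  a form detects. Degree 1 is enough for the charts below, where parameters are read off from single
  matrix entries.\<close>

definition separated :: "(('u \<Rightarrow> complex) \<Rightarrow> complex ^ 'k::finite) \<Rightarrow> 'u set \<Rightarrow> 'u \<Rightarrow> bool" where
  "separated \<phi> P u \<longleftrightarrow> (\<exists>F. form 1 F \<and> (\<forall>x\<in>supp_in P. F (\<phi> x) = 0) \<and> (\<exists>x\<in>supp_in (insert u P). F (\<phi> x) \<noteq> 0))"

primrec flag_separated :: "(('u \<Rightarrow> complex) \<Rightarrow> complex ^ 'k::finite) \<Rightarrow> 'u set \<Rightarrow> 'u list \<Rightarrow> bool" where
  "flag_separated \<phi> P [] = True"
| "flag_separated \<phi> P (u # us) \<longleftrightarrow> separated \<phi> P u \<and> flag_separated \<phi> (insert u P) us"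

lemma flag_separated_append:
  "flag_separated \<phi> P (us @ vs) \<longleftrightarrow> flag_separated \<phi> P us \<and> flag_separated \<phi> (P \<union> set us) vs"
  by (induction us arbitrary: P) auto

text \<open>For blocks of parameters that may be released in any order: the hypothesis covers every
  intermediate set \<open>Q\<close>.\<close>

lemma flag_separatedI:
  assumes "distinct us" "set us \<inter> P = {}"
    and "\<And>Q u. u \<in> set us \<Longrightarrow> u \<notin> Q \<Longrightarrow> P \<subseteq> Q \<Longrightarrow> Q \<subseteq> P \<union> set us \<Longrightarrow> separated \<phi> Q u"
  shows "flag_separated \<phi> P us"
  using assms
proof (induction us arbitrary: P)
  case (Cons u us)
  have "flag_separated \<phi> (insert u P) us"
  proof (rule Cons.IH)
    show "separated \<phi> Q v" if "v \<in> set us" "v \<notin> Q" "insert u P \<subseteq> Q" "Q \<subseteq> insert u P \<union> set us" for Q v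
      using that by (intro Cons.prems(3)) auto
  qed (use Cons.prems in auto)
  moreover have "separated \<phi> P u" using Cons.prems by (intro Cons.prems(3)) auto
  ultimately show ?case by simp
qed simp

text \<open>The members are the closures in \<open>S\<close> of the images of the growing coordinate
  subspaces. The closure for \<open>P\<close> itself stays outside the chain, which gives one set
  for each parameter; the last conjunct is the invariant that lets the next smaller set be put in
  front.\<close>

lemma zchain_of_flag:
  fixes \<phi> :: "('u \<Rightarrow> complex) \<Rightarrow> complex ^ 'k::finite"
  assumes poly: "\<And>k. (\<lambda>x. \<phi> x $ k) \<in> polyfuns (coords UNIV)"
    and S: "S \<subseteq> proj UNIV"
    and "flag_separated \<phi> P us" "pset \<phi> (supp_in (P \<union> set us)) \<subseteq> S"
  shows "\<exists>C. zchain S C \<and> length C = length us \<and> (\<forall>A\<in>set C. S \<inter> zariski closure_of pset \<phi> (supp_in P) \<subset> A)"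
  using assms(3,4)
proof (induction us arbitrary: P)
  case Nil
  show ?case by (intro exI[of _ "[]"]) (simp add: zchain_def)
next
  case (Cons u us)
  let ?A = "\<lambda>P. S \<inter> zariski closure_of pset \<phi> (supp_in P)"
  obtain C where C: "zchain S C" "length C = length us" "\<forall>A\<in>set C. ?A (insert u P) \<subset> A"
    using Cons.IH[of "insert u P"] Cons.prems by auto
  obtain F where F: "form 1 F" "\<forall>x\<in>supp_in P. F (\<phi> x) = 0" "\<exists>x\<in>supp_in (insert u P). F (\<phi> x) \<noteq> 0"
    using Cons.prems(1) by (auto simp: separated_def)
  then obtain x where x: "x \<in> supp_in (insert u P)" "F (\<phi> x) \<noteq> 0" by blast
  have x0: "\<phi> x \<noteq> 0" using x(2) form_homogeneous[OF F(1), of 0 "\<phi> x"] by auto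
  have sub: "pset \<phi> (supp_in (insert u P)) \<subseteq> S"
    using Cons.prems(2) pset_mono[of "supp_in (insert u P)" "supp_in (P \<union> set (u # us))" \<phi>]
    by (auto simp: supp_in_def)
  have irr: "irreducible_in zariski (?A (insert u P))"
    using S sub by (intro irreducible_in_closure irreducible_pset[OF poly supp_in_line x(1) x0]) auto
  have mem: "pt (\<phi> x) \<in> ?A (insert u P)"
  proof -
    have "pt (\<phi> x) \<in> pset \<phi> (supp_in (insert u P))" using x(1) x0 by (auto simp: pset_def)
    then show ?thesis using sub closure_of_subset[of "pset \<phi> (supp_in (insert u P))" zariski] pset_subset_proj[of \<phi>] by auto
  qed
  have notmem: "pt (\<phi> x) \<notin> ?A P"
  proof
    assume "pt (\<phi> x) \<in> ?A P"
    then have m: "pt (\<phi> x) \<in> zariski closure_of pset \<phi> (supp_in P)" by blast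
    have "F (\<phi> x) = 0"
    proof (rule form_zero_on_closure[OF F(1) _ m self_in_pt])
      fix q v assume q: "q \<in> pset \<phi> (supp_in P)" "v \<in> q"
      then obtain y where y: "q = pt (\<phi> y)" "y \<in> supp_in P" by (auto simp: pset_def)
      show "F v = 0" using q(2) y form_zero_on_pt[OF F(1), of "\<phi> y"] F(2) by auto
    qed
    then show False using x(2) by simp
  qed
  have "supp_in P \<subseteq> supp_in (insert u P)" by (auto simp: supp_in_def)
  then have "?A P \<subseteq> ?A (insert u P)"
    using closure_of_mono[OF pset_mono[of "supp_in P" "supp_in (insert u P)" \<phi>], of zariski] by blast
  then have lt: "?A P \<subset> ?A (insert u P)" using mem notmem by blast
  have "closedin (subtopology zariski S) (?A (insert u P))"
    unfolding closedin_subtopology using closedin_closure_of by blast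
  then have "zchain S (?A (insert u P) # C)"
    using C(1,3) irr by (auto simp: zchain_def irreducible_in_subtopology)
  moreover have "\<forall>A\<in>set (?A (insert u P) # C). ?A P \<subset> A" using lt C(3) by auto
  ultimately show ?case using C(2) by (intro exI[of _ "?A (insert u P) # C"]) simp
qed

text \<open>The linear parametrisation by a basis of \<open>L\<close> is the only chart needed for
  the upper bound, and its coordinate flag attains the bound.\<close>

lemma zdim_proj:
  fixes L :: "(complex ^ 'k::finite) set"
  assumes L: "vec.subspace L"
  shows "zdim (proj L) = int (vec.dim L) - 1"
proof -
  obtain F F' :: "complex ^ 'k ^ 'k" and I where F: "F ** F' = mat 1" "F' ** F = mat 1"
    "L = (*v) F ` coord_space I" "card I = vec.dim L" by (rule subspace_normal_form[OF L])
  define \<phi> where "\<phi> x = (\<Sum>j\<in>I. x j *s column j F)" for x :: "'k \<Rightarrow> complex"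
  have \<phi>1: "\<phi> x = F *v (\<chi> j. if j \<in> I then x j else 0)" for x
    unfolding \<phi>_def matrix_mult_sum by (intro sum.mono_neutral_cong_left) auto
  have poly: "(\<lambda>x. \<phi> x $ k) \<in> polyfuns (coords I)" for k
  proof -
    have "(\<lambda>x. \<Sum>j\<in>I. x j * column j F $ k) \<in> polyfuns (coords I)"
      by (intro polyfuns_sum polyfuns.mult[OF polyfuns.gen polyfuns.const]) auto
    then show ?thesis by (simp add: \<phi>_def)
  qed
  have cone: "\<exists>x'. \<phi> x' = s *s \<phi> x" for s x
    by (intro exI[of _ "\<lambda>j. s * x j"]) (simp add: \<phi>_def vec.scale_sum_right)
  have range: "range \<phi> = L"
  proof
    show "range \<phi> \<subseteq> L" unfolding F \<phi>1 by (auto simp: coord_space_def)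
    show "L \<subseteq> range \<phi>"
    proof
      fix y assume "y \<in> L"
      then obtain u where u: "u \<in> coord_space I" "y = F *v u" using F by blast
      have "(\<chi> j. if j \<in> I then u $ j else 0) = u" using u(1) by (auto simp: coord_space_def vec_eq_iff)
      then have "\<phi> (($) u) = y" by (simp add: \<phi>1 u(2))
      then show "y \<in> range \<phi>" by blast
    qed
  qed
  have pL: "proj L = pset \<phi> UNIV" unfolding proj_eq[OF L] pset_def unfolding range[symmetric] by auto
  obtain us where us: "set us = I" "distinct us" using finite_distinct_list[of I] by auto
  have "flag_separated \<phi> {} us"
  proof (rule flag_separatedI[OF us(2)])
    fix Q u assume u: "u \<in> set us" "u \<notin> Q" "Q \<subseteq> {} \<union> set us"
    have form: "form 1 (\<lambda>v. (F' *v v) $ u)" using form_linear[of "\<lambda>j. F' $ u $ j"] by (simp add: matrix_vector_mult_def)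
    have val: "(F' *v \<phi> x) $ u = x u" for x
      unfolding \<phi>1 matrix_vector_mul_assoc F(2) using u(1) us(1) by simp
    show "separated \<phi> Q u"
      unfolding separated_def
      by (intro exI[of _ "\<lambda>v. (F' *v v) $ u"] conjI form bexI[of _ "\<lambda>w. if w = u then 1 else 0"])
        (use u(2) in \<open>auto simp: val supp_in_def\<close>)
  qed simp
  then obtain C where C: "zchain (proj L) C" "length C = length us"
    using zchain_of_flag[of \<phi> "proj L" "{}" us] polyfuns_mono[OF poly] pset_mono[OF subset_UNIV, of \<phi>]
    unfolding pL using pset_subset_proj[of \<phi>] by (metis image_mono subset_UNIV)
  have len: "length us = vec.dim L" using us F(4) distinct_card by metis
  show ?thesis
  proof (rule zdim_eq_of_zchains[OF _ C(1)])
    show "length C = vec.dim L" using C(2) len by simp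
    show "length C \<le> vec.dim L" if "zchain (proj L) C" for C
    proof (rule zchain_length_le[of "{()}" "\<lambda>_. coords I" _ "\<lambda>_. \<phi>"])
      show "finite (coords I) \<and> card (coords I) \<le> vec.dim L" using F(4) card_image_le[of I] by auto
    qed (use that poly cone pL in auto)
  qed
qed

section \<open>Matrices\<close>

definition rker :: "complex ^ ('m::finite \<times> 'n::finite) \<Rightarrow> (complex ^ 'n) set" where
  "rker v = {x. mat_of v *v x = 0}"

definition lker :: "complex ^ ('m::finite \<times> 'n::finite) \<Rightarrow> (complex ^ 'm) set" where
  "lker v = {y. transpose (mat_of v) *v y = 0}"

definition vec_of :: "complex ^ 'n::finite ^ 'm::finite \<Rightarrow> complex ^ ('m \<times> 'n)" where
  "vec_of A = (\<chi> p. A $ fst p $ snd p)"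

lemma mat_of_vec_of [simp]: "mat_of (vec_of A) = A"
  by (simp add: mat_of_def vec_of_def vec_eq_iff)

lemma vec_of_mat_of [simp]: "vec_of (mat_of v) = v"
  by (simp add: mat_of_def vec_of_def vec_eq_iff)

lemma mat_of_nth [simp]: "mat_of v $ i $ j = v $ (i, j)"
  by (simp add: mat_of_def)

lemma mat_of_add: "mat_of (v + w) = mat_of v + mat_of w"
  by (simp add: mat_of_def vec_eq_iff)

lemma mat_of_scale: "mat_of (c *s v) *v x = c *s (mat_of v *v x)"
  by (simp add: mat_of_def vec_eq_iff matrix_vector_mult_def sum_distrib_left mult.assoc)

lemma mat_of_0 [simp]: "mat_of 0 = 0"
  by (simp add: mat_of_def vec_eq_iff)

lemma subspace_rker: "vec.subspace (rker v)"
  unfolding rker_def by (intro vec.linear_subspace_kernel matrix_vector_mul_linear_gen)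

lemma subspace_lker: "vec.subspace (lker v)"
  unfolding lker_def by (intro vec.linear_subspace_kernel matrix_vector_mul_linear_gen)

lemma subspace_range_matrix: "vec.subspace (range ((*v) (A :: complex ^ 'n::finite ^ 'm::finite)))"
  by (intro vec.linear_subspace_image matrix_vector_mul_linear_gen vec.subspace_UNIV)

text \<open>The rank is by definition the row rank, and the kernel is the annihilator of the
  rows.\<close>

lemma rank_nullity: "vec.dim (rker v) + rank (mat_of v) = CARD('n)"
  for v :: "complex ^ ('m::finite \<times> 'n::finite)"
proof -
  have "rker v = annihilator (rows (mat_of v))"
  proof (intro set_eqI)
    fix x
    have "x \<in> annihilator (rows (mat_of v)) \<longleftrightarrow> (\<forall>i. (\<Sum>j\<in>UNIV. row i (mat_of v) $ j * x $ j) = 0)"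
      unfolding annihilator_def rows_def by blast
    also have "\<dots> \<longleftrightarrow> x \<in> rker v" by (simp add: rker_def vec_eq_iff matrix_vector_mult_def row_def)
    finally show "x \<in> rker v \<longleftrightarrow> x \<in> annihilator (rows (mat_of v))" by blast
  qed
  then have "rker v = annihilator (vec.span (rows (mat_of v)))" by (simp add: annihilator_span)
  then show ?thesis
    using dim_annihilator[OF vec.subspace_span[of "rows (mat_of v)"]] by (simp add: row_rank_def_gen)
qed

text \<open>Row rank equals column rank, by comparing \<open>rank_nullity\<close> with rank-nullity
  for the linear map.\<close>

lemma rank_eq_dim_range: "rank A = vec.dim (range ((*v) A))"
  for A :: "complex ^ 'n::finite ^ 'm::finite"
proof -
  have "vec.dim (rker (vec_of A)) + vec.dim (range ((*v) A)) = CARD('n)"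
    using rank_nullity_on[OF matrix_vector_mul_linear_gen[of A] vec.subspace_UNIV]
    unfolding rker_def mat_of_vec_of vec_dim_card Int_UNIV_right .
  then show ?thesis using rank_nullity[of "vec_of A"] by simp
qed

lemma lker_eq_annihilator: "lker v = annihilator (range ((*v) (mat_of v)))"
proof (intro set_eqI iffI)
  fix y assume "y \<in> annihilator (range ((*v) (mat_of v)))"
  then have y: "(\<Sum>j\<in>UNIV. x $ j * (transpose (mat_of v) *v y) $ j) = 0" for x
    unfolding annihilator_def by (auto simp: dot_matrix_transpose)
  have "(transpose (mat_of v) *v y) $ j = 0" for j
    using y[of "axis j 1"] by (simp add: axis_def if_distrib if_distribR cong: if_cong)
  then show "y \<in> lker v" by (simp add: lker_def vec_eq_iff)
qed (auto simp: annihilator_def dot_matrix_transpose lker_def)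

lemma rank_nullity_left: "vec.dim (lker v) + rank (mat_of v) = CARD('m)"
  for v :: "complex ^ ('m::finite \<times> 'n::finite)"
  unfolding lker_eq_annihilator rank_eq_dim_range by (rule dim_annihilator[OF subspace_range_matrix])

text \<open>Transposition on coordinate vectors; it carries results on right kernels over to left
  kernels.\<close>

definition flip_vec :: "complex ^ ('m::finite \<times> 'n::finite) \<Rightarrow> complex ^ ('n \<times> 'm)" where
  "flip_vec v = (\<chi> p. v $ (snd p, fst p))"

lemma mat_of_flip_vec [simp]: "mat_of (flip_vec v) = transpose (mat_of v)"
  by (simp add: flip_vec_def mat_of_def transpose_def vec_eq_iff)

lemma rker_flip_vec: "rker (flip_vec v) = lker v"
  by (simp add: rker_def lker_def)

lemma rank_transpose_complex: "rank (transpose (A :: complex ^ 'n::finite ^ 'm::finite)) = rank A"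
  using rank_nullity[of "flip_vec (vec_of A)"] rank_nullity_left[of "vec_of A"]
  by (simp add: rker_flip_vec)

lemma form_flip_vec: "form d F \<Longrightarrow> form d (\<lambda>v. F (flip_vec v))"
  by (rule form_compose) (use form_coord in \<open>simp_all add: flip_vec_def\<close>)

section \<open>Tensor subspaces in adapted bases\<close>

lemma matrix_vector_in_coord_space:
  assumes "\<And>i j. i \<notin> I \<Longrightarrow> A $ i $ j = 0"
  shows "A *v x \<in> coord_space I"
  using assms by (simp add: coord_space_def matrix_vector_mult_def)

lemma matrix_vector_axis: "A *v axis k 1 = column k A" for A :: "complex ^ 'n::finite ^ 'm::finite"
  by (simp add: vec_eq_iff matrix_vector_mult_def column_def axis_def if_distrib cong: if_cong)

lemma zero_row_of_range:
  fixes A :: "complex ^ 'n::finite ^ 'm::finite"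
  assumes "\<And>x. A *v x \<in> coord_space I" "i \<notin> I"
  shows "A $ i $ j = 0"
proof -
  have "(A *v axis j 1) $ i = 0" using assms by (simp add: coord_space_def)
  then show ?thesis by (simp add: matrix_vector_axis column_def)
qed

text \<open>Changing the bases of rows and columns turns the conditions on column span and row span
  into the vanishing of all entries outside \<open>I2 \<times> I1\<close>.\<close>

lemma tensor_subspace_coords:
  fixes F F' :: "complex ^ 'n::finite ^ 'n" and G G' :: "complex ^ 'm::finite ^ 'm"
  assumes F: "F ** F' = mat 1" "F' ** F = mat 1" and G: "G ** G' = mat 1" "G' ** G = mat 1"
  shows "tensor_subspace ((*v) F ` coord_space I1) ((*v) G ` coord_space I2) =
    (\<lambda>h. vec_of (G ** mat_of h ** transpose F)) ` coord_space (I2 \<times> I1)" (is "?T = ?R")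
proof (intro set_eqI iffI)
  fix v assume v: "v \<in> ?T"
  define h where "h = vec_of (G' ** mat_of v ** transpose F')"
  have FT: "transpose F' ** transpose F = mat 1" using F by (metis matrix_transpose_mul transpose_mat)
  have "v = vec_of (G ** mat_of h ** transpose F)"
  proof -
    have "G ** (G' ** mat_of v ** transpose F') ** transpose F = (G ** G') ** mat_of v ** (transpose F' ** transpose F)"
      by (simp only: matrix_mul_assoc)
    then show ?thesis by (simp add: h_def G FT)
  qed
  moreover have "h \<in> coord_space (I2 \<times> I1)"
  proof -
    have 1: "(G' ** mat_of v) *v x \<in> coord_space I2" for x
    proof -
      have "mat_of v *v x \<in> (*v) G ` coord_space I2" using v by (auto simp: tensor_subspace_def)
      then obtain u where "u \<in> coord_space I2" "mat_of v *v x = G *v u" by auto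
      moreover have "(G' ** mat_of v) *v x = G' *v (mat_of v *v x)" by (simp only: matrix_vector_mul_assoc)
      moreover have "G' *v (G *v u) = u" by (simp only: matrix_vector_mul_assoc G matrix_vector_mul_lid)
      ultimately show ?thesis by simp
    qed
    have 2: "(F' ** transpose (mat_of v)) *v x \<in> coord_space I1" for x
    proof -
      have "transpose (mat_of v) *v x \<in> (*v) F ` coord_space I1" using v by (auto simp: tensor_subspace_def)
      then obtain u where "u \<in> coord_space I1" "transpose (mat_of v) *v x = F *v u" by auto
      moreover have "(F' ** transpose (mat_of v)) *v x = F' *v (transpose (mat_of v) *v x)"
        by (simp only: matrix_vector_mul_assoc)
      moreover have "F' *v (F *v u) = u" by (simp only: matrix_vector_mul_assoc F matrix_vector_mul_lid)
      ultimately show ?thesis by simp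
    qed
    have "h $ (i, j) = 0" if "i \<notin> I2" for i j
    proof -
      have "(G' ** mat_of v ** transpose F') $ i $ j = (\<Sum>k\<in>UNIV. (G' ** mat_of v) $ i $ k * transpose F' $ k $ j)"
        unfolding matrix_matrix_mult_def[of "G' ** mat_of v"] by simp
      also have "\<dots> = 0" using zero_row_of_range[OF 1 that] by simp
      finally show ?thesis by (simp add: h_def vec_of_def)
    qed
    moreover have "h $ (i, j) = 0" if "j \<notin> I1" for i j
    proof -
      have "transpose (G' ** mat_of v ** transpose F') = (F' ** transpose (mat_of v)) ** transpose G'"
        by (simp add: matrix_transpose_mul matrix_mul_assoc)
      moreover have "(G' ** mat_of v ** transpose F') $ i $ j = transpose (G' ** mat_of v ** transpose F') $ j $ i"
        by (simp add: transpose_def)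
      ultimately have "(G' ** mat_of v ** transpose F') $ i $ j = ((F' ** transpose (mat_of v)) ** transpose G') $ j $ i"
        by simp
      also have "\<dots> = (\<Sum>k\<in>UNIV. (F' ** transpose (mat_of v)) $ j $ k * transpose G' $ k $ i)"
        unfolding matrix_matrix_mult_def[of "F' ** transpose (mat_of v)"] by simp
      also have "\<dots> = 0" using zero_row_of_range[OF 2 that] by simp
      finally show ?thesis by (simp add: h_def vec_of_def)
    qed
    ultimately show ?thesis by (auto simp: coord_space_def)
  qed
  ultimately show "v \<in> ?R" by blast
next
  fix v assume "v \<in> ?R"
  then obtain h where h: "h \<in> coord_space (I2 \<times> I1)" "v = vec_of (G ** mat_of h ** transpose F)" by auto
  have "mat_of v *v x = G *v (mat_of h *v (transpose F *v x))" for x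
    by (simp only: h(2) mat_of_vec_of matrix_vector_mul_assoc matrix_mul_assoc)
  moreover have "mat_of h *v y \<in> coord_space I2" for y
    using h(1) by (intro matrix_vector_in_coord_space) (auto simp: coord_space_def)
  moreover have "transpose (mat_of v) *v x = F *v (transpose (mat_of h) *v (transpose G *v x))" for x
    by (simp only: h(2) mat_of_vec_of matrix_vector_mul_assoc matrix_mul_assoc matrix_transpose_mul transpose_transpose)
  moreover have "transpose (mat_of h) *v y \<in> coord_space I1" for y
    using h(1) by (intro matrix_vector_in_coord_space) (auto simp: coord_space_def transpose_def)
  ultimately show "v \<in> ?T" unfolding tensor_subspace_def by auto
qed

lemma subspace_tensor_subspace:
  fixes L1 :: "(complex ^ 'n::finite) set" and L2 :: "(complex ^ 'm::finite) set"
  assumes "vec.subspace L1" "vec.subspace L2" shows "vec.subspace (tensor_subspace L1 L2)"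
proof -
  have "tensor_subspace L1 L2 = {v. (\<forall>x. mat_of v *v x \<in> L2) \<and> (\<forall>y. transpose (mat_of v) *v y \<in> L1)}"
    by (auto simp: tensor_subspace_def)
  moreover have "mat_of (v + w) *v x = mat_of v *v x + mat_of w *v x" for v w :: "complex ^ ('m \<times> 'n)" and x
    by (simp add: mat_of_add matrix_vector_mult_add_rdistrib)
  moreover have "transpose (mat_of (v + w)) *v x = transpose (mat_of v) *v x + transpose (mat_of w) *v x"
    for v w :: "complex ^ ('m \<times> 'n)" and x
    by (simp add: vec_eq_iff matrix_vector_mult_def transpose_def mat_of_add distrib_right sum.distrib)
  moreover have "transpose (mat_of (c *s v)) *v x = c *s (transpose (mat_of v) *v x)"
    for v :: "complex ^ ('m \<times> 'n)" and x c
    by (simp add: vec_eq_iff matrix_vector_mult_def transpose_def sum_distrib_left mult.assoc)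
  moreover have "mat_of (0 :: complex ^ ('m \<times> 'n)) *v x = 0" "transpose (mat_of (0 :: complex ^ ('m \<times> 'n))) *v y = 0" for x y
    by (simp_all add: vec_eq_iff matrix_vector_mult_def transpose_def)
  ultimately show ?thesis using assms unfolding vec.subspace_def by (simp add: mat_of_scale)
qed

lemma linear_sandwich:
  fixes G :: "complex ^ 'a::finite ^ 'b::finite" and F :: "complex ^ 'c::finite ^ 'd::finite"
  shows "Vector_Spaces.linear (*s) (*s) (\<lambda>h. vec_of (G ** mat_of h ** F))"
proof (unfold_locales)
  fix v w :: "complex ^ ('a \<times> 'd)" and c :: complex
  show "vec_of (G ** mat_of (v + w) ** F) = vec_of (G ** mat_of v ** F) + vec_of (G ** mat_of w ** F)"
    by (simp add: vec_of_def vec_eq_iff matrix_matrix_mult_def distrib_left distrib_right sum.distrib)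
  show "vec_of (G ** mat_of (c *s v) ** F) = c *s vec_of (G ** mat_of v ** F)"
    by (simp add: vec_of_def vec_eq_iff matrix_matrix_mult_def sum_distrib_left sum_distrib_right mult_ac)
qed

lemma dim_tensor_subspace:
  fixes L1 :: "(complex ^ 'n::finite) set" and L2 :: "(complex ^ 'm::finite) set"
  assumes L1: "vec.subspace L1" and L2: "vec.subspace L2"
  shows "vec.dim (tensor_subspace L1 L2) = vec.dim L1 * vec.dim L2"
proof -
  obtain F F' :: "complex ^ 'n ^ 'n" and I1 where F: "F ** F' = mat 1" "F' ** F = mat 1"
    "L1 = (*v) F ` coord_space I1" "card I1 = vec.dim L1" by (rule subspace_normal_form[OF L1])
  obtain G G' :: "complex ^ 'm ^ 'm" and I2 where G: "G ** G' = mat 1" "G' ** G = mat 1"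
    "L2 = (*v) G ` coord_space I2" "card I2 = vec.dim L2" by (rule subspace_normal_form[OF L2])
  let ?f = "\<lambda>h. vec_of (G ** mat_of h ** transpose F)"
  have FT: "transpose F ** transpose F' = mat 1" using F(2) by (metis matrix_transpose_mul transpose_mat)
  have inv: "vec_of (G' ** mat_of (?f h) ** transpose F') = h" for h :: "complex ^ ('m \<times> 'n)"
  proof -
    have "G' ** (G ** mat_of h ** transpose F) ** transpose F' = (G' ** G) ** mat_of h ** (transpose F ** transpose F')"
      by (simp only: matrix_mul_assoc)
    then show ?thesis by (simp add: G FT)
  qed
  have "inj ?f" by (rule inj_on_inverseI) (rule inv)
  then have "vec.dim (?f ` coord_space (I2 \<times> I1)) = card (I2 \<times> I1)"
    by (subst dim_inj_image[OF linear_sandwich _ subspace_coord_space])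
      (auto simp: dim_coord_space intro: inj_on_subset)
  moreover have "tensor_subspace L1 L2 = ?f ` coord_space (I2 \<times> I1)"
    unfolding F(3) G(3) by (rule tensor_subspace_coords[OF F(1,2) G(1,2)])
  ultimately show ?thesis using F(4) G(4) by (simp add: card_cartesian_product mult.commute)
qed

lemma tensor_subspace_mono:
  "L1 \<subseteq> L1' \<Longrightarrow> L2 \<subseteq> L2' \<Longrightarrow> tensor_subspace L1 L2 \<subseteq> tensor_subspace L1' L2'"
  unfolding tensor_subspace_def by blast

lemma tensor_subspace_Int:
  "tensor_subspace (L1 \<inter> L1') (L2 \<inter> L2') = tensor_subspace L1 L2 \<inter> tensor_subspace L1' L2'"
  unfolding tensor_subspace_def by blast

lemma tensor_subspace_UNIV: "tensor_subspace UNIV UNIV = UNIV"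
  unfolding tensor_subspace_def by blast

text \<open>The tensor subspace is spanned by the rank one matrices \<open>y x\<^sup>T\<close> with \<open>y \<in> L2\<close>, \<open>x \<in> L1\<close>.\<close>

lemma tensor_subspace_pairing:
  fixes L1 :: "(complex ^ 'n::finite) set" and L2 :: "(complex ^ 'm::finite) set"
  assumes L1: "vec.subspace L1" and L2: "vec.subspace L2"
    and h: "h \<in> tensor_subspace L1 L2"
    and b: "\<And>x y. x \<in> L1 \<Longrightarrow> y \<in> L2 \<Longrightarrow> (\<Sum>i\<in>UNIV. y $ i * (mat_of v *v x) $ i) = 0"
  shows "(\<Sum>p\<in>UNIV. h $ p * v $ p) = 0"
proof -
  obtain F F' :: "complex ^ 'n ^ 'n" and I1 where F: "F ** F' = mat 1" "F' ** F = mat 1"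
    "L1 = (*v) F ` coord_space I1" "card I1 = vec.dim L1" by (rule subspace_normal_form[OF L1])
  obtain G G' :: "complex ^ 'm ^ 'm" and I2 where G: "G ** G' = mat 1" "G' ** G = mat 1"
    "L2 = (*v) G ` coord_space I2" "card I2 = vec.dim L2" by (rule subspace_normal_form[OF L2])
  obtain u where u: "u \<in> coord_space (I2 \<times> I1)" "h = vec_of (G ** mat_of u ** transpose F)"
    using h unfolding F(3) G(3) tensor_subspace_coords[OF F(1,2) G(1,2)] by auto
  have h_nth: "h $ (i, j) = (\<Sum>k\<in>UNIV. \<Sum>l\<in>UNIV. G $ i $ k * u $ (k, l) * F $ j $ l)" for i j
  proof -
    have "h $ (i, j) = (\<Sum>l\<in>UNIV. \<Sum>k\<in>UNIV. G $ i $ k * u $ (k, l) * F $ j $ l)"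
      by (simp add: u(2) vec_of_def matrix_matrix_mult_def transpose_def sum_distrib_right)
    then show ?thesis by (subst (asm) sum.swap)
  qed
  \<comment> \<open>For \<open>k \<in> I2\<close> and \<open>l \<in> I1\<close> the double sum pairs
    \<open>v\<close> with the rank one matrix of column \<open>k\<close> of \<open>G\<close> and
    column \<open>l\<close> of \<open>F\<close>; for other indices \<open>u\<close>
    vanishes.\<close>
  have z: "u $ (k, l) * (\<Sum>i\<in>UNIV. \<Sum>j\<in>UNIV. G $ i $ k * (v $ (i, j) * F $ j $ l)) = 0" for k l
  proof (cases "k \<in> I2 \<and> l \<in> I1")
    case True
    have "F *v axis l 1 \<in> L1" "G *v axis k 1 \<in> L2" unfolding F(3) G(3)
      using True axis_in_coord_space_iff by blast+
    from b[OF this] show ?thesis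
      by (simp add: matrix_vector_axis column_def matrix_vector_mult_def[of "mat_of v"] sum_distrib_left)
  next
    case False
    then show ?thesis using u(1) by (auto simp: coord_space_def)
  qed
  have "(\<Sum>p\<in>UNIV. h $ p * v $ p) = (\<Sum>i\<in>UNIV. \<Sum>j\<in>UNIV. h $ (i, j) * v $ (i, j))"
    by (simp add: UNIV_Times_UNIV[symmetric] sum.cartesian_product del: UNIV_Times_UNIV)
  \<comment> \<open>The fourfold sum is reordered until \<open>k\<close> and \<open>l\<close> are
    outermost, where \<open>z\<close> makes every summand zero.\<close>
  also have "\<dots> = (\<Sum>i\<in>UNIV. \<Sum>j\<in>UNIV. \<Sum>k\<in>UNIV. \<Sum>l\<in>UNIV. u $ (k, l) * (G $ i $ k * (v $ (i, j) * F $ j $ l)))"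
    by (simp only: h_nth sum_distrib_right) (simp add: mult_ac)
  also have "\<dots> = (\<Sum>i\<in>UNIV. \<Sum>k\<in>UNIV. \<Sum>j\<in>UNIV. \<Sum>l\<in>UNIV. u $ (k, l) * (G $ i $ k * (v $ (i, j) * F $ j $ l)))"
    by (intro sum.cong refl sum.swap)
  also have "\<dots> = (\<Sum>k\<in>UNIV. \<Sum>i\<in>UNIV. \<Sum>j\<in>UNIV. \<Sum>l\<in>UNIV. u $ (k, l) * (G $ i $ k * (v $ (i, j) * F $ j $ l)))"
    by (rule sum.swap)
  also have "\<dots> = (\<Sum>k\<in>UNIV. \<Sum>i\<in>UNIV. \<Sum>l\<in>UNIV. \<Sum>j\<in>UNIV. u $ (k, l) * (G $ i $ k * (v $ (i, j) * F $ j $ l)))"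
    by (intro sum.cong refl sum.swap)
  also have "\<dots> = (\<Sum>k\<in>UNIV. \<Sum>l\<in>UNIV. \<Sum>i\<in>UNIV. \<Sum>j\<in>UNIV. u $ (k, l) * (G $ i $ k * (v $ (i, j) * F $ j $ l)))"
    by (intro sum.cong refl sum.swap)
  also have "\<dots> = (\<Sum>k\<in>UNIV. \<Sum>l\<in>UNIV. u $ (k, l) * (\<Sum>i\<in>UNIV. \<Sum>j\<in>UNIV. G $ i $ k * (v $ (i, j) * F $ j $ l)))"
    by (simp only: sum_distrib_left)
  also have "\<dots> = 0" by (simp only: z sum.neutral_const)
  finally show ?thesis .
qed

text \<open>In adapted bases, take the 0-1 matrix of an injection from the indices of
  \<open>L2\<close> to those of \<open>L1\<close>; its column span is all of
  \<open>L2\<close>.\<close>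

lemma tensor_subspace_full_rank:
  fixes L1 :: "(complex ^ 'n::finite) set" and L2 :: "(complex ^ 'm::finite) set"
  assumes L1: "vec.subspace L1" and L2: "vec.subspace L2" and le: "vec.dim L2 \<le> vec.dim L1"
  obtains v where "v \<in> tensor_subspace L1 L2" "rank (mat_of v) = vec.dim L2"
proof -
  obtain F F' :: "complex ^ 'n ^ 'n" and I1 where F: "F ** F' = mat 1" "F' ** F = mat 1"
    "L1 = (*v) F ` coord_space I1" "card I1 = vec.dim L1" by (rule subspace_normal_form[OF L1])
  obtain G G' :: "complex ^ 'm ^ 'm" and I2 where G: "G ** G' = mat 1" "G' ** G = mat 1"
    "L2 = (*v) G ` coord_space I2" "card I2 = vec.dim L2" by (rule subspace_normal_form[OF L2])
  obtain \<rho> where \<rho>: "inj_on \<rho> I2" "\<rho> ` I2 \<subseteq> I1"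
    using le F(4) G(4) card_le_inj[of I2 I1] by auto
  define u :: "complex ^ ('m \<times> 'n)" where "u = (\<chi> p. if fst p \<in> I2 \<and> snd p = \<rho> (fst p) then 1 else 0)"
  define v where "v = vec_of (G ** mat_of u ** transpose F)"
  have u: "u \<in> coord_space (I2 \<times> I1)" using \<rho>(2) by (auto simp: u_def coord_space_def)
  have v: "v \<in> tensor_subspace L1 L2"
    unfolding F(3) G(3) tensor_subspace_coords[OF F(1,2) G(1,2)] v_def using u by blast
  have FT: "transpose F ** transpose F' = mat 1" using F(2) by (metis matrix_transpose_mul transpose_mat)
  have "range ((*v) (mat_of v)) = L2"
  proof
    show "range ((*v) (mat_of v)) \<subseteq> L2" using v by (auto simp: tensor_subspace_def)
    show "L2 \<subseteq> range ((*v) (mat_of v))"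
    proof
      fix y assume "y \<in> L2"
      then obtain z where z: "z \<in> coord_space I2" "y = G *v z" using G(3) by blast
      \<comment> \<open>A preimage of \<open>z\<close>: its coordinate \<open>i\<close> is moved to
        position \<open>\<rho> i\<close>.\<close>
      define w :: "complex ^ 'n" where "w = (\<chi> j. if j \<in> \<rho> ` I2 then z $ (the_inv_into I2 \<rho> j) else 0)"
      have "mat_of u *v w = z"
      proof -
        have "(mat_of u *v w) $ i = z $ i" for i
        proof (cases "i \<in> I2")
          case True
          have "(mat_of u *v w) $ i = (\<Sum>j\<in>UNIV. if j = \<rho> i then w $ j else 0)"
            unfolding matrix_vector_mult_def vec_lambda_beta mat_of_nth using True by (intro sum.cong) (auto simp: u_def)
          also have "\<dots> = z $ i" using True \<rho> by (simp add: w_def the_inv_into_f_f)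
          finally show ?thesis .
        next
          case False
          then show ?thesis using z(1) by (simp add: matrix_vector_mult_def u_def coord_space_def)
        qed
        then show ?thesis by (simp add: vec_eq_iff)
      qed
      moreover have "mat_of v *v (transpose F' *v w) = G *v (mat_of u *v ((transpose F ** transpose F') *v w))"
        by (simp add: v_def matrix_vector_mul_assoc matrix_mul_assoc)
      ultimately have "mat_of v *v (transpose F' *v w) = y" by (simp add: FT z(2))
      then show "y \<in> range ((*v) (mat_of v))" by (metis rangeI)
    qed
  qed
  then show thesis using that[OF v] by (simp add: rank_eq_dim_range)
qed

text \<open>A minor taken with respect to arbitrary vectors \<open>u i\<close> and
  \<open>x j\<close>. Outside the block \<open>I\<close> it is padded with the identity, so that one
  matrix type accommodates minors of all sizes.\<close>

definition minor_mat :: "'m set \<Rightarrow> ('m \<Rightarrow> complex ^ 'm::finite) \<Rightarrow> ('m \<Rightarrow> complex ^ 'n::finite) \<Rightarrow>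
    complex ^ ('m \<times> 'n) \<Rightarrow> complex ^ 'm ^ 'm" where
  "minor_mat I u x v = (\<chi> i j. if i \<in> I \<and> j \<in> I then \<Sum>k\<in>UNIV. u i $ k * (mat_of v *v x j) $ k
     else if i = j then 1 else 0)"

lemma form_bilinear_entry: "form 1 (\<lambda>v. \<Sum>k\<in>UNIV. y $ k * (mat_of v *v x) $ k)"
proof (intro form_sum form_scale)
  fix k
  have "form 1 (\<lambda>v. \<Sum>l\<in>UNIV. x $ l * v $ (k, l))" by (intro form_sum form_scale form_coord)
  then show "form 1 (\<lambda>v. (mat_of v *v x) $ k)" by (simp add: matrix_vector_mult_def mult.commute)
qed

text \<open>In each product of the Leibniz formula the rows in \<open>I\<close> have degree 1 and
  the padding rows are constant.\<close>

lemma form_minor: "form (card I) (\<lambda>v. det (minor_mat I u x v))"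
proof -
  have entry: "form (if i \<in> I then 1 else 0) (\<lambda>v. minor_mat I u x v $ i $ j)" for i j
  proof (cases "i \<in> I")
    case True
    then show ?thesis using form_bilinear_entry[of "u i" "x j"] form_zero[of 1]
      by (cases "j \<in> I"; cases "i = j") (simp_all add: minor_mat_def)
  next
    case False
    then show ?thesis by (cases "i = j") (simp_all add: minor_mat_def form_const)
  qed
  have "(\<Sum>i\<in>UNIV. if i \<in> I then 1 else 0) = card I" by (simp add: sum.If_cases)
  then have "form (card I) (\<lambda>v. \<Prod>i\<in>UNIV. minor_mat I u x v $ i $ p i)" for p
    using form_prod[of UNIV "\<lambda>i. if i \<in> I then 1 else 0" "\<lambda>i v. minor_mat I u x v $ i $ p i"] entry by simp
  then show ?thesis unfolding det_def by (intro form_sum form_scale)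
qed

text \<open>A linear relation between the images of the vectors \<open>x j\<close> would be a kernel
  vector of the minor.\<close>

lemma minor_inj:
  fixes v :: "complex ^ ('m::finite \<times> 'n::finite)"
  assumes det: "det (minor_mat I u x v) \<noteq> 0" and c: "c \<in> coord_space I"
    and z: "mat_of v *v (\<Sum>j\<in>UNIV. c $ j *s x j) = 0"
  shows "c = 0"
proof -
  have "minor_mat I u x v *v c = 0"
  proof -
    have "(minor_mat I u x v *v c) $ i = 0" for i
    proof (cases "i \<in> I")
      case True
      have "(minor_mat I u x v *v c) $ i = (\<Sum>j\<in>UNIV. (\<Sum>k\<in>UNIV. u i $ k * (mat_of v *v x j) $ k) * c $ j)"
        unfolding matrix_vector_mult_def[of "minor_mat I u x v"]
        using True c by (auto simp: minor_mat_def coord_space_def intro!: sum.cong)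
      also have "\<dots> = (\<Sum>k\<in>UNIV. u i $ k * (\<Sum>j\<in>UNIV. c $ j * (mat_of v *v x j) $ k))"
        by (simp add: sum_distrib_left sum_distrib_right mult_ac) (rule sum.swap)
      also have "\<dots> = 0"
      proof -
        have "(\<Sum>j\<in>UNIV. c $ j * (mat_of v *v x j) $ k) = (mat_of v *v (\<Sum>j\<in>UNIV. c $ j *s x j)) $ k" for k
          by (simp add: vec.linear_sum[OF matrix_vector_mul_linear_gen] vector_scalar_commute)
        then show ?thesis by (simp add: z)
      qed
      finally show ?thesis .
    next
      case False
      then have "(minor_mat I u x v *v c) $ i = (\<Sum>j\<in>UNIV. if i = j then c $ j else 0)"
        unfolding matrix_vector_mult_def vec_lambda_beta by (intro sum.cong) (auto simp: minor_mat_def)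
      also have "\<dots> = 0" using False c by (simp add: coord_space_def)
      finally show ?thesis .
    qed
    then show ?thesis by (simp add: vec_eq_iff)
  qed
  moreover have "\<exists>B. B ** minor_mat I u x v = mat 1" using det by (metis invertible_det_nz invertible_def)
  ultimately show ?thesis using matrix_left_invertible_ker by blast
qed

text \<open>The vectors \<open>x j\<close> span a subspace of \<open>L\<close> of dimension
  \<open>card I\<close> that meets the kernel only in 0.\<close>

lemma minor_image:
  fixes v :: "complex ^ ('m::finite \<times> 'n::finite)"
  assumes det: "det (minor_mat I u x v) \<noteq> 0" and L: "vec.subspace L" and x: "\<forall>j\<in>I. x j \<in> L"
  shows "vec.dim (rker v \<inter> L) + card I \<le> vec.dim L"
proof -
  define f where "f c = (\<Sum>j\<in>UNIV. c $ j *s x j)" for c :: "complex ^ 'm"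
  have lf: "Vector_Spaces.linear (*s) (*s) f"
    by (unfold_locales) (simp_all add: f_def vec.scale_left_distrib sum.distrib vec.scale_sum_right)
  have f0: "f 0 = 0" by (simp add: f_def)
  have "inj_on f (coord_space I)"
    using minor_inj[OF det] by (intro linear_inj_on_subspace lf subspace_coord_space) (simp add: f_def)
  then have dim: "vec.dim (f ` coord_space I) = card I"
    using dim_inj_image[OF lf _ subspace_coord_space] dim_coord_space by metis
  have sub: "f ` coord_space I \<subseteq> L"
  proof
    fix y assume "y \<in> f ` coord_space I"
    then obtain c where c: "c \<in> coord_space I" "y = f c" by auto
    have "c $ j *s x j \<in> L" for j
      using c(1) x vec.subspace_scale[OF L] vec.subspace_0[OF L] by (cases "j \<in> I") (auto simp: coord_space_def)
    then show "y \<in> L" unfolding c(2) f_def by (intro vec.subspace_sum[OF L])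
  qed
  have int: "(rker v \<inter> L) \<inter> f ` coord_space I = {0}"
  proof -
    have "y = 0" if y: "y \<in> (rker v \<inter> L) \<inter> f ` coord_space I" for y
    proof -
      obtain c where c: "c \<in> coord_space I" "y = f c" using y by auto
      then have "mat_of v *v (\<Sum>j\<in>UNIV. c $ j *s x j) = 0" using y by (simp add: rker_def f_def)
      then show ?thesis using minor_inj[OF det c(1)] c(2) f0 by simp
    qed
    moreover have "0 \<in> (rker v \<inter> L) \<inter> f ` coord_space I"
      using vec.subspace_0[OF vec.subspace_inter[OF subspace_rker L]] f0
        vec.subspace_0[OF subspace_coord_space[of I]] by (metis IntI imageI)
    ultimately show ?thesis by blast
  qed
  have "vec.dim (rker v \<inter> L) + vec.dim (f ` coord_space I) \<le> vec.dim L + vec.dim ((rker v \<inter> L) \<inter> f ` coord_space I)"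
    by (intro dim_add_le_dim_inter vec.subspace_inter subspace_rker L vec.linear_subspace_image lf subspace_coord_space sub) auto
  then show ?thesis by (simp add: int dim)
qed

text \<open>The \<open>x j\<close> are a basis of a complement of the kernel in \<open>L\<close>,
  and the \<open>u i\<close> are dual to their images. Independent images number at most
  \<open>CARD('m)\<close>, so they can be indexed by a subset of the row indices.\<close>

lemma minor_frame:
  fixes v0 :: "complex ^ ('m::finite \<times> 'n::finite)"
  assumes L: "vec.subspace L"
  shows "\<exists>I (u :: 'm \<Rightarrow> complex ^ 'm) (x :: 'm \<Rightarrow> complex ^ 'n).
    card I + vec.dim (rker v0 \<inter> L) = vec.dim L \<and> (\<forall>j\<in>I. x j \<in> L) \<and>
    (\<forall>i\<in>I. \<forall>j\<in>I. (\<Sum>k\<in>UNIV. u i $ k * (mat_of v0 *v x j) $ k) = (if i = j then 1 else 0))"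
proof -
  let ?f = "(*v) (mat_of v0)"
  have lf: "Vector_Spaces.linear (*s) (*s) ?f" by (rule matrix_vector_mul_linear_gen)
  have subN: "vec.subspace (rker v0 \<inter> L)" by (intro vec.subspace_inter subspace_rker L)
  obtain R where R: "vec.subspace R" "R \<subseteq> L" "R \<inter> (rker v0 \<inter> L) = {0}"
    "vec.dim R + vec.dim (rker v0 \<inter> L) = vec.dim L"
    by (rule subspace_complement[OF subN L Int_lower2]) (rule that)
  have inj: "inj_on ?f R" using R(2,3) by (intro linear_inj_on_subspace lf R(1)) (auto simp: rker_def)
  obtain B where B: "B \<subseteq> R" "vec.independent B" "R \<subseteq> vec.span B" "card B = vec.dim R"
    by (rule vec.basis_exists[of R])
  have spB: "vec.span B = R" using B(3) vec.span_minimal[OF B(1) R(1)] by (rule subset_antisym[rotated])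
  have fB: "finite B" using B(2) vec.finiteI_independent by blast
  have injB: "inj_on ?f B" using inj_on_subset[OF inj B(1)] .
  have ind: "vec.independent (?f ` B)"
    using vec.linear_independent_injective_image[OF lf B(2)] inj spB by simp
  have "card B \<le> CARD('m)"
    using vec.independent_card_le_dim[OF subset_UNIV ind] card_image[OF injB] vec_dim_card by metis
  then obtain I :: "'m set" where I: "card I = card B" by (rule obtain_subset_with_card_n)
  then obtain x where x: "bij_betw x I B" using finite_same_card_bij[of I B] fB by auto
  have injx: "inj_on (\<lambda>j. ?f (x j)) I"
    using x injB comp_inj_on[of x I ?f] by (auto simp: bij_betw_def o_def)
  have "(\<lambda>j. ?f (x j)) ` I = ?f ` B"
    unfolding image_image[symmetric, of ?f x] bij_betw_imp_surj_on[OF x] ..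
  then have ind': "vec.independent ((\<lambda>j. ?f (x j)) ` I)" using ind by simp
  obtain u where u: "\<forall>i\<in>I. \<forall>j\<in>I. (\<Sum>k\<in>UNIV. u i $ k * ?f (x j) $ k) = (if i = j then 1 else 0)"
    using dual_vectors[OF injx ind'] by (elim exE) (rule that)
  have "card I + vec.dim (rker v0 \<inter> L) = vec.dim L" using I B R by simp
  moreover have "\<forall>j\<in>I. x j \<in> L" using x B(1) R(2) by (auto simp: bij_betw_def)
  ultimately show ?thesis using u by (intro exI[of _ I] exI[of _ u] exI[of _ x] conjI)
qed

lemma minor_frame_det:
  assumes "\<forall>i\<in>I. \<forall>j\<in>I. (\<Sum>k\<in>UNIV. u i $ k * (mat_of v0 *v x j) $ k) = (if i = j then 1 else 0)"
  shows "det (minor_mat I u x v0) = 1"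
proof -
  have "minor_mat I u x v0 = mat 1" using assms by (auto simp: minor_mat_def mat_def vec_eq_iff)
  then show ?thesis by simp
qed

text \<open>\<open>F\<close> is the minor that equals 1 at \<open>v0\<close>: wherever it is
  nonzero, the chosen vectors of \<open>L\<close> keep independent images.\<close>

lemma rker_semicontinuous:
  fixes v0 :: "complex ^ ('m::finite \<times> 'n::finite)"
  assumes L: "vec.subspace L"
  obtains d F where "form d F" "F v0 \<noteq> 0" "\<And>v. F v \<noteq> 0 \<Longrightarrow> vec.dim (rker v \<inter> L) \<le> vec.dim (rker v0 \<inter> L)"
proof -
  obtain I and u :: "'m \<Rightarrow> complex ^ 'm" and x :: "'m \<Rightarrow> complex ^ 'n" where I:
    "card I + vec.dim (rker v0 \<inter> L) = vec.dim L" "\<forall>j\<in>I. x j \<in> L"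
    "\<forall>i\<in>I. \<forall>j\<in>I. (\<Sum>k\<in>UNIV. u i $ k * (mat_of v0 *v x j) $ k) = (if i = j then 1 else 0)"
    using minor_frame[OF L, of v0] by (elim exE conjE) (rule that)
  show thesis
  proof (rule that[OF form_minor[of I u x]])
    show "det (minor_mat I u x v0) \<noteq> 0" using minor_frame_det[OF I(3)] by simp
    show "vec.dim (rker v \<inter> L) \<le> vec.dim (rker v0 \<inter> L)" if "det (minor_mat I u x v) \<noteq> 0" for v
      using minor_image[OF that L I(2)] I(1) by simp
  qed
qed

lemma lker_semicontinuous:
  fixes v0 :: "complex ^ ('m::finite \<times> 'n::finite)"
  assumes L: "vec.subspace L"
  obtains d F where "form d F" "F v0 \<noteq> 0" "\<And>v. F v \<noteq> 0 \<Longrightarrow> vec.dim (lker v \<inter> L) \<le> vec.dim (lker v0 \<inter> L)"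
proof -
  obtain d F where F: "form d F" "F (flip_vec v0) \<noteq> 0"
    "\<And>v. F v \<noteq> 0 \<Longrightarrow> vec.dim (rker v \<inter> L) \<le> vec.dim (rker (flip_vec v0) \<inter> L)"
    by (rule rker_semicontinuous[OF L, of "flip_vec v0"], rule that)
  show thesis by (rule that[OF form_flip_vec[OF F(1)] F(2)]) (use F(3) in \<open>auto simp flip: rker_flip_vec\<close>)
qed

section \<open>Charts of the degeneracy locus\<close>

definition degen :: "(complex ^ 'n::finite) set \<Rightarrow> (complex ^ 'm::finite) set \<Rightarrow> nat \<Rightarrow> complex ^ ('m \<times> 'n) \<Rightarrow> bool" where
  "degen L1 L2 r v \<longleftrightarrow> r \<le> vec.dim (rker v \<inter> L1) \<and> r \<le> vec.dim (lker v \<inter> L2)"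

definition degen_locus :: "(complex ^ 'n::finite) set \<Rightarrow> (complex ^ 'm::finite) set \<Rightarrow> nat \<Rightarrow> ('m \<times> 'n) point set" where
  "degen_locus L1 L2 r = {pt v | v. v \<noteq> 0 \<and> degen L1 L2 r v}"

text \<open>Reduced echelon form. A vector of \<open>W\<close> outside the span of the old ones is
  cleared at the pivots \<open>J\<close>, normalised at a new pivot \<open>j0\<close>, and used to
  clear the old vectors at \<open>j0\<close>.\<close>

lemma echelon_vectors:
  fixes W :: "(complex ^ 'n::finite) set"
  assumes W: "vec.subspace W" "W \<subseteq> coord_space I" and "r \<le> vec.dim W"
  shows "\<exists>J w. J \<subseteq> I \<and> card J = r \<and> (\<forall>j\<in>J. w j \<in> W \<and> (\<forall>k\<in>J. w j $ k = (if k = j then 1 else 0)))"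
  using assms(3)
proof (induction r)
  case 0
  show ?case by (intro exI[of _ "{}"]) simp
next
  case (Suc r)
  then obtain J w where J: "J \<subseteq> I" "card J = r"
    and w: "\<forall>j\<in>J. w j \<in> W \<and> (\<forall>k\<in>J. w j $ k = (if k = j then 1 else 0))" by auto
  have "vec.dim (vec.span (w ` J)) \<le> r"
    using vec.dim_le_card[of "vec.span (w ` J)" "w ` J"] card_image_le[of J w] J(2) by simp
  then have "\<not> W \<subseteq> vec.span (w ` J)" using Suc.prems vec.dim_subset[of W "vec.span (w ` J)"] by auto
  then obtain u where u: "u \<in> W" "u \<notin> vec.span (w ` J)" by blast
  define u' where "u' = u - (\<Sum>j\<in>J. u $ j *s w j)"
  have u'W: "u' \<in> W" unfolding u'_def using w u(1)
    by (intro vec.subspace_diff[OF W(1)] vec.subspace_sum[OF W(1)] vec.subspace_scale[OF W(1)]) auto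
  have u'J: "u' $ k = 0" if "k \<in> J" for k
  proof -
    have "(\<Sum>j\<in>J. u $ j * w j $ k) = (\<Sum>j\<in>J. if j = k then u $ k else 0)"
      using w that by (intro sum.cong) auto
    also have "\<dots> = u $ k" using that by simp
    finally show ?thesis by (simp add: u'_def)
  qed
  have "u' \<noteq> 0"
  proof
    assume "u' = 0"
    then have "u = (\<Sum>j\<in>J. u $ j *s w j)" by (simp add: u'_def)
    moreover have "(\<Sum>j\<in>J. u $ j *s w j) \<in> vec.span (w ` J)"
      by (intro vec.span_sum vec.span_scale vec.span_base) auto
    ultimately show False using u(2) by simp
  qed
  then obtain j0 where j0: "u' $ j0 \<noteq> 0" by (auto simp: vec_eq_iff)
  have j0J: "j0 \<notin> J" using j0 u'J by blast
  have j0I: "j0 \<in> I" using u'W W(2) j0 by (auto simp: coord_space_def)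
  define t where "t = (1 / u' $ j0) *s u'"
  have tW: "t \<in> W" unfolding t_def by (intro vec.subspace_scale[OF W(1)] u'W)
  have t: "t $ j0 = 1" "\<And>k. k \<in> J \<Longrightarrow> t $ k = 0" using j0 u'J by (auto simp: t_def)
  define w' where "w' j = (if j = j0 then t else w j - w j $ j0 *s t)" for j
  show ?case
  proof (intro exI conjI)
    show "insert j0 J \<subseteq> I" using J j0I by simp
    show "card (insert j0 J) = Suc r" using J j0J by simp
    show "\<forall>j\<in>insert j0 J. w' j \<in> W \<and> (\<forall>k\<in>insert j0 J. w' j $ k = (if k = j then 1 else 0))"
    proof (intro ballI conjI)
      fix j assume j: "j \<in> insert j0 J"
      show "w' j \<in> W"
        using j w tW by (auto simp: w'_def intro!: vec.subspace_diff[OF W(1)] vec.subspace_scale[OF W(1)])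
      fix k assume k: "k \<in> insert j0 J"
      show "w' j $ k = (if k = j then 1 else 0)"
        using j k w t j0J by (auto simp: w'_def)
    qed
  qed
qed

text \<open>The matrix of the substitution that expresses the columns in \<open>J\<close> through those in \<open>I - J\<close>.\<close>

definition alpha :: "'n set \<Rightarrow> 'n set \<Rightarrow> ('n \<Rightarrow> 'n \<Rightarrow> complex) \<Rightarrow> complex ^ 'n::finite ^ 'n" where
  "alpha I J c = (\<chi> k j. if k \<in> J then 0 else if j \<in> J then (if k \<in> I then c k j else 0) else if k = j then 1 else 0)"

text \<open>The kernel vector \<open>w j\<close> has entry 1 at \<open>j\<close> and 0 at the other
  pivots, so it expresses column \<open>j\<close> through the columns in \<open>I - J\<close>, with
  coefficients \<open>- w j $ k\<close>.\<close>

lemma echelon_alpha: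
  fixes v :: "complex ^ ('m::finite \<times> 'n::finite)"
  assumes "r \<le> vec.dim (rker v \<inter> coord_space I)"
  shows "\<exists>J c. J \<subseteq> I \<and> card J = r \<and> mat_of v ** alpha I J c = mat_of v"
proof -
  obtain J w where J: "J \<subseteq> I" "card J = r"
    and w: "\<forall>j\<in>J. w j \<in> rker v \<inter> coord_space I \<and> (\<forall>k\<in>J. w j $ k = (if k = j then 1 else 0))"
    using echelon_vectors[OF vec.subspace_inter[OF subspace_rker subspace_coord_space] Int_lower2 assms] by blast
  define c where "c k j = - w j $ k" for k j
  have "(mat_of v ** alpha I J c) $ i $ j = mat_of v $ i $ j" for i j
  proof (cases "j \<in> J")
    case True
    have "(mat_of v *v w j) $ i = 0" using w True by (simp add: rker_def)
    then have "(\<Sum>k\<in>UNIV. v $ (i, k) * alpha I J c $ k $ j) = (\<Sum>k\<in>UNIV. v $ (i, k) * (alpha I J c $ k $ j + w j $ k))"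
      by (simp add: matrix_vector_mult_def distrib_left sum.distrib)
    also have "\<dots> = (\<Sum>k\<in>UNIV. if k = j then v $ (i, j) else 0)"
    proof (intro sum.cong refl)
      fix k
      have "w j $ k = 0" if "k \<notin> I" using w True that by (auto simp: coord_space_def)
      then have "alpha I J c $ k $ j + w j $ k = (if k = j then 1 else 0)"
        using w True by (auto simp: alpha_def c_def)
      then show "v $ (i, k) * (alpha I J c $ k $ j + w j $ k) = (if k = j then v $ (i, j) else 0)" by simp
    qed
    finally show ?thesis by (simp add: matrix_matrix_mult_def)
  next
    case False
    have "(\<Sum>k\<in>UNIV. v $ (i, k) * alpha I J c $ k $ j) = (\<Sum>k\<in>UNIV. if k = j then v $ (i, j) else 0)"
      using False by (intro sum.cong) (auto simp: alpha_def)
    then show ?thesis by (simp add: matrix_matrix_mult_def)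
  qed
  then have "mat_of v ** alpha I J c = mat_of v" by (simp add: vec_eq_iff)
  then show ?thesis using J by blast
qed

lemma dim_alpha_kernel:
  fixes I J :: "'n::finite set"
  assumes J: "J \<subseteq> I"
  shows "card J \<le> vec.dim ({z. alpha I J c *v z = 0} \<inter> coord_space I)"
proof -
  \<comment> \<open>For \<open>j \<in> J\<close>, column \<open>j\<close> of \<open>T\<close> is the
    unit vector minus the combination that \<open>alpha\<close> substitutes for it, so
    \<open>alpha\<close> kills it.\<close>
  define T :: "complex ^ 'n ^ 'n" where
    "T = (\<chi> k j. if k \<in> J then if k = j then 1 else 0 else if j \<in> J \<and> k \<in> I then - c k j else 0)"
  have inj: "inj_on ((*v) T) (coord_space J)"
  proof (rule linear_inj_on_subspace[OF matrix_vector_mul_linear_gen subspace_coord_space])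
    fix z assume z: "z \<in> coord_space J" "T *v z = 0"
    have "z $ k = 0" if "k \<in> J" for k
    proof -
      have "(T *v z) $ k = (\<Sum>j\<in>UNIV. if j = k then z $ k else 0)"
        unfolding matrix_vector_mult_def vec_lambda_beta using that by (intro sum.cong) (auto simp: T_def)
      then show ?thesis using z(2) by simp
    qed
    then show "z = 0" using z(1) by (auto simp: vec_eq_iff coord_space_def)
  qed
  have "(alpha I J c ** T) $ k $ l = 0" if "l \<in> J" for k l
  proof (cases "k \<in> J")
    case True
    then show ?thesis by (simp add: matrix_matrix_mult_def alpha_def)
  next
    case False
    have "(alpha I J c ** T) $ k $ l = (\<Sum>j\<in>UNIV. (if j = l then alpha I J c $ k $ l else 0) + (if j = k then T $ k $ l else 0))"
      unfolding matrix_matrix_mult_def vec_lambda_beta using False that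
      by (intro sum.cong) (auto simp: alpha_def T_def)
    also have "\<dots> = 0" using False that by (simp add: sum.distrib) (simp add: alpha_def T_def)
    finally show ?thesis .
  qed
  then have "alpha I J c *v (T *v z) = 0" if "z \<in> coord_space J" for z
    using that unfolding matrix_vector_mul_assoc
    by (auto simp: vec_eq_iff matrix_vector_mult_def coord_space_def intro!: sum.neutral) (metis mult_eq_0_iff)
  moreover have "T *v z \<in> coord_space I" for z
    using J by (intro matrix_vector_in_coord_space) (auto simp: T_def)
  ultimately have "(*v) T ` coord_space J \<subseteq> {z. alpha I J c *v z = 0} \<inter> coord_space I" by blast
  then have "vec.dim ((*v) T ` coord_space J) \<le> vec.dim ({z. alpha I J c *v z = 0} \<inter> coord_space I)"
    by (rule vec.dim_subset)
  then show ?thesis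
    using dim_inj_image[OF matrix_vector_mul_linear_gen inj subspace_coord_space] by (simp add: dim_coord_space)
qed

text \<open>Free matrix entries, then the coefficients of the dependent columns, then those of the
  dependent rows.\<close>

type_synonym ('m, 'n) param = "('m \<times> 'n) + ('n \<times> 'n) + ('m \<times> 'm)"

text \<open>The block of free entries off \<open>J'\<close> and \<open>J\<close>, extended to all
  columns by the right factor and to all rows by the left factor.\<close>

definition core :: "'n set \<Rightarrow> 'm set \<Rightarrow> 'n set \<Rightarrow> 'm set \<Rightarrow> (('m::finite, 'n::finite) param \<Rightarrow> complex) \<Rightarrow> complex ^ 'n ^ 'm" where
  "core I1 I2 J J' x = transpose (alpha I2 J' (\<lambda>l i. x (Inr (Inr (l, i))))) **
     (\<chi> l k. if l \<in> J' \<or> k \<in> J then 0 else x (Inl (l, k))) ** alpha I1 J (\<lambda>k j. x (Inr (Inl (k, j))))"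

text \<open>The coordinates of \<open>x\<close> on which \<open>core\<close> depends; their number
  is the dimension of the affine cone.\<close>

definition params :: "'n set \<Rightarrow> 'm set \<Rightarrow> 'n set \<Rightarrow> 'm set \<Rightarrow> ('m, 'n) param set" where
  "params I1 I2 J J' = Inl ` ((- J') \<times> (- J)) \<union> ((\<lambda>p. Inr (Inl p)) ` ((I1 - J) \<times> J) \<union> (\<lambda>p. Inr (Inr p)) ` ((I2 - J') \<times> J'))"

lemma core_nth:
  "core I1 I2 J J' x $ i $ j = (\<Sum>l\<in>UNIV. alpha I2 J' (\<lambda>l i. x (Inr (Inr (l, i)))) $ l $ i *
     (\<Sum>k\<in>UNIV. (if l \<in> J' \<or> k \<in> J then 0 else x (Inl (l, k))) * alpha I1 J (\<lambda>k j. x (Inr (Inl (k, j)))) $ k $ j))"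
  unfolding core_def matrix_mul_assoc[symmetric]
  by (simp add: matrix_matrix_mult_def transpose_def)

lemma sum_indicator_mult: "(\<Sum>l\<in>(UNIV :: 'a::finite set). (if l = i then 1 else 0) * f l) = (f i :: complex)"
proof -
  have "(\<Sum>l\<in>UNIV. (if l = i then 1 else 0) * f l) = (\<Sum>l\<in>UNIV. if l = i then f i else 0)"
    by (intro sum.cong) auto
  then show ?thesis by simp
qed

lemma core_nth_free_row:
  assumes "i \<notin> J'"
  shows "core I1 I2 J J' x $ i $ j = (\<Sum>k\<in>UNIV. (if k \<in> J then 0 else x (Inl (i, k))) * alpha I1 J (\<lambda>k j. x (Inr (Inl (k, j)))) $ k $ j)"
proof -
  have a: "alpha I2 J' c $ l $ i = (if l = i then 1 else 0)" for c l
    using assms by (auto simp: alpha_def)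
  show ?thesis unfolding core_nth a sum_indicator_mult using assms by simp
qed

lemma core_nth_free_col:
  assumes "j \<notin> J"
  shows "core I1 I2 J J' x $ i $ j = (\<Sum>l\<in>UNIV. alpha I2 J' (\<lambda>l i. x (Inr (Inr (l, i)))) $ l $ i * (if l \<in> J' then 0 else x (Inl (l, j))))"
proof -
  have a: "alpha I1 J c $ k $ j = (if k = j then 1 else 0)" for c k
    using assms by (auto simp: alpha_def)
  have "(\<Sum>k\<in>UNIV. (if l \<in> J' \<or> k \<in> J then 0 else x (Inl (l, k))) * (if k = j then 1 else 0))
      = (if l \<in> J' then 0 else x (Inl (l, j)))" for l
  proof -
    have "(\<Sum>k\<in>UNIV. (if l \<in> J' \<or> k \<in> J then 0 else x (Inl (l, k))) * (if k = j then 1 else 0))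
      = (\<Sum>k\<in>UNIV. if k = j then (if l \<in> J' then 0 else x (Inl (l, j))) else 0)"
      using assms by (intro sum.cong) auto
    then show ?thesis by simp
  qed
  then show ?thesis unfolding core_nth a by simp
qed

lemma core_nth_free:
  assumes "i \<notin> J'" "j \<notin> J" shows "core I1 I2 J J' x $ i $ j = x (Inl (i, j))"
proof -
  have "alpha I2 J' c $ l $ i = (if l = i then 1 else 0)" for c l
    using assms by (auto simp: alpha_def)
  then have "core I1 I2 J J' x $ i $ j = (\<Sum>l\<in>UNIV. if l = i then x (Inl (i, j)) else 0)"
    unfolding core_nth_free_col[OF assms(2)] using assms by (intro sum.cong) auto
  then show ?thesis by simp
qed

lemma core_nth_row:
  assumes "i \<notin> J'" "j \<in> J"
  shows "core I1 I2 J J' x $ i $ j = (\<Sum>k\<in>I1 - J. x (Inl (i, k)) * x (Inr (Inl (k, j))))"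
  unfolding core_nth_free_row[OF assms(1)]
  using assms(2) by (intro sum.mono_neutral_cong_right) (auto simp: alpha_def)

lemma core_nth_col:
  assumes "i \<in> J'" "j \<notin> J"
  shows "core I1 I2 J J' x $ i $ j = (\<Sum>l\<in>I2 - J'. x (Inr (Inr (l, i))) * x (Inl (l, j)))"
  unfolding core_nth_free_col[OF assms(2)]
  using assms(1) by (intro sum.mono_neutral_cong_right) (auto simp: alpha_def)

text \<open>The kernel of the right factor is contained in the kernel of the product; the transposed
  product gives the same for the left factor.\<close>

lemma degen_core:
  fixes J :: "'n::finite set" and J' :: "'m::finite set"
  assumes J: "J \<subseteq> I1" "card J = r" "J' \<subseteq> I2" "card J' = r"
  shows "degen (coord_space I1) (coord_space I2) r (vec_of (core I1 I2 J J' x))"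
  unfolding degen_def
proof
  let ?A = "alpha I1 J (\<lambda>k j. x (Inr (Inl (k, j))))" and ?B = "alpha I2 J' (\<lambda>l i. x (Inr (Inr (l, i))))"
  let ?D = "(\<chi> l k. if l \<in> J' \<or> k \<in> J then 0 else x (Inl (l, k))) :: complex ^ 'n ^ 'm"
  have "core I1 I2 J J' x *v z = (transpose ?B ** ?D) *v (?A *v z)" for z
    unfolding core_def by (simp only: matrix_vector_mul_assoc)
  then have sub: "{z. ?A *v z = 0} \<inter> coord_space I1 \<subseteq> rker (vec_of (core I1 I2 J J' x)) \<inter> coord_space I1"
    by (auto simp: rker_def)
  then show "r \<le> vec.dim (rker (vec_of (core I1 I2 J J' x)) \<inter> coord_space I1)"
    using order_trans[OF dim_alpha_kernel[OF J(1)] vec.dim_subset[OF sub]] J(2) by simp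
  have "transpose (core I1 I2 J J' x) *v z = (transpose ?A ** transpose ?D) *v (?B *v z)" for z
    unfolding core_def by (simp only: matrix_vector_mul_assoc matrix_transpose_mul transpose_transpose matrix_mul_assoc)
  then have sub: "{z. ?B *v z = 0} \<inter> coord_space I2 \<subseteq> lker (vec_of (core I1 I2 J J' x)) \<inter> coord_space I2"
    by (auto simp: lker_def)
  then show "r \<le> vec.dim (lker (vec_of (core I1 I2 J J' x)) \<inter> coord_space I2)"
    using order_trans[OF dim_alpha_kernel[OF J(3)] vec.dim_subset[OF sub]] J(4) by simp
qed

lemma core_cover:
  fixes h :: "complex ^ ('m::finite \<times> 'n::finite)"
  assumes "degen (coord_space I1) (coord_space I2) r h"
  shows "\<exists>J J' x. J \<subseteq> I1 \<and> card J = r \<and> J' \<subseteq> I2 \<and> card J' = r \<and> mat_of h = core I1 I2 J J' x"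
proof -
  obtain J c where J: "J \<subseteq> I1" "card J = r" "mat_of h ** alpha I1 J c = mat_of h"
    using echelon_alpha[of r h I1] assms unfolding degen_def by blast
  have "r \<le> vec.dim (rker (flip_vec h) \<inter> coord_space I2)" using assms by (simp add: degen_def rker_flip_vec)
  then obtain J' d where J': "J' \<subseteq> I2" "card J' = r" "mat_of (flip_vec h) ** alpha I2 J' d = mat_of (flip_vec h)"
    using echelon_alpha[of r "flip_vec h" I2] by blast
  have "transpose (alpha I2 J' d) ** mat_of h = mat_of h"
    using arg_cong[OF J'(3), of transpose] by (simp add: matrix_transpose_mul)
  then have h: "transpose (alpha I2 J' d) ** (mat_of h ** alpha I1 J c) = mat_of h" using J(3) by simp
  \<comment> \<open>The free entries are those of \<open>h\<close> itself: both substitutions leave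
    \<open>h\<close> unchanged, so nothing has to be solved for.\<close>
  define x :: "('m, 'n) param \<Rightarrow> complex" where
    "x = (\<lambda>u. case u of Inl p \<Rightarrow> h $ p | Inr (Inl (k, j)) \<Rightarrow> c k j | Inr (Inr (l, i)) \<Rightarrow> d l i)"
  have "core I1 I2 J J' x $ i $ j = (transpose (alpha I2 J' d) ** (mat_of h ** alpha I1 J c)) $ i $ j" for i j
  proof -
    have *: "alpha I2 J' d $ l $ i * (\<Sum>k\<in>UNIV. (if l \<in> J' \<or> k \<in> J then 0 else h $ (l, k)) * alpha I1 J c $ k $ j) =
      alpha I2 J' d $ l $ i * (\<Sum>k\<in>UNIV. h $ (l, k) * alpha I1 J c $ k $ j)" for l
    proof (cases "l \<in> J'")
      case True
      then show ?thesis by (simp add: alpha_def)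
    next
      case False
      then have "(\<Sum>k\<in>UNIV. (if l \<in> J' \<or> k \<in> J then 0 else h $ (l, k)) * alpha I1 J c $ k $ j) =
        (\<Sum>k\<in>UNIV. h $ (l, k) * alpha I1 J c $ k $ j)"
        by (intro sum.cong) (auto simp: alpha_def)
      then show ?thesis by simp
    qed
    show ?thesis unfolding core_nth x_def sum.case prod.case * by (simp add: matrix_matrix_mult_def transpose_def)
  qed
  then have "mat_of h = core I1 I2 J J' x" unfolding h by (simp add: vec_eq_iff)
  then show ?thesis using J J' by blast
qed

lemma rker_base_change:
  fixes F F' :: "complex ^ 'n::finite ^ 'n" and P P' :: "complex ^ 'm::finite ^ 'm"
  assumes F: "F ** F' = mat 1" "F' ** F = mat 1" and P: "P' ** P = mat 1"
  shows "rker (vec_of (P ** A ** F')) = (*v) F ` rker (vec_of A)"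
proof -
  have *: "(P ** A ** F') *v z = 0 \<longleftrightarrow> A *v (F' *v z) = 0" for z
  proof -
    have e: "(P ** A ** F') *v z = P *v (A *v (F' *v z))"
      by (simp only: matrix_vector_mul_assoc matrix_mul_assoc)
    have "P' *v (P *v y) = y" for y by (simp only: matrix_vector_mul_assoc P matrix_vector_mul_lid)
    then have "P *v y = 0 \<longleftrightarrow> y = 0" for y by (metis matrix_vector_mult_0_right)
    then show ?thesis unfolding e .
  qed
  show ?thesis
  proof (intro set_eqI iffI)
    fix z assume "z \<in> rker (vec_of (P ** A ** F'))"
    then have "F' *v z \<in> rker (vec_of A)" using * by (simp add: rker_def)
    moreover have "z = F *v (F' *v z)" by (simp only: matrix_vector_mul_assoc F matrix_vector_mul_lid)
    ultimately show "z \<in> (*v) F ` rker (vec_of A)" by blast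
  next
    fix z assume "z \<in> (*v) F ` rker (vec_of A)"
    then obtain y where y: "A *v y = 0" "z = F *v y" by (auto simp: rker_def)
    have "F' *v z = y" unfolding y(2) by (simp only: matrix_vector_mul_assoc F matrix_vector_mul_lid)
    then show "z \<in> rker (vec_of (P ** A ** F'))" using * y(1) by (simp add: rker_def)
  qed
qed

section \<open>Charts for arbitrary subspaces, by base change\<close>

context
  fixes F F' :: "complex ^ 'n::finite ^ 'n" and G G' :: "complex ^ 'm::finite ^ 'm"
    and I1 :: "'n set" and I2 :: "'m set"
  assumes F: "F ** F' = mat 1" "F' ** F = mat 1" and G: "G ** G' = mat 1" "G' ** G = mat 1"
begin

text \<open>The base change is contragredient to the one in \<open>tensor_subspace_coords\<close>:
  here the kernels, there the row and column spans, have to follow \<open>F\<close> and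
  \<open>G\<close>.\<close>

definition chart :: "'n set \<Rightarrow> 'm set \<Rightarrow> (('m, 'n) param \<Rightarrow> complex) \<Rightarrow> complex ^ ('m \<times> 'n)" where
  "chart J J' x = vec_of (transpose G' ** core I1 I2 J J' x ** F')"

lemma transpose_inverses: "transpose G ** transpose G' = mat 1" "transpose G' ** transpose G = mat 1"
  "transpose F ** transpose F' = mat 1" "transpose F' ** transpose F = mat 1"
  using F G by (metis matrix_transpose_mul transpose_mat)+

lemma dim_kernels_base_change:
  "vec.dim (rker (vec_of (transpose G' ** A ** F')) \<inter> (*v) F ` coord_space I1) = vec.dim (rker (vec_of A) \<inter> coord_space I1)"
  "vec.dim (lker (vec_of (transpose G' ** A ** F')) \<inter> (*v) G ` coord_space I2) = vec.dim (lker (vec_of A) \<inter> coord_space I2)"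
proof -
  have injF: "inj ((*v) F)" and injG: "inj ((*v) G)"
    using inj_matrix_of_left_inverse F(2) G(2) by blast+
  have "rker (vec_of (transpose G' ** A ** F')) \<inter> (*v) F ` coord_space I1 = (*v) F ` (rker (vec_of A) \<inter> coord_space I1)"
    unfolding rker_base_change[OF F transpose_inverses(1)] image_Int[OF injF] ..
  then show "vec.dim (rker (vec_of (transpose G' ** A ** F')) \<inter> (*v) F ` coord_space I1) = vec.dim (rker (vec_of A) \<inter> coord_space I1)"
    using dim_inj_image[OF matrix_vector_mul_linear_gen inj_on_subset[OF injF subset_UNIV]
      vec.subspace_inter[OF subspace_rker subspace_coord_space]] by simp
  have "flip_vec (vec_of (transpose G' ** A ** F')) = vec_of (transpose F' ** transpose A ** G')"
  proof -
    have "mat_of (flip_vec (vec_of (transpose G' ** A ** F'))) = transpose F' ** transpose A ** G'"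
      by (simp add: matrix_transpose_mul matrix_mul_assoc)
    then show ?thesis by (metis vec_of_mat_of)
  qed
  then have "lker (vec_of (transpose G' ** A ** F')) = rker (vec_of (transpose F' ** transpose A ** G'))"
    by (metis rker_flip_vec)
  also have "\<dots> = (*v) G ` rker (vec_of (transpose A))" by (rule rker_base_change[OF G transpose_inverses(3)])
  also have "rker (vec_of (transpose A)) = lker (vec_of A)" by (simp add: rker_def lker_def)
  finally have "lker (vec_of (transpose G' ** A ** F')) \<inter> (*v) G ` coord_space I2 = (*v) G ` (lker (vec_of A) \<inter> coord_space I2)"
    by (simp add: image_Int[OF injG])
  then show "vec.dim (lker (vec_of (transpose G' ** A ** F')) \<inter> (*v) G ` coord_space I2) = vec.dim (lker (vec_of A) \<inter> coord_space I2)"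
    using dim_inj_image[OF matrix_vector_mul_linear_gen inj_on_subset[OF injG subset_UNIV]
      vec.subspace_inter[OF subspace_lker subspace_coord_space]] by simp
qed

lemma degen_base_change:
  "degen ((*v) F ` coord_space I1) ((*v) G ` coord_space I2) r (vec_of (transpose G' ** A ** F')) \<longleftrightarrow>
   degen (coord_space I1) (coord_space I2) r (vec_of A)"
  unfolding degen_def dim_kernels_base_change ..

lemma degen_locus_charts:
  "degen_locus ((*v) F ` coord_space I1) ((*v) G ` coord_space I2) r =
   (\<Union>(J, J') \<in> {J. J \<subseteq> I1 \<and> card J = r} \<times> {J'. J' \<subseteq> I2 \<and> card J' = r}. pset (chart J J') UNIV)" (is "?L = ?R")
proof
  show "?L \<subseteq> ?R"
  proof
    fix p assume "p \<in> ?L"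
    then obtain v where v: "p = pt v" "v \<noteq> 0" "degen ((*v) F ` coord_space I1) ((*v) G ` coord_space I2) r v"
      unfolding degen_locus_def mem_Collect_eq by (elim exE conjE) (rule that)
    define h where "h = vec_of (transpose G ** mat_of v ** F)"
    have "transpose G' ** (transpose G ** mat_of v ** F) ** F' = (transpose G' ** transpose G) ** mat_of v ** (F ** F')"
      by (simp only: matrix_mul_assoc)
    then have vh: "v = vec_of (transpose G' ** mat_of h ** F')" by (simp add: h_def F transpose_inverses)
    then have "degen (coord_space I1) (coord_space I2) r h" using v(3) degen_base_change[of r "mat_of h"] by simp
    from core_cover[OF this]
    obtain J J' x where J: "J \<subseteq> I1" "card J = r" "J' \<subseteq> I2" "card J' = r" "mat_of h = core I1 I2 J J' x"
      by (elim exE conjE) (rule that)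
    then have "chart J J' x = v" using vh by (simp add: chart_def)
    then have "p \<in> pset (chart J J') UNIV" using v(1,2) unfolding pset_def by blast
    then show "p \<in> ?R" using J by (intro UN_I[of "(J, J')"]) simp_all
  qed
  show "?R \<subseteq> ?L"
  proof
    fix p assume "p \<in> ?R"
    then obtain J J' where J: "J \<subseteq> I1" "card J = r" "J' \<subseteq> I2" "card J' = r" "p \<in> pset (chart J J') UNIV" by auto
    from J(5) obtain x where "p = pt (chart J J' x)" "chart J J' x \<noteq> 0"
      unfolding pset_def mem_Collect_eq by (elim exE conjE) (rule that)
    moreover have "degen ((*v) F ` coord_space I1) ((*v) G ` coord_space I2) r (chart J J' x)"
      unfolding chart_def degen_base_change by (rule degen_core[OF J(1-4)])
    ultimately show "p \<in> ?L" unfolding degen_locus_def by (intro CollectI exI[of _ "chart J J' x"] conjI)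
  qed
qed

lemma polyfuns_if:
  "(P \<Longrightarrow> f \<in> polyfuns X) \<Longrightarrow> (\<not> P \<Longrightarrow> g \<in> polyfuns X) \<Longrightarrow> (\<lambda>x. if P then f x else g x) \<in> polyfuns X"
  by (cases P) simp_all

lemma chart_polyfuns: "(\<lambda>x. chart J J' x $ p) \<in> polyfuns (coords (params I1 I2 J J'))"
proof -
  let ?X = "coords (params I1 I2 J J')"
  have c: "(\<lambda>x. x u) \<in> polyfuns ?X" if "u \<in> params I1 I2 J J'" for u
    using that by (intro polyfuns.gen) auto
  have A: "(\<lambda>x. alpha I1 J (\<lambda>k j. x (Inr (Inl (k, j)))) $ k $ j) \<in> polyfuns ?X" for k j
    unfolding alpha_def vec_lambda_beta by (intro polyfuns_if polyfuns.const c) (auto simp: params_def)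
  have B: "(\<lambda>x. alpha I2 J' (\<lambda>l i. x (Inr (Inr (l, i)))) $ l $ i) \<in> polyfuns ?X" for l i
    unfolding alpha_def vec_lambda_beta by (intro polyfuns_if polyfuns.const c) (auto simp: params_def)
  have D: "(\<lambda>x. if l \<in> J' \<or> k \<in> J then 0 else x (Inl (l, k))) \<in> polyfuns ?X" for l k
    by (intro polyfuns_if polyfuns.const c) (auto simp: params_def)
  have core: "(\<lambda>x. core I1 I2 J J' x $ i $ j) \<in> polyfuns ?X" for i j
    unfolding core_nth by (intro polyfuns_sum polyfuns.mult A B D)
  have "(\<lambda>x. \<Sum>l\<in>UNIV. (\<Sum>k\<in>UNIV. transpose G' $ fst p $ k * core I1 I2 J J' x $ k $ l) * F' $ l $ snd p) \<in> polyfuns ?X"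
    by (intro polyfuns_sum polyfuns.mult polyfuns.const core)
  then show ?thesis by (simp add: chart_def vec_of_def matrix_matrix_mult_def)
qed

text \<open>The matrix is linear in the free entries once the column and row coefficients are
  fixed.\<close>

lemma chart_cone: "\<exists>x'. chart J J' x' = s *s chart J J' x"
proof
  define x' where "x' = (\<lambda>u. case u of Inl p \<Rightarrow> s * x (Inl p) | Inr q \<Rightarrow> x (Inr q))"
  have "core I1 I2 J J' x' $ i $ j = s * core I1 I2 J J' x $ i $ j" for i j
    unfolding core_nth sum_distrib_left by (intro sum.cong refl) (simp add: x'_def)
  then show "chart J J' x' = s *s chart J J' x"
    by (simp add: chart_def vec_of_def vec_eq_iff matrix_matrix_mult_def sum_distrib_left sum_distrib_right mult_ac)
qed

lemma core_of_chart: "transpose G ** mat_of (chart J J' x) ** F = core I1 I2 J J' x"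
proof -
  have "transpose G ** (transpose G' ** core I1 I2 J J' x ** F') ** F = (transpose G ** transpose G') ** core I1 I2 J J' x ** (F' ** F)"
    by (simp only: matrix_mul_assoc)
  then show ?thesis by (simp add: chart_def F transpose_inverses)
qed

lemma form_core_entry: "form 1 (\<lambda>v. (transpose G ** mat_of v ** F) $ i $ j)"
proof -
  have "(transpose G ** mat_of v ** F) $ i $ j = (\<Sum>k\<in>UNIV. column i G $ k * (mat_of v *v column j F) $ k)" for v
    unfolding matrix_mul_assoc[symmetric]
    by (simp add: matrix_matrix_mult_def transpose_def column_def matrix_vector_mult_def)
  then show ?thesis by (simp only: form_bilinear_entry)
qed

lemma separatedI:
  assumes "\<And>x. x \<in> supp_in Q \<Longrightarrow> core I1 I2 J J' x $ i $ j = 0"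
    and "x \<in> supp_in (insert u Q)" "core I1 I2 J J' x $ i $ j \<noteq> 0"
  shows "separated (chart J J') Q u"
  unfolding separated_def
proof (intro exI conjI)
  show "form 1 (\<lambda>v. (transpose G ** mat_of v ** F) $ i $ j)" by (rule form_core_entry)
qed (use assms in \<open>auto simp: core_of_chart\<close>)

context
  fixes J J' r \<rho>
  assumes J: "J \<subseteq> I1" "card J = r" "J' \<subseteq> I2" "card J' = r"
    and \<rho>: "inj_on \<rho> (- J')" "\<rho> ` (- J') \<subseteq> - J" "I1 - J \<subseteq> \<rho> ` (- J')"
begin

text \<open>The support of a partial permutation matrix on the free block: it meets every free row
  exactly once and every column in \<open>I1 - J\<close>.\<close>

definition diag_params :: "('m, 'n) param set" where
  "diag_params = (\<lambda>i. Inl (i, \<rho> i)) ` (- J')"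

text \<open>The flag starts with the entries \<open>(i, \<rho> i)\<close>: on them alone, each of the remaining parameters
  is a matrix entry up to a nonzero factor.\<close>

lemma chart_flag: "\<exists>us. distinct us \<and> set us = params I1 I2 J J' \<and> flag_separated (chart J J') {} us"
proof -
  define C :: "('m, 'n) param set" where "C = (\<lambda>p. Inr (Inl p)) ` ((I1 - J) \<times> J)"
  define E :: "('m, 'n) param set" where "E = (\<lambda>p. Inr (Inr p)) ` ((I2 - J') \<times> J')"
  define H :: "('m, 'n) param set" where "H = Inl ` ((- J') \<times> (- J)) - diag_params"
  have fin: "finite diag_params" "finite C" "finite E" "finite H" by (simp_all add: diag_params_def C_def E_def H_def)
  obtain ds where ds: "set ds = diag_params" "distinct ds" using finite_distinct_list[OF fin(1)] by blast
  obtain cs where cs: "set cs = C" "distinct cs" using finite_distinct_list[OF fin(2)] by blast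
  obtain es where es: "set es = E" "distinct es" using finite_distinct_list[OF fin(3)] by blast
  obtain hs where hs: "set hs = H" "distinct hs" using finite_distinct_list[OF fin(4)] by blast
  have dsub: "diag_params \<subseteq> Inl ` ((- J') \<times> (- J))" using \<rho>(2) by (auto simp: diag_params_def)
  have disj: "diag_params \<inter> C = {}" "(diag_params \<union> C) \<inter> E = {}" "(diag_params \<union> C \<union> E) \<inter> H = {}"
    by (auto simp: diag_params_def C_def E_def H_def)
  have sepInl: "separated (chart J J') Q (Inl (i, j))" if "i \<notin> J'" "j \<notin> J" "Inl (i, j) \<notin> Q" for i j Q
  proof (rule separatedI[where x = "\<lambda>u. if u = Inl (i, j) then 1 else 0"])
    show "core I1 I2 J J' x $ i $ j = 0" if "x \<in> supp_in Q" for x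
      using that \<open>Inl (i, j) \<notin> Q\<close> by (simp add: core_nth_free[OF \<open>i \<notin> J'\<close> \<open>j \<notin> J\<close>] supp_in_def)
    show "core I1 I2 J J' (\<lambda>u. if u = Inl (i, j) then 1 else 0) $ i $ j \<noteq> 0"
      by (simp add: core_nth_free[OF that(1,2)])
  qed (simp add: supp_in_def)
  have 1: "flag_separated (chart J J') {} ds"
  proof (rule flag_separatedI[OF ds(2)])
    fix Q u assume "u \<in> set ds" "u \<notin> Q"
    moreover then obtain i j where "u = Inl (i, j)" "i \<notin> J'" "j \<notin> J" using ds dsub by auto
    ultimately show "separated (chart J J') Q u" using sepInl by simp
  qed simp
  have 4: "flag_separated (chart J J') (diag_params \<union> C \<union> E) hs"
  proof (rule flag_separatedI[OF hs(2)])
    show "set hs \<inter> (diag_params \<union> C \<union> E) = {}" using hs disj by auto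
    fix Q u assume "u \<in> set hs" "u \<notin> Q"
    moreover then obtain i j where "u = Inl (i, j)" "i \<notin> J'" "j \<notin> J" using hs by (auto simp: H_def)
    ultimately show "separated (chart J J') Q u" using sepInl by simp
  qed
  \<comment> \<open>Until the remaining free entries are released, a free row has its only possible
    nonzero entry at \<open>\<rho> i\<close>. This reduces the sums in \<open>core_nth_row\<close>
    and \<open>core_nth_col\<close> to one term.\<close>
  have diagI: "x (Inl (i, k)) = 0" if "x \<in> supp_in Q" "Q \<subseteq> diag_params \<union> C \<union> E" "k \<noteq> \<rho> i" for x i k Q
    using that by (auto simp: supp_in_def diag_params_def C_def E_def)
  have 2: "flag_separated (chart J J') diag_params cs"
  proof (rule flag_separatedI[OF cs(2)])
    show "set cs \<inter> diag_params = {}" using cs disj by auto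
    fix Q u assume u: "u \<in> set cs" "u \<notin> Q" and Q: "diag_params \<subseteq> Q" "Q \<subseteq> diag_params \<union> set cs"
    from u(1) obtain k j where k: "u = Inr (Inl (k, j))" "k \<in> I1 - J" "j \<in> J" unfolding cs C_def by auto
    from k(2) \<rho>(3) have "k \<in> \<rho> ` (- J')" by blast
    then obtain i where i: "i \<notin> J'" "k = \<rho> i" by auto
    have val: "core I1 I2 J J' x $ i $ j = x (Inl (i, k)) * x u" if x: "x \<in> supp_in (insert u Q)" for x
    proof -
      have sub: "insert u Q \<subseteq> diag_params \<union> C \<union> E" using Q u cs by auto
      have "core I1 I2 J J' x $ i $ j = (\<Sum>k'\<in>I1 - J. if k' = k then x (Inl (i, k)) * x u else 0)"
        unfolding core_nth_row[OF i(1) k(3)] using diagI[OF x sub] by (intro sum.cong) (auto simp: i(2) k(1))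
      then show ?thesis using k(2) by simp
    qed
    show "separated (chart J J') Q u"
    proof (rule separatedI[where x = "\<lambda>w. if w = u \<or> w = Inl (i, k) then 1 else 0" and i = i and j = j])
      show "core I1 I2 J J' x $ i $ j = 0" if x: "x \<in> supp_in Q" for x
      proof -
        have "x \<in> supp_in (insert u Q)" "x u = 0" using x u(2) by (auto simp: supp_in_def)
        then show ?thesis using val by simp
      qed
      have "Inl (i, k) \<in> Q" using Q(1) i by (auto simp: diag_params_def)
      then show s: "(\<lambda>w. if w = u \<or> w = Inl (i, k) then 1 else 0) \<in> supp_in (insert u Q)" by (auto simp: supp_in_def)
      show "core I1 I2 J J' (\<lambda>w. if w = u \<or> w = Inl (i, k) then 1 else 0) $ i $ j \<noteq> 0"
        using val[OF s] by simp
    qed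
  qed
  have 3: "flag_separated (chart J J') (diag_params \<union> C) es"
  proof (rule flag_separatedI[OF es(2)])
    show "set es \<inter> (diag_params \<union> C) = {}" using es disj by auto
    fix Q u assume u: "u \<in> set es" "u \<notin> Q" and Q: "diag_params \<union> C \<subseteq> Q" "Q \<subseteq> diag_params \<union> C \<union> set es"
    from u(1) obtain l i where l: "u = Inr (Inr (l, i))" "l \<in> I2 - J'" "i \<in> J'" unfolding es E_def by auto
    have j: "\<rho> l \<notin> J" using \<rho>(2) l by auto
    have val: "core I1 I2 J J' x $ i $ \<rho> l = x u * x (Inl (l, \<rho> l))" if x: "x \<in> supp_in (insert u Q)" for x
    proof -
      have sub: "insert u Q \<subseteq> diag_params \<union> C \<union> E" using Q u es by auto
      have "core I1 I2 J J' x $ i $ \<rho> l = (\<Sum>l'\<in>I2 - J'. if l' = l then x u * x (Inl (l, \<rho> l)) else 0)"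
        unfolding core_nth_col[OF l(3) j]
      proof (intro sum.cong refl)
        fix l' assume l': "l' \<in> I2 - J'"
        have "\<rho> l \<noteq> \<rho> l'" if "l' \<noteq> l" using \<rho>(1) l l' that by (auto simp: inj_on_def)
        then show "x (Inr (Inr (l', i))) * x (Inl (l', \<rho> l)) = (if l' = l then x u * x (Inl (l, \<rho> l)) else 0)"
          using diagI[OF x sub] l(1) by auto
      qed
      then show ?thesis using l(2) by simp
    qed
    show "separated (chart J J') Q u"
    proof (rule separatedI[where x = "\<lambda>w. if w = u \<or> w = Inl (l, \<rho> l) then 1 else 0" and i = i and j = "\<rho> l"])
      show "core I1 I2 J J' x $ i $ \<rho> l = 0" if x: "x \<in> supp_in Q" for x
      proof -
        have "x \<in> supp_in (insert u Q)" "x u = 0" using x u(2) by (auto simp: supp_in_def)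
        then show ?thesis using val by simp
      qed
      have "Inl (l, \<rho> l) \<in> Q" using Q(1) l by (auto simp: diag_params_def)
      then show s: "(\<lambda>w. if w = u \<or> w = Inl (l, \<rho> l) then 1 else 0) \<in> supp_in (insert u Q)" by (auto simp: supp_in_def)
      show "core I1 I2 J J' (\<lambda>w. if w = u \<or> w = Inl (l, \<rho> l) then 1 else 0) $ i $ \<rho> l \<noteq> 0"
        using val[OF s] by simp
    qed
  qed
  show ?thesis
  proof (intro exI conjI)
    show "distinct (ds @ cs @ es @ hs)" using ds cs es hs disj by auto
    show "set (ds @ cs @ es @ hs) = params I1 I2 J J'"
      using ds cs es hs dsub by (auto simp: params_def C_def E_def H_def)
    show "flag_separated (chart J J') {} (ds @ cs @ es @ hs)"
      using 1 2 3 4 by (simp add: flag_separated_append ds cs es)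
  qed
qed

text \<open>Kernel vectors in the coordinate space of \<open>I1\<close> vanish at every column hit
  by \<open>\<rho>\<close>, hence live on \<open>J\<close>; injectivity of \<open>\<rho>\<close>
  confines the left kernel to \<open>J'\<close>. So each chart has a point where both kernels are
  minimal.\<close>

lemma chart_diag_point:
  defines "x \<equiv> \<lambda>u. if u \<in> diag_params then 1 else 0"
  shows "vec.dim (rker (vec_of (core I1 I2 J J' x)) \<inter> coord_space I1) \<le> r"
    and "vec.dim (lker (vec_of (core I1 I2 J J' x)) \<inter> coord_space I2) \<le> r"
proof -
  have c: "x (Inr q) = 0" for q by (auto simp: x_def diag_params_def)
  have xi: "x (Inl (i, k)) = (if k = \<rho> i then 1 else 0)" if "i \<notin> J'" for i k
    using that by (auto simp: x_def diag_params_def)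
  have row: "core I1 I2 J J' x $ i $ j = (if j = \<rho> i then 1 else 0)" if "i \<notin> J'" for i j
  proof (cases "j \<in> J")
    case True
    then have "j \<noteq> \<rho> i" using \<rho>(2) that by auto
    then show ?thesis using True by (simp add: core_nth_row[OF that] c)
  next
    case False
    then show ?thesis using that by (simp add: core_nth_free xi)
  qed
  have row': "core I1 I2 J J' x $ i $ j = 0" if "i \<in> J'" "j \<notin> J" for i j
    using that by (simp add: core_nth_col c)
  have "rker (vec_of (core I1 I2 J J' x)) \<inter> coord_space I1 \<subseteq> coord_space J"
  proof
    fix z assume z: "z \<in> rker (vec_of (core I1 I2 J J' x)) \<inter> coord_space I1"
    have "z $ k = 0" if "k \<notin> J" for k
    proof (cases "k \<in> I1")
      case True
      then have "k \<in> \<rho> ` (- J')" using \<rho>(3) that by blast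
      then obtain i where i: "i \<notin> J'" "k = \<rho> i" by auto
      have "(core I1 I2 J J' x *v z) $ i = (\<Sum>j\<in>UNIV. if j = \<rho> i then z $ k else 0)"
        unfolding matrix_vector_mult_def vec_lambda_beta using i by (intro sum.cong) (auto simp: row)
      then show ?thesis using z by (simp add: rker_def)
    next
      case False
      then show ?thesis using z by (auto simp: coord_space_def)
    qed
    then show "z \<in> coord_space J" by (simp add: coord_space_def)
  qed
  then have "vec.dim (rker (vec_of (core I1 I2 J J' x)) \<inter> coord_space I1) \<le> vec.dim (coord_space J)"
    by (rule vec.dim_subset)
  then show "vec.dim (rker (vec_of (core I1 I2 J J' x)) \<inter> coord_space I1) \<le> r" by (simp add: dim_coord_space J)
  have "lker (vec_of (core I1 I2 J J' x)) \<inter> coord_space I2 \<subseteq> coord_space J'"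
  proof
    fix y assume y: "y \<in> lker (vec_of (core I1 I2 J J' x)) \<inter> coord_space I2"
    have "y $ i = 0" if i: "i \<notin> J'" for i
    proof -
      have "(transpose (core I1 I2 J J' x) *v y) $ \<rho> i = (\<Sum>l\<in>UNIV. core I1 I2 J J' x $ l $ \<rho> i * y $ l)"
        by (simp add: matrix_vector_mult_def transpose_def)
      also have "\<dots> = (\<Sum>l\<in>UNIV. if l = i then y $ i else 0)"
      proof (intro sum.cong refl)
        fix l
        have "\<rho> i \<notin> J" using \<rho>(2) i by auto
        moreover have "\<rho> i = \<rho> l \<longleftrightarrow> l = i" if "l \<notin> J'" using \<rho>(1) i that by (auto simp: inj_on_def)
        ultimately show "core I1 I2 J J' x $ l $ \<rho> i * y $ l = (if l = i then y $ i else 0)"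
          using i by (cases "l \<in> J'") (auto simp: row row')
      qed
      finally show ?thesis using y by (simp add: lker_def)
    qed
    then show "y \<in> coord_space J'" by (simp add: coord_space_def)
  qed
  then have "vec.dim (lker (vec_of (core I1 I2 J J' x)) \<inter> coord_space I2) \<le> vec.dim (coord_space J')"
    by (rule vec.dim_subset)
  then show "vec.dim (lker (vec_of (core I1 I2 J J' x)) \<inter> coord_space I2) \<le> r" by (simp add: dim_coord_space J)
qed

end

end

section \<open>Dimension of the degeneracy locus\<close>

text \<open>Free entries plus the coefficients of r dependent columns and of r dependent rows, for
  spaces of dimensions \<open>a\<close> and \<open>b\<close>. This is the dimension of the affine
  cone, one more than the projective dimension.\<close>

definition degen_dim :: "nat \<Rightarrow> nat \<Rightarrow> nat \<Rightarrow> nat \<Rightarrow> nat \<Rightarrow> nat" where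
  "degen_dim m n a b r = (m - r) * (n - r) + (a - r) * r + (b - r) * r"

lemma card_params:
  fixes J :: "'n::finite set" and J' :: "'m::finite set"
  assumes "J \<subseteq> I1" "card J = r" "J' \<subseteq> I2" "card J' = r"
  shows "card (params I1 I2 J J') = degen_dim CARD('m) CARD('n) (card I1) (card I2) r"
proof -
  have c: "card (- J) = CARD('n) - r" "card (- J') = CARD('m) - r"
    "card (I1 - J) = card I1 - r" "card (I2 - J') = card I2 - r"
    using assms by (simp_all add: Compl_eq_Diff_UNIV card_Diff_subset)
  have "card ((Inl :: _ \<Rightarrow> ('m, 'n) param) ` ((- J') \<times> (- J))) = (CARD('m) - r) * (CARD('n) - r)"
    by (subst card_image) (auto simp: c card_cartesian_product)
  moreover have "card ((\<lambda>p. Inr (Inl p) :: ('m, 'n) param) ` ((I1 - J) \<times> J)) = (card I1 - r) * r"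
    using assms by (subst card_image) (auto simp: c card_cartesian_product inj_on_def)
  moreover have "card ((\<lambda>p. Inr (Inr p) :: ('m, 'n) param) ` ((I2 - J') \<times> J')) = (card I2 - r) * r"
    using assms by (subst card_image) (auto simp: c card_cartesian_product inj_on_def)
  ultimately show ?thesis unfolding params_def degen_dim_def
    by (subst card_Un_disjoint; (subst card_Un_disjoint)?) auto
qed

text \<open>The bound \<open>card I1 \<le> CARD('m)\<close> makes \<open>I1 - J\<close> no larger
  than the set of free rows; the other free rows are matched with further columns, of which there
  are enough since \<open>CARD('m) \<le> CARD('n)\<close>.\<close>

lemma matching_exists:
  fixes J I1 :: "'n::finite set" and J' :: "'m::finite set"
  assumes J: "J \<subseteq> I1" "card J = card J'" and le: "card I1 \<le> CARD('m)" "CARD('m) \<le> CARD('n)"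
  shows "\<exists>\<rho>. inj_on \<rho> (- J') \<and> \<rho> ` (- J') \<subseteq> - J \<and> I1 - J \<subseteq> \<rho> ` (- J')"
proof -
  have c: "card (- J) = CARD('n) - card J" "card (- J') = CARD('m) - card J" "card (I1 - J) = card I1 - card J"
    using J by (simp_all add: Compl_eq_Diff_UNIV card_Diff_subset)
  have cJ: "card J \<le> card I1" using J by (intro card_mono) auto
  have "card (- J - (I1 - J)) = card (- J) - card (I1 - J)" by (intro card_Diff_subset) auto
  then have "card (- J') - card (I1 - J) \<le> card (- J - (I1 - J))" using c le by simp
  then obtain T where T: "T \<subseteq> - J - (I1 - J)" "card T = card (- J') - card (I1 - J)"
    by (rule obtain_subset_with_card_n)
  have "card ((I1 - J) \<union> T) = card (I1 - J) + card T" using T(1) by (intro card_Un_disjoint) auto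
  also have "\<dots> = card (- J')" using T(2) c le cJ by simp
  finally obtain \<rho> where \<rho>: "bij_betw \<rho> (- J') ((I1 - J) \<union> T)"
    using finite_same_card_bij[of "- J'" "(I1 - J) \<union> T"] by auto
  then have "\<rho> ` (- J') = (I1 - J) \<union> T" "inj_on \<rho> (- J')" by (auto simp: bij_betw_def)
  then show ?thesis using T(1) by (intro exI[of _ \<rho>]) auto
qed

lemma subspace_of_dim:
  fixes L :: "(complex ^ 'k::finite) set"
  assumes L: "vec.subspace L" and k: "k \<le> vec.dim L"
  obtains L' where "vec.subspace L'" "L' \<subseteq> L" "vec.dim L' = k"
proof -
  obtain F F' :: "complex ^ 'k ^ 'k" and I where F: "F ** F' = mat 1" "F' ** F = mat 1"
    "L = (*v) F ` coord_space I" "card I = vec.dim L" by (rule subspace_normal_form[OF L])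
  obtain I' where I': "I' \<subseteq> I" "card I' = k" using obtain_subset_with_card_n[of k I] k F(4) by metis
  show thesis
  proof (rule that[of "(*v) F ` coord_space I'"])
    show "vec.subspace ((*v) F ` coord_space I')"
      by (intro vec.linear_subspace_image matrix_vector_mul_linear_gen subspace_coord_space)
    show "(*v) F ` coord_space I' \<subseteq> L" unfolding F(3) using I'(1) by (auto simp: coord_space_def)
    show "vec.dim ((*v) F ` coord_space I') = k"
      using dim_inj_image[OF matrix_vector_mul_linear_gen inj_on_subset[OF inj_matrix_of_left_inverse[OF F(2)] subset_UNIV] subspace_coord_space, of I']
      by (simp add: dim_coord_space I')
  qed
qed

lemma degen_locus_subset_proj: "degen_locus L1 L2 r \<subseteq> proj UNIV"
  unfolding degen_locus_def by auto

context
  fixes L1 :: "(complex ^ 'n::finite) set" and L2 :: "(complex ^ 'm::finite) set" and r :: nat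
  assumes L1: "vec.subspace L1" and L2: "vec.subspace L2"
    and le: "r \<le> vec.dim L1" "vec.dim L1 \<le> CARD('m)" "CARD('m) \<le> CARD('n)" "r \<le> vec.dim L2"
begin

text \<open>There are finitely many charts, all with the same number of parameters.\<close>

lemma degen_locus_zchain_le:
  assumes S: "S \<subseteq> degen_locus L1 L2 r" and C: "zchain S C"
  shows "length C \<le> degen_dim CARD('m) CARD('n) (vec.dim L1) (vec.dim L2) r"
proof -
  obtain F F' :: "complex ^ 'n ^ 'n" and I1 where F: "F ** F' = mat 1" "F' ** F = mat 1"
    "L1 = (*v) F ` coord_space I1" "card I1 = vec.dim L1" by (rule subspace_normal_form[OF L1])
  obtain G G' :: "complex ^ 'm ^ 'm" and I2 where G: "G ** G' = mat 1" "G' ** G = mat 1"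
    "L2 = (*v) G ` coord_space I2" "card I2 = vec.dim L2" by (rule subspace_normal_form[OF L2])
  let ?I = "{J. J \<subseteq> I1 \<and> card J = r} \<times> {J'. J' \<subseteq> I2 \<and> card J' = r}"
  show ?thesis
  proof (rule zchain_length_le[where I = ?I and X = "\<lambda>(J, J'). coords (params I1 I2 J J')"
        and \<phi> = "\<lambda>(J, J'). chart F' G' I1 I2 J J'", OF _ _ _ _ _ C])
    show "finite ?I" by simp
    show "S \<subseteq> (\<Union>i\<in>?I. pset (case i of (J, J') \<Rightarrow> chart F' G' I1 I2 J J') UNIV)"
      using S unfolding F(3) G(3) degen_locus_charts[OF F(1,2) G(1,2)] by (simp add: case_prod_unfold)
  next
    fix i assume i: "i \<in> ?I"
    then obtain J J' where J: "i = (J, J')" "J \<subseteq> I1" "card J = r" "J' \<subseteq> I2" "card J' = r" by auto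
    show "finite (case i of (J, J') \<Rightarrow> coords (params I1 I2 J J')) \<and>
        card (case i of (J, J') \<Rightarrow> coords (params I1 I2 J J')) \<le> degen_dim CARD('m) CARD('n) (vec.dim L1) (vec.dim L2) r"
      using card_image_le[of "params I1 I2 J J'" "\<lambda>u x. x u"] card_params[OF J(2-5)] F(4) G(4)
      by (simp add: J(1))
    show "(\<lambda>x. (case i of (J, J') \<Rightarrow> chart F' G' I1 I2 J J') x $ k) \<in> polyfuns (case i of (J, J') \<Rightarrow> coords (params I1 I2 J J'))" for k
      using chart_polyfuns[OF F(1,2) G(1,2)] by (simp add: J(1))
    show "\<exists>x'. (case i of (J, J') \<Rightarrow> chart F' G' I1 I2 J J') x' = s *s (case i of (J, J') \<Rightarrow> chart F' G' I1 I2 J J') x" for x s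
      using chart_cone[OF F(1,2) G(1,2)] by (simp add: J(1))
  qed
qed

text \<open>The irreducible set through a point is the closure of a chart that contains the point.\<close>

lemma degen_locus_local:
  assumes p: "p \<in> degen_locus L1 L2 r"
  shows "\<exists>A. A \<subseteq> degen_locus L1 L2 r \<and> p \<in> A \<and> irreducible_in zariski A \<and>
      closedin (subtopology zariski (degen_locus L1 L2 r)) A \<and>
      (\<exists>C. zchain A C \<and> length C = degen_dim CARD('m) CARD('n) (vec.dim L1) (vec.dim L2) r)"
    and "r < CARD('m) \<Longrightarrow> openin zariski U \<Longrightarrow> p \<in> U \<Longrightarrow> \<exists>v. v \<noteq> 0 \<and> pt v \<in> U \<and> degen L1 L2 r v \<and>
      vec.dim (rker v \<inter> L1) \<le> r \<and> vec.dim (lker v \<inter> L2) \<le> r"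
proof -
  obtain F F' :: "complex ^ 'n ^ 'n" and I1 where F: "F ** F' = mat 1" "F' ** F = mat 1"
    "L1 = (*v) F ` coord_space I1" "card I1 = vec.dim L1" by (rule subspace_normal_form[OF L1])
  obtain G G' :: "complex ^ 'm ^ 'm" and I2 where G: "G ** G' = mat 1" "G' ** G = mat 1"
    "L2 = (*v) G ` coord_space I2" "card I2 = vec.dim L2" by (rule subspace_normal_form[OF L2])
  note cov = degen_locus_charts[OF F(1,2) G(1,2), of I1 I2 r, folded F(3) G(3)]
  obtain J J' where J: "J \<subseteq> I1" "card J = r" "J' \<subseteq> I2" "card J' = r"
    and pJ: "p \<in> pset (chart F' G' I1 I2 J J') UNIV" using p unfolding cov by auto
  let ?\<phi> = "chart F' G' I1 I2 J J'"
  have "card J = card J'" "card I1 \<le> CARD('m)" using J le F(4) by simp_all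
  from matching_exists[OF J(1) this le(3)] obtain \<rho> where
    \<rho>: "inj_on \<rho> (- J')" "\<rho> ` (- J') \<subseteq> - J" "I1 - J \<subseteq> \<rho> ` (- J')" by (elim exE conjE) (rule that)
  have poly: "(\<lambda>x. ?\<phi> x $ k) \<in> polyfuns (coords UNIV)" for k
    by (rule polyfuns_mono[OF chart_polyfuns[OF F(1,2) G(1,2)]]) auto
  obtain x where x: "p = pt (?\<phi> x)" "?\<phi> x \<noteq> 0" using pJ unfolding pset_def mem_Collect_eq by (elim exE conjE) (rule that)
  have irr: "irreducible_in zariski (pset ?\<phi> UNIV)"
    by (rule irreducible_pset[OF poly _ UNIV_I x(2)]) simp
  have sub: "pset ?\<phi> UNIV \<subseteq> degen_locus L1 L2 r" unfolding cov using J by auto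
  define A where "A = degen_locus L1 L2 r \<inter> zariski closure_of pset ?\<phi> UNIV"
  have subA: "pset ?\<phi> UNIV \<subseteq> A"
    unfolding A_def by (intro Int_greatest sub closure_of_subset) (simp add: pset_subset_proj)
  have chain: "\<exists>C. zchain A C \<and> length C = degen_dim CARD('m) CARD('n) (vec.dim L1) (vec.dim L2) r"
  proof -
    obtain us where us: "distinct us" "set us = params I1 I2 J J'" "flag_separated ?\<phi> {} us"
      using chart_flag[OF F(1,2) G(1,2) J \<rho>] by (elim exE conjE) (rule that)
    have "A \<subseteq> proj UNIV" using degen_locus_subset_proj unfolding A_def by blast
    moreover have "pset ?\<phi> (supp_in ({} \<union> set us)) \<subseteq> A" using subA pset_mono[OF subset_UNIV] by (rule subset_trans[rotated])
    ultimately obtain C where "zchain A C" "length C = length us"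
      using zchain_of_flag[OF poly _ us(3)] by blast
    moreover have "length us = degen_dim CARD('m) CARD('n) (vec.dim L1) (vec.dim L2) r"
      using distinct_card[OF us(1)] us(2) card_params[OF J] F(4) G(4) by simp
    ultimately show ?thesis by auto
  qed
  have clA: "closedin (subtopology zariski (degen_locus L1 L2 r)) A"
    unfolding A_def closedin_subtopology using closedin_closure_of by blast
  have irrA: "irreducible_in zariski A"
    unfolding A_def using degen_locus_subset_proj by (intro irreducible_in_closure irr sub) simp
  show "\<exists>A. A \<subseteq> degen_locus L1 L2 r \<and> p \<in> A \<and> irreducible_in zariski A \<and>
      closedin (subtopology zariski (degen_locus L1 L2 r)) A \<and>
      (\<exists>C. zchain A C \<and> length C = degen_dim CARD('m) CARD('n) (vec.dim L1) (vec.dim L2) r)"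
    using pJ subA irrA clA chain by (intro exI[of _ A] conjI) (auto simp: A_def)
  assume rm: "r < CARD('m)" and U: "openin zariski U" "p \<in> U"
  define x0 :: "('m, 'n) param \<Rightarrow> complex" where "x0 = (\<lambda>u. if u \<in> diag_params J' \<rho> then 1 else 0)"
  define v0 where "v0 = ?\<phi> x0"
  have v0r: "vec.dim (rker v0 \<inter> L1) \<le> r" and v0l: "vec.dim (lker v0 \<inter> L2) \<le> r"
    using chart_diag_point[OF F(1,2) G(1,2) J \<rho>]
    unfolding v0_def chart_def[OF F(1,2) G(1,2)] F(3) G(3) dim_kernels_base_change[OF F(1,2) G(1,2)] x0_def by simp_all
  \<comment> \<open>Because \<open>r < CARD('m)\<close> there is a free row, and it contains a
    diagonal entry 1.\<close>
  have v0: "v0 \<noteq> 0"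
  proof
    assume "v0 = 0"
    then have "core I1 I2 J J' x0 = transpose G ** mat_of 0 ** F"
      using core_of_chart[OF F(1,2) G(1,2), of I1 I2 J J' x0] by (simp add: v0_def)
    also have "\<dots> = 0" by (simp add: vec_eq_iff matrix_matrix_mult_def)
    finally have z: "core I1 I2 J J' x0 = 0" .
    have "card (- J') > 0" using rm J by (simp add: Compl_eq_Diff_UNIV card_Diff_subset)
    then obtain i where i: "i \<notin> J'" by (metis ComplD card_gt_0_iff ex_in_conv)
    then have "\<rho> i \<notin> J" using \<rho>(2) by auto
    then have "core I1 I2 J J' x0 $ i $ \<rho> i = 1" using i by (simp add: core_nth_free x0_def diag_params_def[OF F(1,2) G(1,2) J \<rho>])
    then show False using z by simp
  qed
  obtain d0 F0 where F0: "form d0 F0" "F0 (?\<phi> x) \<noteq> 0" "\<And>w. w \<noteq> 0 \<Longrightarrow> F0 w \<noteq> 0 \<Longrightarrow> pt w \<in> U"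
    using openin_zariski_base[OF U(1), of "?\<phi> x"] U(2) x by metis
  obtain d1 F1 where F1: "form d1 F1" "F1 v0 \<noteq> 0" "\<And>v. F1 v \<noteq> 0 \<Longrightarrow> vec.dim (rker v \<inter> L1) \<le> vec.dim (rker v0 \<inter> L1)"
    by (rule rker_semicontinuous[OF L1, of v0], rule that)
  obtain d2 F2 where F2: "form d2 F2" "F2 v0 \<noteq> 0" "\<And>v. F2 v \<noteq> 0 \<Longrightarrow> vec.dim (lker v \<inter> L2) \<le> vec.dim (lker v0 \<inter> L2)"
    by (rule lker_semicontinuous[OF L2, of v0], rule that)
  \<comment> \<open>Each of the three forms is nonzero somewhere on the chart: \<open>F0\<close> at
    \<open>p\<close>, the two minors at the diagonal point. Irreducibility yields a point where all
    are nonzero.\<close>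
  have "\<not> vanishes_on F0 (pset ?\<phi> UNIV)"
    unfolding vanishes_on_def using F0(2) pJ x(1) self_in_pt[of "?\<phi> x"] by blast
  moreover have pv0: "pt v0 \<in> pset ?\<phi> UNIV" unfolding pset_def using v0 v0_def by blast
  have "\<not> vanishes_on F1 (pset ?\<phi> UNIV)" "\<not> vanishes_on F2 (pset ?\<phi> UNIV)"
    unfolding vanishes_on_def using F1(2) F2(2) pv0 self_in_pt[of v0] by blast+
  ultimately have "\<not> vanishes_on (\<lambda>v. F0 v * (F1 v * F2 v)) (pset ?\<phi> UNIV)"
    using irreducible_vanishes_mult[OF irr F0(1) form_mult[OF F1(1) F2(1)]]
      irreducible_vanishes_mult[OF irr F1(1) F2(1)] by blast
  then obtain q u where qu: "q \<in> pset ?\<phi> UNIV" "u \<in> q" "F0 u * (F1 u * F2 u) \<noteq> 0" unfolding vanishes_on_def by blast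
  from qu(1) obtain y where y: "q = pt (?\<phi> y)" "?\<phi> y \<noteq> 0" unfolding pset_def mem_Collect_eq by (elim exE conjE) (rule that)
  have "F0 (?\<phi> y) * (F1 (?\<phi> y) * F2 (?\<phi> y)) \<noteq> 0"
    using form_nonzero_on_pt[OF form_mult[OF F0(1) form_mult[OF F1(1) F2(1)]], of "?\<phi> y"] qu(2,3) y(1) by blast
  then have nz: "F0 (?\<phi> y) \<noteq> 0" "F1 (?\<phi> y) \<noteq> 0" "F2 (?\<phi> y) \<noteq> 0" by auto
  have "degen L1 L2 r (?\<phi> y)"
    unfolding chart_def[OF F(1,2) G(1,2)] F(3) G(3) degen_base_change[OF F(1,2) G(1,2)] by (rule degen_core[OF J])
  moreover have "vec.dim (rker (?\<phi> y) \<inter> L1) \<le> r" "vec.dim (lker (?\<phi> y) \<inter> L2) \<le> r"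
    using F1(3)[OF nz(2)] F2(3)[OF nz(3)] v0r v0l by linarith+
  ultimately show "\<exists>v. v \<noteq> 0 \<and> pt v \<in> U \<and> degen L1 L2 r v \<and> vec.dim (rker v \<inter> L1) \<le> r \<and> vec.dim (lker v \<inter> L2) \<le> r"
    using F0(3)[OF y(2) nz(1)] y(2) by (intro exI[of _ "?\<phi> y"] conjI)
qed

text \<open>A nonzero matrix with rows annihilating \<open>P\<close> and columns annihilating
  \<open>Q\<close> has these spaces in its kernels; both annihilators are nonzero as r is below both
  matrix sizes.\<close>

lemma degen_locus_nonempty:
  assumes "r < CARD('m)"
  shows "degen_locus L1 L2 r \<noteq> {}"
proof -
  obtain P where P: "vec.subspace P" "P \<subseteq> L1" "vec.dim P = r" by (rule subspace_of_dim[OF L1 le(1)])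
  obtain Q where Q: "vec.subspace Q" "Q \<subseteq> L2" "vec.dim Q = r" by (rule subspace_of_dim[OF L2 le(4)])
  have "vec.dim (annihilator P) > 0" using dim_annihilator[OF P(1)] P(3) assms le(3) by linarith
  moreover have "vec.dim (annihilator Q) > 0" using dim_annihilator[OF Q(1)] Q(3) assms by linarith
  ultimately have "vec.dim (tensor_subspace (annihilator P) (annihilator Q)) > 0"
    by (simp add: dim_tensor_subspace subspace_annihilator)
  then obtain v where v: "v \<in> tensor_subspace (annihilator P) (annihilator Q)" "v \<noteq> 0"
    by (metis vec.dim_eq_0 less_irrefl subset_singleton_iff subsetI singletonI)
  have "P \<subseteq> rker v"
  proof
    fix x assume x: "x \<in> P"
    have "(mat_of v *v x) $ i = 0" for i
    proof -
      have "transpose (mat_of v) *v axis i 1 \<in> annihilator P" using v(1) by (auto simp: tensor_subspace_def)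
      then have "row i (mat_of v) \<in> annihilator P" by (simp add: matrix_vector_axis column_transpose)
      then have "(\<Sum>j\<in>UNIV. x $ j * row i (mat_of v) $ j) = 0" using x by (simp add: annihilator_def)
      then show ?thesis by (simp add: matrix_vector_mult_def row_def mult.commute)
    qed
    then show "x \<in> rker v" by (simp add: rker_def vec_eq_iff)
  qed
  moreover have "Q \<subseteq> lker v"
  proof
    fix y assume y: "y \<in> Q"
    have "(transpose (mat_of v) *v y) $ j = 0" for j
    proof -
      have "mat_of v *v axis j 1 \<in> annihilator Q" using v(1) by (auto simp: tensor_subspace_def)
      then have "column j (mat_of v) \<in> annihilator Q" by (simp add: matrix_vector_axis)
      then have "(\<Sum>i\<in>UNIV. y $ i * column j (mat_of v) $ i) = 0" using y by (simp add: annihilator_def)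
      then show ?thesis by (simp add: matrix_vector_mult_def transpose_def column_def mult.commute)
    qed
    then show "y \<in> lker v" by (simp add: lker_def vec_eq_iff)
  qed
  ultimately have "P \<subseteq> rker v \<inter> L1" "Q \<subseteq> lker v \<inter> L2" using P Q by auto
  then have "vec.dim P \<le> vec.dim (rker v \<inter> L1)" "vec.dim Q \<le> vec.dim (lker v \<inter> L2)"
    by (auto intro: vec.dim_subset)
  then have "degen L1 L2 r v" using P(3) Q(3) by (simp add: degen_def)
  then have "pt v \<in> degen_locus L1 L2 r"
    unfolding degen_locus_def using v(2) by (intro CollectI exI[of _ v] conjI refl)
  then show ?thesis by blast
qed

end

text \<open>The condition on \<open>lker v\<close> bounds the rank of \<open>v\<close>, which makes the condition on \<open>L\<close> void
  once \<open>vec.dim L \<ge> CARD('m)\<close>.\<close>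

lemma degen_shrink:
  fixes v :: "complex ^ ('m::finite \<times> 'n::finite)"
  assumes L: "vec.subspace L" "vec.subspace L'" "L' \<subseteq> L" and dim: "vec.dim L' = min (vec.dim L) CARD('m)"
  shows "degen L L2 r v \<longleftrightarrow> degen L' L2 r v"
proof
  assume d: "degen L' L2 r v"
  have "vec.dim (rker v \<inter> L') \<le> vec.dim (rker v \<inter> L)" using L(3) by (intro vec.dim_subset) auto
  then show "degen L L2 r v" using d unfolding degen_def by linarith
next
  assume d: "degen L L2 r v"
  show "degen L' L2 r v"
  proof (cases "vec.dim L \<le> CARD('m)")
    case True
    then have "L' = L" using vec.subspace_dim_equal[OF L(2,1,3)] dim by simp
    then show ?thesis using d by simp
  next
    case False
    have "r \<le> vec.dim (lker v)" using d vec.dim_subset[of "lker v \<inter> L2" "lker v"] unfolding degen_def by force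
    then have "rank (mat_of v) + r \<le> CARD('m)" using rank_nullity_left[of v] by linarith
    moreover have "vec.dim (rker v) + vec.dim L' \<le> CARD('n) + vec.dim (rker v \<inter> L')"
      using dim_add_le_dim_inter[OF subspace_rker L(2) vec.subspace_UNIV, of v] by (metis subset_UNIV vec_dim_card)
    ultimately have "r \<le> vec.dim (rker v \<inter> L')" using rank_nullity[of v] dim False by linarith
    then show ?thesis using d unfolding degen_def by blast
  qed
qed

text \<open>Passing to \<open>L'\<close> costs at most its codimension in \<open>L\<close>, which is
  the truncated difference on the right.\<close>

lemma dim_rker_shrink:
  fixes v :: "complex ^ ('m::finite \<times> 'n::finite)"
  assumes L: "vec.subspace L" "vec.subspace L'" "L' \<subseteq> L" and dim: "vec.dim L' = min (vec.dim L) CARD('m)"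
  shows "vec.dim (rker v \<inter> L) \<le> vec.dim (rker v \<inter> L') + (vec.dim L - CARD('m))"
proof -
  have "(rker v \<inter> L) \<inter> L' = rker v \<inter> L'" using L(3) by blast
  then have "vec.dim (rker v \<inter> L) + vec.dim L' \<le> vec.dim L + vec.dim (rker v \<inter> L')"
    using dim_add_le_dim_inter[OF vec.subspace_inter[OF subspace_rker L(1)] L(2,1) Int_lower2 L(3), of v] by simp
  then show ?thesis using dim by linarith
qed

text \<open>The left kernel bounds the rank by \<open>CARD('m) - r\<close>, so the right kernel is
  large enough to meet \<open>L\<close> in excess dimension. This is the origin of max(l1 - M, 0) in
  the defect.\<close>

lemma dim_rker_ge_of_degen:
  fixes v :: "complex ^ ('m::finite \<times> 'n::finite)"
  assumes L: "vec.subspace L" and d: "degen L L2 r v"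
  shows "r + (vec.dim L - CARD('m)) \<le> vec.dim (rker v \<inter> L)"
proof (cases "vec.dim L \<le> CARD('m)")
  case True
  then show ?thesis using d unfolding degen_def by simp
next
  case False
  have "r \<le> vec.dim (lker v)" using d vec.dim_subset[of "lker v \<inter> L2" "lker v"] unfolding degen_def by force
  then have "rank (mat_of v) + r \<le> CARD('m)" using rank_nullity_left[of v] by linarith
  moreover have "vec.dim (rker v) + vec.dim L \<le> CARD('n) + vec.dim (rker v \<inter> L)"
    using dim_add_le_dim_inter[OF subspace_rker L vec.subspace_UNIV, of v] by (metis subset_UNIV vec_dim_card)
  ultimately show ?thesis using rank_nullity[of v] False by linarith
qed

context
  fixes L1 :: "(complex ^ 'n::finite) set" and L2 :: "(complex ^ 'm::finite) set" and r :: nat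
  assumes L1: "vec.subspace L1" and L2: "vec.subspace L2"
    and le: "r \<le> vec.dim L1" "r < CARD('m)" "CARD('m) \<le> CARD('n)" "r \<le> vec.dim L2"
begin

lemma shrunk_subspace:
  obtains L' where "vec.subspace L'" "L' \<subseteq> L1" "vec.dim L' = min (vec.dim L1) CARD('m)" "r \<le> vec.dim L'" "vec.dim L' \<le> CARD('m)"
    "degen_locus L1 L2 r = degen_locus L' L2 r"
proof -
  obtain L' where L': "vec.subspace L'" "L' \<subseteq> L1" "vec.dim L' = min (vec.dim L1) CARD('m)"
    using subspace_of_dim[OF L1, of "min (vec.dim L1) CARD('m)"] by (metis min.cobounded1)
  show thesis
  proof (rule that[OF L'])
    show "degen_locus L1 L2 r = degen_locus L' L2 r"
      unfolding degen_locus_def degen_shrink[OF L1 L'] ..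
  qed (use L' le in auto)
qed

lemma zdim_degen_locus_subset:
  assumes "S \<subseteq> degen_locus L1 L2 r"
  shows "zdim S \<le> int (degen_dim CARD('m) CARD('n) (min (vec.dim L1) CARD('m)) (vec.dim L2) r) - 1"
proof -
  obtain L' where L': "vec.subspace L'" "vec.dim L' = min (vec.dim L1) CARD('m)" "r \<le> vec.dim L'" "vec.dim L' \<le> CARD('m)"
    "degen_locus L1 L2 r = degen_locus L' L2 r" by (rule shrunk_subspace)
  show ?thesis
    using zdim_le_of_zchains[of S, OF degen_locus_zchain_le[OF L'(1) L2 L'(3,4) le(3,4)]] assms L'(2,5) by simp
qed

lemma zdim_degen_locus_component:
  assumes "p \<in> degen_locus L1 L2 r"
  shows "\<exists>A. A \<subseteq> degen_locus L1 L2 r \<and> p \<in> A \<and> irreducible_in zariski A \<and>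
      closedin (subtopology zariski (degen_locus L1 L2 r)) A \<and>
      zdim A = int (degen_dim CARD('m) CARD('n) (min (vec.dim L1) CARD('m)) (vec.dim L2) r) - 1"
proof -
  obtain L' where L': "vec.subspace L'" "vec.dim L' = min (vec.dim L1) CARD('m)" "r \<le> vec.dim L'" "vec.dim L' \<le> CARD('m)"
    "degen_locus L1 L2 r = degen_locus L' L2 r" by (rule shrunk_subspace)
  note * = L'(1) L2 L'(3,4) le(3,4)
  have "p \<in> degen_locus L' L2 r" using assms L'(5) by simp
  from degen_locus_local(1)[OF * this] obtain A C where
    A: "A \<subseteq> degen_locus L' L2 r" "p \<in> A" "irreducible_in zariski A"
      "closedin (subtopology zariski (degen_locus L' L2 r)) A"
    and C: "zchain A C" "length C = degen_dim CARD('m) CARD('n) (vec.dim L') (vec.dim L2) r"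
    by (elim exE conjE) (rule that)
  have "zdim A = int (degen_dim CARD('m) CARD('n) (vec.dim L') (vec.dim L2) r) - 1"
    by (rule zdim_eq_of_zchains[OF degen_locus_zchain_le[OF * A(1)] C])
  then show ?thesis using A unfolding L'(2,5) by (intro exI[of _ A] conjI)
qed

text \<open>The longest chain is found in a closed subset of the locus, and sets closed there are
  closed in the whole locus.\<close>

lemma zdim_degen_locus:
  "zdim (degen_locus L1 L2 r) = int (degen_dim CARD('m) CARD('n) (min (vec.dim L1) CARD('m)) (vec.dim L2) r) - 1"
proof -
  obtain L' where L': "vec.subspace L'" "vec.dim L' = min (vec.dim L1) CARD('m)" "r \<le> vec.dim L'" "vec.dim L' \<le> CARD('m)"
    "degen_locus L1 L2 r = degen_locus L' L2 r" by (rule shrunk_subspace)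
  note * = L'(1) L2 L'(3,4) le(3,4)
  obtain p where p: "p \<in> degen_locus L' L2 r" using degen_locus_nonempty[OF * le(2)] by blast
  from degen_locus_local(1)[OF * p] obtain A C where
    A: "A \<subseteq> degen_locus L' L2 r" "closedin (subtopology zariski (degen_locus L' L2 r)) A"
    and C: "zchain A C" "length C = degen_dim CARD('m) CARD('n) (vec.dim L') (vec.dim L2) r"
    by (elim exE conjE) (rule that)
  have "zchain (degen_locus L' L2 r) C"
  proof -
    have "closedin (subtopology zariski (degen_locus L' L2 r)) B" if "closedin (subtopology zariski A) B" for B
      using closedin_trans_full[of "subtopology zariski (degen_locus L' L2 r)" A B] that A
      by (simp add: subtopology_subtopology inf.absorb2)
    then show ?thesis using C(1) A(1) unfolding zchain_def irreducible_in_subtopology by blast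
  qed
  then show ?thesis
    using zdim_eq_of_zchains[OF degen_locus_zchain_le[OF * subset_refl] _ C(2)] unfolding L'(2,5) by blast
qed

lemma degen_locus_ne: "degen_locus L1 L2 r \<noteq> {}"
proof -
  obtain L' where L': "vec.subspace L'" "vec.dim L' = min (vec.dim L1) CARD('m)" "r \<le> vec.dim L'" "vec.dim L' \<le> CARD('m)"
    "degen_locus L1 L2 r = degen_locus L' L2 r" by (rule shrunk_subspace)
  show ?thesis unfolding L'(5) by (rule degen_locus_nonempty[OF L'(1) L2 L'(3,4) le(3,4,2)])
qed

text \<open>A generic point for the shrunk subspace is generic for \<open>L1\<close> too, with the
  excess dimension added to the kernel.\<close>

lemma degen_locus_generic:
  assumes "p \<in> degen_locus L1 L2 r" "openin zariski U" "p \<in> U"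
  shows "\<exists>v. v \<noteq> 0 \<and> pt v \<in> U \<and> degen L1 L2 r v \<and>
      vec.dim (rker v \<inter> L1) \<le> r + (vec.dim L1 - CARD('m)) \<and> vec.dim (lker v \<inter> L2) \<le> r"
proof -
  obtain L' where L': "vec.subspace L'" "L' \<subseteq> L1" "vec.dim L' = min (vec.dim L1) CARD('m)" "r \<le> vec.dim L'" "vec.dim L' \<le> CARD('m)"
    "degen_locus L1 L2 r = degen_locus L' L2 r" by (rule shrunk_subspace)
  have "p \<in> degen_locus L' L2 r" using assms(1) L'(6) by simp
  from degen_locus_local(2)[OF L'(1) L2 L'(4,5) le(3,4) this le(2) assms(2,3)] obtain v where
    v: "v \<noteq> 0" "pt v \<in> U" "degen L' L2 r v" "vec.dim (rker v \<inter> L') \<le> r" "vec.dim (lker v \<inter> L2) \<le> r"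
    by (elim exE conjE) (rule that)
  have "degen L1 L2 r v" using v(3) degen_shrink[OF L1 L'(1-3)] by blast
  moreover have "vec.dim (rker v \<inter> L1) \<le> r + (vec.dim L1 - CARD('m))"
    using dim_rker_shrink[OF L1 L'(1-3), of v] v(4) by linarith
  ultimately show ?thesis using v by (intro exI[of _ v] conjI)
qed

end

section \<open>Tangent spaces and conormal varieties\<close>

text \<open>What matters is that the directional derivative is linear in the direction, so the
  gradient appears only as a vector \<open>g\<close> that represents it.\<close>

lemma polyfun_gradient:
  assumes "f \<in> polyfuns (range (\<lambda>k (v :: complex ^ 'k::finite). v $ k))"
  shows "\<exists>g. \<forall>y. ((\<lambda>t. f (v + t *s y)) has_field_derivative (\<Sum>i\<in>UNIV. g $ i * y $ i)) (at 0)"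
  using assms
proof induction
  case (const c)
  show ?case by (intro exI[of _ 0]) simp
next
  case (gen f)
  then obtain k where f: "f = (\<lambda>v. v $ k)" by auto
  have "(\<Sum>i\<in>UNIV. axis k 1 $ i * y $ i) = y $ k" for y :: "complex ^ 'k"
    by (simp add: axis_def if_distrib if_distribR cong: if_cong)
  moreover have "((\<lambda>t. v $ k + t * y $ k) has_field_derivative y $ k) (at 0)" for y :: "complex ^ 'k"
    by (auto intro!: derivative_eq_intros)
  ultimately show ?case unfolding f by (intro exI[of _ "axis k 1"]) simp
next
  case (add f h)
  then obtain g g' where g: "\<forall>y. ((\<lambda>t. f (v + t *s y)) has_field_derivative (\<Sum>i\<in>UNIV. g $ i * y $ i)) (at 0)"
    "\<forall>y. ((\<lambda>t. h (v + t *s y)) has_field_derivative (\<Sum>i\<in>UNIV. g' $ i * y $ i)) (at 0)" by (elim exE)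
  show ?case
  proof (intro exI allI)
    fix y
    have "(\<Sum>i\<in>UNIV. (g + g') $ i * y $ i) = (\<Sum>i\<in>UNIV. g $ i * y $ i) + (\<Sum>i\<in>UNIV. g' $ i * y $ i)"
      by (simp add: distrib_right sum.distrib)
    then show "((\<lambda>t. f (v + t *s y) + h (v + t *s y)) has_field_derivative (\<Sum>i\<in>UNIV. (g + g') $ i * y $ i)) (at 0)"
      using DERIV_add[OF g(1)[rule_format, of y] g(2)[rule_format, of y]] by simp
  qed
next
  case (mult f h)
  then obtain g g' where g: "\<forall>y. ((\<lambda>t. f (v + t *s y)) has_field_derivative (\<Sum>i\<in>UNIV. g $ i * y $ i)) (at 0)"
    "\<forall>y. ((\<lambda>t. h (v + t *s y)) has_field_derivative (\<Sum>i\<in>UNIV. g' $ i * y $ i)) (at 0)" by (elim exE)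
  show ?case
  proof (intro exI allI)
    fix y
    have "(\<Sum>i\<in>UNIV. (h v *s g + f v *s g') $ i * y $ i) = (\<Sum>i\<in>UNIV. g $ i * y $ i) * h v + (\<Sum>i\<in>UNIV. g' $ i * y $ i) * f v"
      by (simp add: sum.distrib sum_distrib_left algebra_simps)
    then show "((\<lambda>t. f (v + t *s y) * h (v + t *s y)) has_field_derivative (\<Sum>i\<in>UNIV. (h v *s g + f v *s g') $ i * y $ i)) (at 0)"
      using DERIV_mult[OF g(1)[rule_format, of y] g(2)[rule_format, of y]] by simp
  qed
qed

lemma form_gradient:
  assumes "form d F"
  shows "\<exists>g. \<forall>y. ((\<lambda>t. F (v + t *s y)) has_field_derivative (\<Sum>i\<in>UNIV. g $ i * y $ i)) (at 0)"
proof (rule polyfun_gradient)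
  show "F \<in> polyfuns (range (\<lambda>k v. v $ k))"
    using form_in_polyfuns[OF assms, of "\<lambda>v. v"] by (simp add: polyfuns.gen)
qed

lemma rank_mono_rker:
  fixes v w :: "complex ^ ('m::finite \<times> 'n::finite)"
  assumes "rker v \<subseteq> rker w" shows "rank (mat_of w) \<le> rank (mat_of v)"
  using vec.dim_subset[OF assms] rank_nullity[of v] rank_nullity[of w] by linarith

lemma rank_mono_range:
  fixes v w :: "complex ^ ('m::finite \<times> 'n::finite)"
  assumes "range ((*v) (mat_of w)) \<subseteq> range ((*v) (mat_of v))" shows "rank (mat_of w) \<le> rank (mat_of v)"
  unfolding rank_eq_dim_range using vec.dim_subset[OF assms] .

lemma kernels_scale:
  assumes "c \<noteq> 0"
  shows "rker (c *s v) = rker v" "lker (c *s v) = lker v" "rank (mat_of (c *s v)) = rank (mat_of v)"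
proof -
  show r: "rker (c *s v) = rker v" using assms by (simp add: rker_def mat_of_scale)
  have "flip_vec (c *s v) = c *s flip_vec v" by (simp add: flip_vec_def vec_eq_iff)
  then have "lker (c *s v) = rker (c *s flip_vec v)" by (metis rker_flip_vec)
  also have "\<dots> = rker (flip_vec v)" using assms by (simp add: rker_def mat_of_scale)
  finally show "lker (c *s v) = lker v" by (simp only: rker_flip_vec)
  show "rank (mat_of (c *s v)) = rank (mat_of v)"
    using rank_nullity[of v] rank_nullity[of "c *s v"] unfolding r by linarith
qed

lemma determinantal_eq: "determinantal r = {pt v | v. v \<noteq> 0 \<and> rank (mat_of v) \<le> r}"
proof (intro set_eqI iffI)
  fix p assume p: "p \<in> determinantal r"
  then have "p \<in> proj UNIV" "p \<subseteq> {v. rank (mat_of v) \<le> r}" by (auto simp: determinantal_def proj_def)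
  then obtain v where "p = pt v" "v \<noteq> 0" "pt v \<subseteq> {v. rank (mat_of v) \<le> r}" by (auto simp: proj_UNIV)
  then show "p \<in> {pt v | v. v \<noteq> 0 \<and> rank (mat_of v) \<le> r}" using self_in_pt[of v] by blast
next
  fix p assume "p \<in> {pt v | v. v \<noteq> 0 \<and> rank (mat_of v) \<le> r}"
  then obtain v where v: "p = pt v" "v \<noteq> 0" "rank (mat_of v) \<le> r" by blast
  have "rank (mat_of (c *s v)) \<le> r" for c
  proof -
    have "rker v \<subseteq> rker (c *s v)" by (auto simp: rker_def mat_of_scale)
    then show ?thesis by (rule order_trans[OF rank_mono_rker v(3)])
  qed
  then have "pt v \<subseteq> {v. rank (mat_of v) \<le> r}" by (auto simp: pt_def)
  then show "p \<in> determinantal r" using pt_in_proj_UNIV[OF v(2)] v(1) by (auto simp: determinantal_def proj_def)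
qed

text \<open>The rank is at most \<open>r\<close> iff the left kernel has dimension at least
  \<open>CARD('m) - r\<close>, and the right kernel is at least as large as the left one.\<close>

lemma determinantal_eq_degen_locus:
  assumes "r \<le> CARD('m)" "CARD('m) \<le> CARD('n)"
  shows "(determinantal r :: ('m::finite \<times> 'n::finite) point set) = degen_locus UNIV UNIV (CARD('m) - r)"
proof -
  have "rank (mat_of v) \<le> r \<longleftrightarrow> degen UNIV UNIV (CARD('m) - r) v" for v :: "complex ^ ('m \<times> 'n)"
    using rank_nullity[of v] rank_nullity_left[of v] assms unfolding degen_def Int_UNIV_right by linarith
  then show ?thesis unfolding determinantal_eq degen_locus_def by simp
qed

text \<open>The matrix equations v^T w = 0 and v w^T = 0, written entry by entry so that they are
  bihomogeneous equations.\<close>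

definition perp :: "complex ^ ('m::finite \<times> 'n::finite) \<Rightarrow> complex ^ ('m \<times> 'n) \<Rightarrow> bool" where
  "perp v w \<longleftrightarrow> (\<forall>k j. (\<Sum>i\<in>UNIV. v $ (i, k) * w $ (i, j)) = 0) \<and> (\<forall>k i. (\<Sum>j\<in>UNIV. v $ (k, j) * w $ (i, j)) = 0)"

lemma perp_sym: "perp v w \<Longrightarrow> perp w v"
  by (simp add: perp_def mult.commute)

text \<open>The first equation puts the columns of \<open>w\<close> into the left kernel of
  \<open>v\<close>, the second puts the rows of \<open>w\<close> into the kernel.\<close>

lemma perp_iff: "perp v w \<longleftrightarrow> w \<in> tensor_subspace (rker v) (lker v)"
proof
  assume p: "perp v w"
  have "(transpose (mat_of v) *v (mat_of w *v x)) $ k = 0" for x k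
  proof -
    have "(transpose (mat_of v) *v (mat_of w *v x)) $ k = (\<Sum>i\<in>UNIV. \<Sum>j\<in>UNIV. v $ (i, k) * w $ (i, j) * x $ j)"
      by (simp add: matrix_vector_mult_def transpose_def sum_distrib_left mult.assoc)
    also have "\<dots> = (\<Sum>j\<in>UNIV. (\<Sum>i\<in>UNIV. v $ (i, k) * w $ (i, j)) * x $ j)"
      by (subst sum.swap) (simp only: sum_distrib_right)
    finally show ?thesis using p by (simp add: perp_def)
  qed
  moreover have "(mat_of v *v (transpose (mat_of w) *v y)) $ k = 0" for y k
  proof -
    have "(mat_of v *v (transpose (mat_of w) *v y)) $ k = (\<Sum>j\<in>UNIV. \<Sum>i\<in>UNIV. v $ (k, j) * w $ (i, j) * y $ i)"
      by (simp add: matrix_vector_mult_def transpose_def sum_distrib_left mult.assoc)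
    also have "\<dots> = (\<Sum>i\<in>UNIV. (\<Sum>j\<in>UNIV. v $ (k, j) * w $ (i, j)) * y $ i)"
      by (subst sum.swap) (simp only: sum_distrib_right)
    finally show ?thesis using p by (simp add: perp_def)
  qed
  ultimately show "w \<in> tensor_subspace (rker v) (lker v)"
    by (auto simp: tensor_subspace_def rker_def lker_def vec_eq_iff)
next
  assume w: "w \<in> tensor_subspace (rker v) (lker v)"
  have "(\<Sum>i\<in>UNIV. v $ (i, k) * w $ (i, j)) = 0" for k j
  proof -
    have "mat_of w *v axis j 1 \<in> lker v" using w by (auto simp: tensor_subspace_def)
    then have "(transpose (mat_of v) *v column j (mat_of w)) $ k = 0" by (simp add: lker_def matrix_vector_axis)
    then show ?thesis by (simp add: matrix_vector_mult_def transpose_def column_def)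
  qed
  moreover have "(\<Sum>j\<in>UNIV. v $ (k, j) * w $ (i, j)) = 0" for k i
  proof -
    have "transpose (mat_of w) *v axis i 1 \<in> rker v" using w by (auto simp: tensor_subspace_def)
    then have "(mat_of v *v column i (transpose (mat_of w))) $ k = 0" by (simp add: rker_def matrix_vector_axis)
    then show ?thesis by (simp add: matrix_vector_mult_def transpose_def column_def)
  qed
  ultimately show "perp v w" by (simp add: perp_def)
qed

text \<open>A minor that is the identity at \<open>u\<close> is bordered by a left kernel vector and
  a kernel vector. The new row is \<open>t\<close> times a constant row \<open>N\<close>, so the
  determinant is t det(M t), with derivative det(M 0) at 0.\<close>

lemma minor_directional_derivative:
  fixes u y :: "complex ^ ('m::finite \<times> 'n::finite)"
  assumes I: "\<forall>i\<in>I. \<forall>j\<in>I. (\<Sum>k\<in>UNIV. a i $ k * (mat_of u *v b j) $ k) = (if i = j then 1 else 0)"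
    and i0: "i0 \<notin> I" and q: "q \<in> lker u" and x: "x \<in> rker u"
  defines "a' \<equiv> a(i0 := q)" and "b' \<equiv> b(i0 := x)"
  shows "((\<lambda>t. det (minor_mat (insert i0 I) a' b' (u + t *s y))) has_field_derivative
    (\<Sum>k\<in>UNIV. q $ k * (mat_of y *v x) $ k)) (at 0)"
proof -
  let ?I = "insert i0 I"
  define N :: "complex ^ 'm" where "N = (\<chi> j. if j \<in> ?I then \<Sum>k\<in>UNIV. q $ k * (mat_of y *v b' j) $ k else 0)"
  define M where "M t = (\<chi> i. if i = i0 then N else minor_mat ?I a' b' (u + t *s y) $ i)" for t
  have expand: "(\<Sum>k\<in>UNIV. z $ k * (mat_of (u + t *s y) *v w) $ k) =
      (\<Sum>k\<in>UNIV. z $ k * (mat_of u *v w) $ k) + t * (\<Sum>k\<in>UNIV. z $ k * (mat_of y *v w) $ k)" for z w t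
    by (simp add: mat_of_add matrix_vector_mult_add_rdistrib mat_of_scale distrib_left sum.distrib sum_distrib_left mult_ac)
  have q0: "(\<Sum>k\<in>UNIV. q $ k * (mat_of u *v w) $ k) = 0" for w
  proof -
    have "(\<Sum>k\<in>UNIV. (mat_of u *v w) $ k * q $ k) = (\<Sum>j\<in>UNIV. w $ j * (transpose (mat_of u) *v q) $ j)"
      by (rule dot_matrix_transpose)
    also have "\<dots> = 0" using q by (simp add: lker_def)
    finally show ?thesis by (simp add: mult.commute)
  qed
  have det: "det (minor_mat ?I a' b' (u + t *s y)) = t * det (M t)" for t
  proof -
    have "minor_mat ?I a' b' (u + t *s y) = (\<chi> i. if i = i0 then t *s N else minor_mat ?I a' b' (u + t *s y) $ i)"
      by (auto simp: vec_eq_iff minor_mat_def N_def a'_def expand q0)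
    then have "det (minor_mat ?I a' b' (u + t *s y)) = det (\<chi> i. if i = i0 then t *s N else minor_mat ?I a' b' (u + t *s y) $ i)"
      by (rule arg_cong)
    also have "\<dots> = t * det (M t)" unfolding M_def by (rule det_row_mul)
    finally show ?thesis .
  qed
  \<comment> \<open>At \<open>t = 0\<close> every other row is a row of the identity, the entry in
    the new column being 0 because \<open>x\<close> is in the kernel; Cramer's rule then leaves the
    diagonal entry of \<open>N\<close>.\<close>
  have M0: "M 0 = (\<chi> i. if i = i0 then \<Sum>j\<in>UNIV. N $ j *s row j (mat 1) else row i (mat 1))"
  proof -
    have "(\<Sum>j\<in>UNIV. N $ j *s row j (mat 1)) = N"
      by (simp add: vec_eq_iff row_def mat_def if_distrib if_distribR cong: if_cong)
    moreover have "minor_mat ?I a' b' (u + 0 *s y) $ i = row i (mat 1)" if "i \<noteq> i0" for i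
    proof -
      have "minor_mat ?I a' b' u $ i $ j = (if i = j then 1 else 0)" for j
        using that I i0 x by (auto simp: minor_mat_def a'_def b'_def rker_def)
      then show ?thesis by (simp add: vec_eq_iff row_def mat_def)
    qed
    ultimately show ?thesis by (auto simp: M_def vec_eq_iff)
  qed
  have "det (M 0) = N $ i0 * det (mat 1 :: complex ^ 'm ^ 'm)" unfolding M0 by (rule cramer_lemma_transpose)
  then have detM0: "det (M 0) = (\<Sum>k\<in>UNIV. q $ k * (mat_of y *v x) $ k)" by (simp add: N_def b'_def)
  have cont: "isCont (\<lambda>t. M t $ i $ j) 0" for i j
  proof -
    have "M t $ i $ j = (if i = i0 then N $ j else if i \<in> ?I \<and> j \<in> ?I then
        (\<Sum>k\<in>UNIV. a' i $ k * (mat_of u *v b' j) $ k) + t * (\<Sum>k\<in>UNIV. a' i $ k * (mat_of y *v b' j) $ k)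
        else if i = j then 1 else 0)" for t
      by (auto simp: M_def minor_mat_def expand)
    then show ?thesis by (cases "i = i0"; cases "i \<in> ?I \<and> j \<in> ?I") (auto intro!: continuous_intros)
  qed
  \<comment> \<open>By the Caratheodory criterion, continuity of the cofactor of \<open>t\<close> at
    0 yields the derivative of the product.\<close>
  have "isCont (\<lambda>t. det (M t)) 0"
    unfolding det_def by (intro continuous_sum continuous_mult continuous_const continuous_prod cont)
  then have "((\<lambda>t. t * det (M t)) has_field_derivative det (M 0)) (at 0)"
    unfolding CARAT_DERIV by (intro exI[of _ "\<lambda>t. det (M t)"]) (simp add: mult.commute)
  then show ?thesis unfolding det detM0 .
qed

section \<open>Gradients of forms that vanish on the determinantal variety\<close>

definition vanishing_form :: "nat \<Rightarrow> nat \<Rightarrow> (complex ^ ('m::finite \<times> 'n::finite) \<Rightarrow> complex) \<Rightarrow> bool" where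
  "vanishing_form r d F \<longleftrightarrow> form d F \<and> (\<forall>q\<in>determinantal r. \<forall>w\<in>q. F w = 0)"

text \<open>The zero vector represents no point; there \<open>F\<close> is controlled by homogeneity
  from \<open>u\<close>, which also covers degree 0.\<close>

lemma vanishing_form_zero:
  fixes u w :: "complex ^ ('m::finite \<times> 'n::finite)"
  assumes F: "vanishing_form r d F" and u: "u \<noteq> 0" "rank (mat_of u) \<le> r" and w: "rank (mat_of w) \<le> r"
  shows "F w = 0"
proof -
  have *: "F v = 0" if "v \<noteq> 0" "rank (mat_of v) \<le> r" for v
    using F that self_in_pt[of v] unfolding vanishing_form_def determinantal_eq by blast
  show ?thesis
  proof (cases "w = 0")
    case True
    have "form d F" using F by (simp add: vanishing_form_def)
    from form_homogeneous[OF this, of 0 u] show ?thesis using *[OF u] True by simp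
  qed (use * w in blast)
qed

lemma gradient_zero_along_line:
  fixes u :: "complex ^ ('m::finite \<times> 'n::finite)"
  assumes F: "vanishing_form r d F" and u: "u \<noteq> 0" "rank (mat_of u) \<le> r"
    and g: "\<forall>y. ((\<lambda>t. F (u + t *s y)) has_field_derivative (\<Sum>i\<in>UNIV. g $ i * y $ i)) (at 0)"
    and y: "\<And>t. rank (mat_of (u + t *s y)) \<le> r"
  shows "(\<Sum>i\<in>UNIV. g $ i * y $ i) = 0"
proof -
  have "(\<lambda>t. F (u + t *s y)) = (\<lambda>t. 0)" using vanishing_form_zero[OF F u y] by (rule ext)
  then have "((\<lambda>t. 0 :: complex) has_field_derivative (\<Sum>i\<in>UNIV. g $ i * y $ i)) (at 0)" using g[rule_format, of y] by simp
  then show ?thesis using DERIV_unique DERIV_const by blast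
qed

lemma sum_pairs: "(\<Sum>p\<in>UNIV. f p) = (\<Sum>i\<in>UNIV. \<Sum>j\<in>UNIV. f (i, j))"
  for f :: "'a::finite \<times> 'b::finite \<Rightarrow> complex"
  by (simp add: UNIV_Times_UNIV[symmetric] sum.cartesian_product del: UNIV_Times_UNIV)

text \<open>Adding a multiple of one column of \<open>u\<close> to a column, or of one row to a row,
  does not raise the rank. \<open>F\<close> vanishes along these lines, and orthogonality to their
  directions is the system of equations in \<open>perp\<close>.\<close>

lemma gradient_perp:
  fixes u :: "complex ^ ('m::finite \<times> 'n::finite)"
  assumes F: "vanishing_form r d F" and u: "u \<noteq> 0" "rank (mat_of u) \<le> r"
    and g: "\<forall>y. ((\<lambda>t. F (u + t *s y)) has_field_derivative (\<Sum>i\<in>UNIV. g $ i * y $ i)) (at 0)"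
  shows "perp u g"
  unfolding perp_def
proof (intro conjI allI)
  fix k j :: 'n
  define y :: "complex ^ ('m \<times> 'n)" where "y = (\<chi> p. if snd p = j then u $ (fst p, k) else 0)"
  have "mat_of (u + t *s y) *v x = mat_of u *v (x + (t * x $ j) *s axis k 1)" for t x
  proof -
    have "(mat_of y *v x) = x $ j *s column k (mat_of u)"
      by (simp add: vec_eq_iff matrix_vector_mult_def column_def y_def if_distrib if_distribR mult.commute cong: if_cong)
    then show ?thesis
      by (simp add: mat_of_add matrix_vector_mult_add_rdistrib mat_of_scale matrix_vector_right_distrib
          vector_scalar_commute matrix_vector_axis)
  qed
  then have sub: "range ((*v) (mat_of (u + t *s y))) \<subseteq> range ((*v) (mat_of u))" for t by auto
  have "rank (mat_of (u + t *s y)) \<le> r" for t by (rule order_trans[OF rank_mono_range[OF sub] u(2)])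
  from gradient_zero_along_line[OF F u g this]
  have "(\<Sum>i\<in>UNIV. \<Sum>j'\<in>UNIV. g $ (i, j') * y $ (i, j')) = 0" by (simp add: sum_pairs)
  moreover have "(\<Sum>j'\<in>UNIV. g $ (i, j') * y $ (i, j')) = u $ (i, k) * g $ (i, j)" for i
    by (simp add: y_def if_distrib mult.commute cong: if_cong)
  ultimately show "(\<Sum>i\<in>UNIV. u $ (i, k) * g $ (i, j)) = 0" by simp
next
  fix k i :: 'm
  define y :: "complex ^ ('m \<times> 'n)" where "y = (\<chi> p. if fst p = i then u $ (k, snd p) else 0)"
  have sub: "rker u \<subseteq> rker (u + t *s y)" for t
  proof
    fix x assume x: "x \<in> rker u"
    have "(mat_of y *v x) $ l = (if l = i then (mat_of u *v x) $ k else 0)" for l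
      by (simp add: matrix_vector_mult_def y_def)
    then have "mat_of y *v x = 0" using x by (simp add: vec_eq_iff rker_def)
    then show "x \<in> rker (u + t *s y)"
      using x by (simp add: rker_def mat_of_add matrix_vector_mult_add_rdistrib mat_of_scale)
  qed
  have "rank (mat_of (u + t *s y)) \<le> r" for t by (rule order_trans[OF rank_mono_rker[OF sub] u(2)])
  from gradient_zero_along_line[OF F u g this]
  have "(\<Sum>i'\<in>UNIV. \<Sum>j\<in>UNIV. g $ (i', j) * y $ (i', j)) = 0" by (simp add: sum_pairs)
  moreover have "(\<Sum>j\<in>UNIV. g $ (i', j) * y $ (i', j)) = (if i' = i then \<Sum>j\<in>UNIV. u $ (k, j) * g $ (i, j) else 0)" for i'
    by (simp add: y_def mult.commute)
  ultimately show "(\<Sum>j\<in>UNIV. u $ (k, j) * g $ (i, j)) = 0" by simp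
qed

lemma tangent_cone_space_eq:
  "tangent_cone_space (determinantal r) p = {y. \<forall>d F. vanishing_form r d F \<longrightarrow>
     (\<forall>v\<in>p - {0}. deriv (\<lambda>t. F (v + t *s y)) 0 = 0)}"
  unfolding tangent_cone_space_def vanishing_form_def ..

lemma pt_nonzeroE:
  assumes "v \<in> pt u - {0}" obtains c where "c \<noteq> 0" "v = c *s u"
proof -
  obtain c where "v = c *s u" using assms by (auto simp: pt_def)
  then show thesis using assms that[of c] by auto
qed

text \<open>One inclusion is \<open>gradient_perp\<close>. For the other, bordered minors of size
  \<open>r + 1\<close> vanish on the variety, and their differentials at \<open>u\<close> are the
  pairings with rank one matrices that span the tensor subspace.\<close>

lemma tangent_cone_space_smooth:
  fixes u :: "complex ^ ('m::finite \<times> 'n::finite)"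
  assumes u: "u \<noteq> 0" "rank (mat_of u) = r" and r: "r < CARD('m)"
  shows "tangent_cone_space (determinantal r) (pt u) = annihilator (tensor_subspace (rker u) (lker u))"
proof (intro set_eqI iffI)
  fix y assume y: "y \<in> annihilator (tensor_subspace (rker u) (lker u))"
  show "y \<in> tangent_cone_space (determinantal r) (pt u)"
    unfolding tangent_cone_space_eq
  proof (intro CollectI allI impI ballI)
    fix d and F :: "complex ^ ('m \<times> 'n) \<Rightarrow> complex" and v assume F: "vanishing_form r d F" and "v \<in> pt u - {0}"
    then obtain c where c: "c \<noteq> 0" "v = c *s u" using pt_nonzeroE by blast
    have v: "v \<noteq> 0" "rank (mat_of v) \<le> r" using u c kernels_scale(3)[OF c(1), of u] by auto
    have "form d F" using F by (simp add: vanishing_form_def)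
    from form_gradient[OF this, of v] obtain g where
      g: "\<forall>y. ((\<lambda>t. F (v + t *s y)) has_field_derivative (\<Sum>i\<in>UNIV. g $ i * y $ i)) (at 0)" by (elim exE) (rule that)
    have "g \<in> tensor_subspace (rker u) (lker u)"
      using gradient_perp[OF F v g] kernels_scale[OF c(1), of u] unfolding perp_iff c(2) by simp
    then have "(\<Sum>i\<in>UNIV. g $ i * y $ i) = 0" using y by (simp add: annihilator_def)
    then show "deriv (\<lambda>t. F (v + t *s y)) 0 = 0" using DERIV_imp_deriv[OF g[rule_format, of y]] by simp
  qed
next
  fix y assume y: "y \<in> tangent_cone_space (determinantal r) (pt u)"
  obtain I and a :: "'m \<Rightarrow> complex ^ 'm" and b :: "'m \<Rightarrow> complex ^ 'n" where I:
    "card I + vec.dim (rker u \<inter> UNIV) = vec.dim (UNIV :: (complex ^ 'n) set)"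
    "\<forall>i\<in>I. \<forall>j\<in>I. (\<Sum>k\<in>UNIV. a i $ k * (mat_of u *v b j) $ k) = (if i = j then 1 else 0)"
    using minor_frame[OF vec.subspace_UNIV, of u] by (elim exE conjE) (rule that)
  have cI: "card I = r" using I(1) rank_nullity[of u] u(2) unfolding vec_dim_card Int_UNIV_right by linarith
  then obtain i0 where i0: "i0 \<notin> I" using r by (metis UNIV_eq_I less_irrefl)
  have "(\<Sum>i\<in>UNIV. q $ i * (mat_of y *v x) $ i) = 0" if qx: "x \<in> rker u" "q \<in> lker u" for x q
  proof -
    let ?F = "\<lambda>v. det (minor_mat (insert i0 I) (a(i0 := q)) (b(i0 := x)) v)"
    have "vanishing_form r (card (insert i0 I)) ?F"
      unfolding vanishing_form_def
    proof (intro conjI ballI)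
      show fF: "form (card (insert i0 I)) ?F" by (rule form_minor)
      fix p :: "('m \<times> 'n) point" and w assume "p \<in> determinantal r" "w \<in> p"
      then obtain v where v: "p = pt v" "rank (mat_of v) \<le> r" unfolding determinantal_eq by blast
      have "?F v = 0"
      proof (rule ccontr)
        assume "?F v \<noteq> 0"
        from minor_image[OF this vec.subspace_UNIV] have "vec.dim (rker v) + card (insert i0 I) \<le> CARD('n)"
          unfolding vec_dim_card Int_UNIV_right by simp
        then show False using rank_nullity[of v] v(2) cI i0 by simp
      qed
      then show "?F w = 0" using form_zero_on_pt[OF fF, of v] \<open>w \<in> p\<close> v(1) by blast
    qed
    moreover have "u \<in> pt u - {0}" using u(1) self_in_pt by simp
    ultimately have "deriv (\<lambda>t. ?F (u + t *s y)) 0 = 0" using y unfolding tangent_cone_space_eq by blast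
    then show ?thesis
      using DERIV_imp_deriv[OF minor_directional_derivative[OF I(2) i0 qx(2,1), of y]] by simp
  qed
  then have "(\<Sum>p\<in>UNIV. h $ p * y $ p) = 0" if "h \<in> tensor_subspace (rker u) (lker u)" for h
    using tensor_subspace_pairing[OF subspace_rker subspace_lker that] by blast
  then show "y \<in> annihilator (tensor_subspace (rker u) (lker u))" unfolding annihilator_def by blast
qed

text \<open>Changing a single entry raises the rank by at most one, since kernel vectors with zero
  coordinate \<open>j\<close> survive. So \<open>F\<close> vanishes along every coordinate direction
  and has gradient 0.\<close>

lemma tangent_cone_space_singular:
  fixes u :: "complex ^ ('m::finite \<times> 'n::finite)"
  assumes u: "u \<noteq> 0" "rank (mat_of u) < r"
  shows "tangent_cone_space (determinantal r) (pt u) = UNIV"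
proof -
  have "deriv (\<lambda>t. F (v + t *s y)) 0 = 0" if F: "vanishing_form r d F" and vu: "v \<in> pt u - {0}"
    for d and F :: "complex ^ ('m \<times> 'n) \<Rightarrow> complex" and v y
  proof -
    obtain c where c: "c \<noteq> 0" "v = c *s u" using pt_nonzeroE[OF vu] by blast
    have v: "v \<noteq> 0" "rank (mat_of v) < r" using u c kernels_scale(3)[OF c(1), of u] by auto
    have "form d F" using F by (simp add: vanishing_form_def)
    from form_gradient[OF this, of v] obtain g where
      g: "\<forall>y. ((\<lambda>t. F (v + t *s y)) has_field_derivative (\<Sum>i\<in>UNIV. g $ i * y $ i)) (at 0)" by (elim exE) (rule that)
    have "g $ (i, j) = 0" for i j
    proof -
      have "rank (mat_of (v + t *s axis (i, j) 1)) \<le> r" for t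
      proof -
        let ?w = "v + t *s axis (i, j) 1"
        have "rker v \<inter> coord_space (- {j}) \<subseteq> rker ?w"
        proof
          fix x assume x: "x \<in> rker v \<inter> coord_space (- {j})"
          have "(mat_of (axis (i, j) 1) *v x) $ k = 0" for k
            using x unfolding matrix_vector_mult_def vec_lambda_beta
            by (intro sum.neutral) (auto simp: axis_def coord_space_def)
          then have "mat_of (axis (i, j) 1) *v x = 0" by (simp add: vec_eq_iff)
          then show "x \<in> rker ?w"
            using x by (simp add: rker_def mat_of_add matrix_vector_mult_add_rdistrib mat_of_scale)
        qed
        then have "vec.dim (rker v \<inter> coord_space (- {j})) \<le> vec.dim (rker ?w)" by (rule vec.dim_subset)
        moreover have "vec.dim (rker v) + vec.dim (coord_space (- {j})) \<le> CARD('n) + vec.dim (rker v \<inter> coord_space (- {j}))"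
          using dim_add_le_dim_inter[OF subspace_rker subspace_coord_space vec.subspace_UNIV subset_UNIV subset_UNIV, of v "- {j}"]
          unfolding vec_dim_card .
        moreover have "vec.dim (coord_space (- {j})) = CARD('n) - 1"
          unfolding dim_coord_space by (simp add: Compl_eq_Diff_UNIV card_Diff_subset)
        moreover have "CARD('n) \<ge> 1" by (simp add: Suc_leI)
        ultimately show ?thesis using rank_nullity[of v] rank_nullity[of ?w] v(2) by linarith
      qed
      from gradient_zero_along_line[OF F v(1) less_imp_le[OF v(2)] g this]
      show ?thesis by (simp add: axis_def if_distrib cong: if_cong)
    qed
    then have "g = 0" by (auto simp: vec_eq_iff)
    then show ?thesis using DERIV_imp_deriv[OF g[rule_format, of y]] by simp
  qed
  then show ?thesis unfolding tangent_cone_space_eq by blast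
qed

section \<open>The smooth locus and the conormal hyperplanes of the determinantal variety\<close>

context
  fixes r :: nat
  assumes r: "1 \<le> r" "r < CARD('m::finite)" "CARD('m) \<le> CARD('n::finite)"
begin

abbreviation (input) "Xr \<equiv> (determinantal r :: ('m \<times> 'n) point set)"

lemma local_zdim_determinantal:
  assumes "p \<in> Xr"
  shows "local_zdim Xr p = int (r * (CARD('m) + CARD('n) - r)) - 1"
proof -
  have UV: "vec.dim (UNIV :: (complex ^ 'n) set) = CARD('n)" "vec.dim (UNIV :: (complex ^ 'm) set) = CARD('m)"
    by (rule vec_dim_card)+
  let ?s = "CARD('m) - r"
  have s: "?s \<le> vec.dim (UNIV :: (complex ^ 'n) set)" "?s < CARD('m)" "?s \<le> vec.dim (UNIV :: (complex ^ 'm) set)"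
    using r unfolding UV by auto
  have Xeq: "Xr = degen_locus UNIV UNIV ?s" using r by (intro determinantal_eq_degen_locus) auto
  \<comment> \<open>With m rows, n columns and s = m - r the count is r (n - m + r) + 2 r (m -
    r).\<close>
  have D: "degen_dim CARD('m) CARD('n) (min (vec.dim (UNIV :: (complex ^ 'n) set)) CARD('m)) (vec.dim (UNIV :: (complex ^ 'm) set)) ?s
      = r * (CARD('m) + CARD('n) - r)"
  proof -
    obtain k l where k: "CARD('m) = r + k" "CARD('n) = CARD('m) + l" using r by (metis le_iff_add less_imp_le)
    show ?thesis unfolding UV degen_dim_def using k by (simp add: algebra_simps)
  qed
  note le = zdim_degen_locus_subset[OF vec.subspace_UNIV vec.subspace_UNIV s(1,2) r(3) s(3), folded Xeq, unfolded D]
  note comp = zdim_degen_locus_component[OF vec.subspace_UNIV vec.subspace_UNIV s(1,2) r(3) s(3), folded Xeq, unfolded D]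
  show ?thesis unfolding local_zdim_def
  proof (rule cSup_eq_maximum)
    obtain A where "A \<subseteq> Xr" "p \<in> A" "irreducible_in zariski A" "closedin (subtopology zariski Xr) A"
      "zdim A = int (r * (CARD('m) + CARD('n) - r)) - 1" using comp[OF assms] by (elim exE conjE) (rule that)
    then show "int (r * (CARD('m) + CARD('n) - r)) - 1 \<in> {zdim Y |Y. closedin (subtopology zariski Xr) Y \<and> irreducible_in zariski Y \<and> p \<in> Y}"
      by (intro CollectI exI[of _ A]) simp
    fix z assume "z \<in> {zdim Y |Y. closedin (subtopology zariski Xr) Y \<and> irreducible_in zariski Y \<and> p \<in> Y}"
    then obtain Y where Y: "z = zdim Y" "closedin (subtopology zariski Xr) Y" by blast
    have "Y \<subseteq> Xr" using closedin_subset[OF Y(2)] by simp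
    then show "z \<le> int (r * (CARD('m) + CARD('n) - r)) - 1" unfolding Y(1) by (rule le)
  qed
qed

text \<open>At rank \<open>r\<close> the tangent space has codimension (m - r)(n - r), the
  codimension of the variety; at smaller rank it is everything and too large by this positive
  number.\<close>

lemma smooth_locus_determinantal: "smooth_locus Xr = {pt v | v. v \<noteq> 0 \<and> rank (mat_of v) = r}"
proof -
  have key: "pt v \<in> smooth_locus Xr \<longleftrightarrow> rank (mat_of v) = r" if v: "v \<noteq> 0" "rank (mat_of v) \<le> r" for v :: "complex ^ ('m \<times> 'n)"
  proof -
    have vX: "pt v \<in> Xr" unfolding determinantal_eq using v by blast
    obtain k l where k: "CARD('m) = r + k" "CARD('n) = r + l" "k > 0" "l > 0"
      using r by (metis add_diff_inverse_nat less_imp_le_nat linorder_not_less order_less_le_trans zero_less_diff)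
    have sub: "vec.subspace (tangent_cone_space Xr (pt v))"
      using tangent_cone_space_smooth[OF v(1) _ r(2)] tangent_cone_space_singular[OF v(1)] v(2)
        subspace_annihilator vec.subspace_UNIV by (metis le_neq_implies_less)
    have z: "zdim (tangent_space Xr (pt v)) = int (vec.dim (tangent_cone_space Xr (pt v))) - 1"
      unfolding tangent_space_def by (rule zdim_proj[OF sub])
    have loc: "local_zdim Xr (pt v) = int (r * (CARD('m) + CARD('n) - r)) - 1" by (rule local_zdim_determinantal[OF vX])
    show ?thesis
    proof (cases "rank (mat_of v) = r")
      case True
      have "vec.dim (tensor_subspace (rker v) (lker v)) = l * k"
        using rank_nullity[of v] rank_nullity_left[of v] True k(1,2)
        by (simp add: dim_tensor_subspace[OF subspace_rker subspace_lker])
      then have "vec.dim (tangent_cone_space Xr (pt v)) + l * k = CARD('m \<times> 'n)"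
        using dim_annihilator[OF subspace_tensor_subspace[OF subspace_rker subspace_lker], of v v]
        unfolding tangent_cone_space_smooth[OF v(1) True r(2)] by simp
      then have "vec.dim (tangent_cone_space Xr (pt v)) + l * k = (r + k) * (r + l)" using k by simp
      then have "vec.dim (tangent_cone_space Xr (pt v)) = r * (CARD('m) + CARD('n) - r)"
        unfolding k by (simp add: algebra_simps)
      then show ?thesis using vX True z loc by (simp add: smooth_locus_def)
    next
      case False
      then have "tangent_cone_space Xr (pt v) = UNIV" using v by (intro tangent_cone_space_singular) auto
      then have "vec.dim (tangent_cone_space Xr (pt v)) = CARD('m \<times> 'n)" by (metis vec_dim_card)
      also have "\<dots> = (r + k) * (r + l)" using k by simp
      also have "\<dots> = r * (CARD('m) + CARD('n) - r) + k * l" unfolding k by (simp add: algebra_simps)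
      finally have "zdim (tangent_space Xr (pt v)) \<noteq> local_zdim Xr (pt v)" unfolding z loc using k by simp
      then show ?thesis using False by (simp add: smooth_locus_def)
    qed
  qed
  show ?thesis
  proof (intro set_eqI iffI)
    fix p assume p: "p \<in> smooth_locus Xr"
    then have "p \<in> Xr" by (simp add: smooth_locus_def)
    then obtain v where v: "p = pt v" "v \<noteq> 0" "rank (mat_of v) \<le> r" unfolding determinantal_eq by blast
    then show "p \<in> {pt v | v. v \<noteq> 0 \<and> rank (mat_of v) = r}" using key[OF v(2,3)] p by blast
  next
    fix p assume "p \<in> {pt v :: ('m \<times> 'n) point | v. v \<noteq> 0 \<and> rank (mat_of v) = r}"
    then obtain v where "p = pt v" "v \<noteq> 0" "rank (mat_of v) = r" by blast
    then show "p \<in> smooth_locus Xr" using key[of v] by simp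
  qed
qed

text \<open>The tangent space is an annihilator, so taking annihilators again turns the inclusion
  into membership of \<open>w\<close> in the tensor subspace.\<close>

lemma tangent_space_subset_hyperplane:
  fixes v w :: "complex ^ ('m \<times> 'n)"
  assumes v: "v \<noteq> 0" "rank (mat_of v) = r"
  shows "tangent_space Xr (pt v) \<subseteq> hyperplane (pt w) \<longleftrightarrow> perp v w"
proof -
  let ?T = "tensor_subspace (rker v) (lker v)"
  have T: "vec.subspace ?T" by (intro subspace_tensor_subspace subspace_rker subspace_lker)
  have "hyperplane (pt w) = proj (annihilator (pt w))" by (simp add: hyperplane_def annihilator_def)
  then have "tangent_space Xr (pt v) \<subseteq> hyperplane (pt w) \<longleftrightarrow> proj (annihilator ?T) \<subseteq> proj (annihilator (pt w))"
    unfolding tangent_space_def tangent_cone_space_smooth[OF v r(2)] by simp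
  also have "\<dots> \<longleftrightarrow> annihilator ?T \<subseteq> annihilator (pt w)"
  proof
    assume s: "proj (annihilator ?T) \<subseteq> proj (annihilator (pt w))"
    show "annihilator ?T \<subseteq> annihilator (pt w)"
    proof
      fix y assume y: "y \<in> annihilator ?T"
      show "y \<in> annihilator (pt w)"
      proof (cases "y = 0")
        case True then show ?thesis using vec.subspace_0[OF subspace_annihilator] by simp
      next
        case False
        then show ?thesis using s y pt_in_proj_iff[OF subspace_annihilator False] by blast
      qed
    qed
  next
    assume "annihilator ?T \<subseteq> annihilator (pt w)"
    then show "proj (annihilator ?T) \<subseteq> proj (annihilator (pt w))" unfolding proj_def by blast
  qed
  also have "\<dots> \<longleftrightarrow> w \<in> ?T"
  proof
    assume s: "annihilator ?T \<subseteq> annihilator (pt w)"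
    show "w \<in> ?T"
    proof (rule ccontr)
      assume "w \<notin> ?T"
      then obtain u where u: "u \<in> annihilator ?T" "(\<Sum>i\<in>UNIV. u $ i * w $ i) \<noteq> 0" by (rule annihilator_separates[OF T])
      have "u \<in> annihilator (pt w)" using s u(1) by blast
      then have "(\<Sum>i\<in>UNIV. w $ i * u $ i) = 0" using self_in_pt[of w] unfolding annihilator_def by blast
      then show False using u(2) by (simp add: mult.commute)
    qed
  next
    assume "w \<in> ?T"
    then have "pt w \<subseteq> ?T" by (simp add: pt_subset_iff[OF T])
    then show "annihilator ?T \<subseteq> annihilator (pt w)" unfolding annihilator_def by blast
  qed
  finally show ?thesis unfolding perp_iff .
qed

section \<open>The relative conormal variety, dual variety and defect\<close>

context
  fixes L1 :: "(complex ^ 'n) set" and L2 :: "(complex ^ 'm) set"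
  assumes L1: "vec.subspace L1" and L2: "vec.subspace L2"
begin

abbreviation (input) "Zr \<equiv> Xr \<inter> proj (tensor_subspace L1 L2)"

definition incidence :: "(('m \<times> 'n) point \<times> ('m \<times> 'n) point) set" where
  "incidence = {(pt v, pt w) | v w. v \<noteq> 0 \<and> w \<noteq> 0 \<and> rank (mat_of v) = r \<and> v \<in> tensor_subspace L1 L2 \<and> perp v w}"

lemma rel_conormal_determinantal: "rel_conormal Xr Zr = zariski2 closure_of incidence"
proof -
  have T: "vec.subspace (tensor_subspace L1 L2)" by (rule subspace_tensor_subspace[OF L1 L2])
  have "{(x, h). x \<in> smooth_locus Xr \<inter> Zr \<and> h \<in> proj UNIV \<and> tangent_space Xr x \<subseteq> hyperplane h} = incidence" (is "?A = _")
  proof (intro set_eqI iffI)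
    fix q assume q: "q \<in> ?A"
    obtain x h where xh: "q = (x, h)" by (cases q)
    obtain v where v: "x = pt v" "v \<noteq> 0" "rank (mat_of v) = r" using q xh unfolding smooth_locus_determinantal by auto
    obtain w where w: "h = pt w" "w \<noteq> 0" using q xh unfolding proj_UNIV by auto
    have "pt v \<in> proj (tensor_subspace L1 L2)" using q xh v by auto
    then have "v \<in> tensor_subspace L1 L2" using pt_in_proj_iff[OF T v(2)] by simp
    moreover have "perp v w" using q xh v w tangent_space_subset_hyperplane[OF v(2,3), of w] by simp
    ultimately show "q \<in> incidence" unfolding incidence_def using xh v w by (intro CollectI exI[of _ v] exI[of _ w]) simp
  next
    fix q assume "q \<in> incidence"
    then obtain v w where q: "q = (pt v, pt w)" "v \<noteq> 0" "w \<noteq> 0" "rank (mat_of v) = r" "v \<in> tensor_subspace L1 L2" "perp v w"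
      unfolding incidence_def mem_Collect_eq by (elim exE conjE) (rule that)
    have s: "pt v \<in> smooth_locus Xr" unfolding smooth_locus_determinantal using q by blast
    then have "pt v \<in> Xr" by (simp add: smooth_locus_def)
    moreover have "pt v \<in> proj (tensor_subspace L1 L2)" using pt_in_proj_iff[OF T q(2)] q(5) by simp
    ultimately show "q \<in> ?A"
      using s q(1,3,6) tangent_space_subset_hyperplane[OF q(2,4), of w] by simp
  qed
  then show ?thesis unfolding rel_conormal_def by simp
qed

text \<open>The row span and the column span of \<open>v\<close> are subspaces of dimension
  \<open>r\<close> of the two intersections.\<close>

lemma degen_of_incidence:
  assumes "rank (mat_of v) = r" "v \<in> tensor_subspace L1 L2" "perp v w"
  shows "degen L1 L2 r w"
proof -
  have "v \<in> tensor_subspace (rker w) (lker w)" using perp_sym[OF assms(3)] by (simp add: perp_iff)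
  then have sub: "range ((*v) (transpose (mat_of v))) \<subseteq> rker w \<inter> L1" "range ((*v) (mat_of v)) \<subseteq> lker w \<inter> L2"
    using assms(2) by (auto simp: tensor_subspace_def)
  have "rank (transpose (mat_of v)) = r" using assms(1) by (simp add: rank_transpose_complex)
  then show ?thesis
    using vec.dim_subset[OF sub(1)] vec.dim_subset[OF sub(2)] assms(1) unfolding degen_def rank_eq_dim_range by simp
qed

text \<open>All three conditions are closed: the first by linear equations, the second by bilinear
  ones, the third by the minors of the semicontinuity lemmas.\<close>

lemma closure_incidence:
  assumes vw: "(pt v, pt w) \<in> zariski2 closure_of incidence" "v \<noteq> 0" "w \<noteq> 0"
  shows "v \<in> tensor_subspace L1 L2" "perp v w" "degen L1 L2 r w"
proof -
  have inc: "degen L1 L2 r w' \<and> v' \<in> tensor_subspace L1 L2 \<and> perp v' w'"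
    if i: "(pt v', pt w') \<in> incidence" "v' \<noteq> 0" "w' \<noteq> 0" for v' w'
  proof -
    obtain a b where ab: "pt v' = pt a" "pt w' = pt b" "a \<noteq> 0" "b \<noteq> 0" "rank (mat_of a) = r" "a \<in> tensor_subspace L1 L2" "perp a b"
      using i(1) unfolding incidence_def mem_Collect_eq by (elim exE conjE Pair_inject) (rule that)
    obtain c where c: "c \<noteq> 0" "v' = c *s a" by (rule pt_eqD[OF ab(1) i(2)])
    obtain d where d: "d \<noteq> 0" "w' = d *s b" by (rule pt_eqD[OF ab(2) i(3)])
    have "perp v' w'"
    proof -
      have "(\<Sum>i\<in>UNIV. v' $ (i, k) * w' $ (i, j)) = c * d * (\<Sum>i\<in>UNIV. a $ (i, k) * b $ (i, j))" for k j
        by (simp add: c d sum_distrib_left mult_ac)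
      moreover have "(\<Sum>j\<in>UNIV. v' $ (k, j) * w' $ (i, j)) = c * d * (\<Sum>j\<in>UNIV. a $ (k, j) * b $ (i, j))" for k i
        by (simp add: c d sum_distrib_left mult_ac)
      ultimately show ?thesis using ab(7) by (simp add: perp_def)
    qed
    moreover have "v' \<in> tensor_subspace L1 L2"
      unfolding c using vec.subspace_scale[OF subspace_tensor_subspace[OF L1 L2] ab(6)] .
    moreover have "rank (mat_of v') = r" using kernels_scale(3)[OF c(1), of a] ab(5) c(2) by simp
    ultimately show ?thesis using degen_of_incidence by blast
  qed
  show "v \<in> tensor_subspace L1 L2"
  proof (rule ccontr)
    assume "v \<notin> tensor_subspace L1 L2"
    then obtain u where u: "u \<in> annihilator (tensor_subspace L1 L2)" "(\<Sum>i\<in>UNIV. u $ i * v $ i) \<noteq> 0"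
      by (rule annihilator_separates[OF subspace_tensor_subspace[OF L1 L2]])
    have "(\<Sum>i\<in>UNIV. u $ i * v $ i) = 0"
    proof (rule biform_zero_on_closure[OF biform_left[OF form_linear] _ vw(1)])
      fix v' w' assume "v' \<noteq> 0" "w' \<noteq> 0" "(pt v', pt w') \<in> incidence"
      then have "v' \<in> tensor_subspace L1 L2" using inc by blast
      then have "(\<Sum>i\<in>UNIV. v' $ i * u $ i) = 0" using u(1) by (simp add: annihilator_def)
      then show "(\<Sum>i\<in>UNIV. u $ i * v' $ i) = 0" by (simp add: mult.commute)
    qed
    then show False using u(2) by simp
  qed
  show "perp v w"
    unfolding perp_def
  proof (intro conjI allI)
    fix k j
    show "(\<Sum>i\<in>UNIV. v $ (i, k) * w $ (i, j)) = 0"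
    proof (rule biform_zero_on_closure[OF _ _ vw(1)])
      show "biform 1 1 (\<lambda>v w. \<Sum>i\<in>UNIV. v $ (i, k) * w $ (i, j))" by (intro biform_sum biform_times form_coord)
      show "(\<Sum>i\<in>UNIV. v' $ (i, k) * w' $ (i, j)) = 0" if "v' \<noteq> 0" "w' \<noteq> 0" "(pt v', pt w') \<in> incidence" for v' w'
        using inc[OF that(3,1,2)] by (simp add: perp_def)
    qed
  next
    fix k i
    show "(\<Sum>j\<in>UNIV. v $ (k, j) * w $ (i, j)) = 0"
    proof (rule biform_zero_on_closure[OF _ _ vw(1)])
      show "biform 1 1 (\<lambda>v w. \<Sum>j\<in>UNIV. v $ (k, j) * w $ (i, j))" by (intro biform_sum biform_times form_coord)
      show "(\<Sum>j\<in>UNIV. v' $ (k, j) * w' $ (i, j)) = 0" if "v' \<noteq> 0" "w' \<noteq> 0" "(pt v', pt w') \<in> incidence" for v' w'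
        using inc[OF that(3,1,2)] by (simp add: perp_def)
    qed
  qed
  show "degen L1 L2 r w"
    unfolding degen_def
  proof
    obtain d F where F: "form d F" "F w \<noteq> 0" "\<And>w'. F w' \<noteq> 0 \<Longrightarrow> vec.dim (rker w' \<inter> L1) \<le> vec.dim (rker w \<inter> L1)"
      by (rule rker_semicontinuous[OF L1, of w], rule that)
    show "r \<le> vec.dim (rker w \<inter> L1)"
    proof (rule ccontr)
      assume n: "\<not> r \<le> vec.dim (rker w \<inter> L1)"
      have "F w = 0"
      proof (rule biform_zero_on_closure[OF biform_right[OF F(1)] _ vw(1)])
        fix v' w' assume "v' \<noteq> 0" "w' \<noteq> 0" "(pt v', pt w') \<in> incidence"
        then have "degen L1 L2 r w'" using inc by blast
        then show "F w' = 0" using F(3)[of w'] n unfolding degen_def by force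
      qed
      then show False using F(2) by simp
    qed
    obtain d' G where G: "form d' G" "G w \<noteq> 0" "\<And>w'. G w' \<noteq> 0 \<Longrightarrow> vec.dim (lker w' \<inter> L2) \<le> vec.dim (lker w \<inter> L2)"
      by (rule lker_semicontinuous[OF L2, of w], rule that)
    show "r \<le> vec.dim (lker w \<inter> L2)"
    proof (rule ccontr)
      assume n: "\<not> r \<le> vec.dim (lker w \<inter> L2)"
      have "G w = 0"
      proof (rule biform_zero_on_closure[OF biform_right[OF G(1)] _ vw(1)])
        fix v' w' assume "v' \<noteq> 0" "w' \<noteq> 0" "(pt v', pt w') \<in> incidence"
        then have "degen L1 L2 r w'" using inc by blast
        then show "G w' = 0" using G(3)[of w'] n unfolding degen_def by force
      qed
      then show False using G(2) by simp
    qed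
  qed
qed

lemma incidence_subset: "incidence \<subseteq> proj UNIV \<times> proj UNIV"
  unfolding incidence_def by auto

lemma incidence_subset_closure: "incidence \<subseteq> zariski2 closure_of incidence"
  using incidence_subset by (intro closure_of_subset) simp

lemma conormal_pointE:
  assumes "(p, h) \<in> zariski2 closure_of incidence"
  obtains v w where "p = pt v" "h = pt w" "v \<noteq> 0" "w \<noteq> 0"
proof -
  have "(p, h) \<in> proj UNIV \<times> proj UNIV" using subsetD[OF closure_of_subset_topspace assms] by simp
  then show thesis using that by (auto simp: proj_UNIV)
qed

text \<open>Every degenerate \<open>w\<close> comes from the incidence set itself: subspaces of
  dimension \<open>r\<close> of its two kernel intersections carry a matrix of rank exactly
  \<open>r\<close>.\<close>

lemma rel_dual_determinantal: "rel_dual Xr Zr = degen_locus L1 L2 r"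
proof (intro set_eqI iffI)
  fix h assume "h \<in> rel_dual Xr Zr"
  then obtain p where p: "(p, h) \<in> zariski2 closure_of incidence"
    unfolding rel_dual_def rel_conormal_determinantal by auto
  obtain v w where vw: "p = pt v" "h = pt w" "v \<noteq> 0" "w \<noteq> 0" by (rule conormal_pointE[OF p])
  then have "degen L1 L2 r w" using closure_incidence(3)[of v w] p by simp
  then show "h \<in> degen_locus L1 L2 r" unfolding degen_locus_def using vw by (intro CollectI exI[of _ w] conjI)
next
  fix h assume "h \<in> degen_locus L1 L2 r"
  then obtain w where w: "h = pt w" "w \<noteq> 0" "degen L1 L2 r w"
    unfolding degen_locus_def mem_Collect_eq by (elim exE conjE) (rule that)
  obtain P where P: "vec.subspace P" "P \<subseteq> rker w \<inter> L1" "vec.dim P = r"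
    using w(3) unfolding degen_def by (elim conjE) (rule subspace_of_dim[OF vec.subspace_inter[OF subspace_rker L1]], assumption, rule that)
  obtain Q where Q: "vec.subspace Q" "Q \<subseteq> lker w \<inter> L2" "vec.dim Q = r"
    using w(3) unfolding degen_def by (elim conjE) (rule subspace_of_dim[OF vec.subspace_inter[OF subspace_lker L2]], assumption, rule that)
  obtain v where v: "v \<in> tensor_subspace P Q" "rank (mat_of v) = r"
    using tensor_subspace_full_rank[OF P(1) Q(1)] P(3) Q(3) by auto
  have "v \<in> tensor_subspace (rker w) (lker w)" "v \<in> tensor_subspace L1 L2"
    using v(1) tensor_subspace_mono[of P _ Q] P(2) Q(2) by blast+
  moreover then have "perp v w" using perp_sym perp_iff by blast
  moreover have "v \<noteq> 0"
  proof
    assume "v = 0"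
    then have "rker v = UNIV" by (simp add: rker_def)
    then have "vec.dim (rker v) = CARD('n)" by (metis vec_dim_card)
    then show False using rank_nullity[of v] v(2) r(1) by simp
  qed
  ultimately have "(pt v, h) \<in> incidence" unfolding incidence_def w(1) using w(2) v(2)
    by (intro CollectI exI[of _ v] exI[of _ w]) simp
  then have "(pt v, h) \<in> rel_conormal Xr Zr" unfolding rel_conormal_determinantal using incidence_subset_closure by blast
  then show "h \<in> rel_dual Xr Zr" unfolding rel_dual_def by force
qed

text \<open>For a generic hyperplane the second factor has dimension exactly \<open>r\<close>, so that the rank
  condition on the contact locus becomes void.\<close>

lemma contact_locus_determinantal:
  assumes w: "w \<noteq> 0" "degen L1 L2 r w" "vec.dim (lker w \<inter> L2) \<le> r"
  shows "contact_locus (pt w) Xr Zr = proj (tensor_subspace (rker w \<inter> L1) (lker w \<inter> L2))" (is "_ = proj ?T")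
proof -
  have subs: "vec.subspace (rker w \<inter> L1)" "vec.subspace (lker w \<inter> L2)"
    by (intro vec.subspace_inter subspace_rker subspace_lker L1 L2)+
  have T: "vec.subspace ?T" by (rule subspace_tensor_subspace[OF subs])
  have dl: "vec.dim (lker w \<inter> L2) = r" using w(2,3) by (simp add: degen_def)
  have con: "contact_locus (pt w) Xr Zr = {p. (p, pt w) \<in> zariski2 closure_of incidence}"
    unfolding contact_locus_def rel_conormal_determinantal by force
  show ?thesis unfolding con
  proof (intro set_eqI iffI)
    fix p assume "p \<in> {p. (p, pt w) \<in> zariski2 closure_of incidence}"
    then have p: "(p, pt w) \<in> zariski2 closure_of incidence" by simp
    obtain v where v: "p = pt v" "v \<noteq> 0" using conormal_pointE[OF p] by metis
    have "v \<in> tensor_subspace L1 L2" "perp v w" using closure_incidence[of v w] p v w(1) by simp_all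
    then have "v \<in> ?T" using perp_sym[of v w] unfolding tensor_subspace_Int perp_iff by blast
    then show "p \<in> proj ?T" using pt_in_proj_iff[OF T v(2)] v(1) by simp
  next
    fix p assume "p \<in> proj ?T"
    then obtain v where v: "p = pt v" "v \<noteq> 0" "v \<in> ?T" unfolding proj_eq[OF T] by blast
    obtain v1 where v1: "v1 \<in> ?T" "rank (mat_of v1) = r"
      using tensor_subspace_full_rank[OF subs] dl w(2) unfolding degen_def by auto
    have "\<exists>y. y \<in> incidence \<and> y \<in> U" if U: "(p, pt w) \<in> U" "openin zariski2 U" for U
    proof -
      obtain d e B where B: "biform d e B" "B v w \<noteq> 0"
        "\<And>v w. v \<noteq> 0 \<Longrightarrow> w \<noteq> 0 \<Longrightarrow> B v w \<noteq> 0 \<Longrightarrow> (pt v, pt w) \<in> U"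
        by (rule openin_zariski2_base[OF U(2) U(1)[unfolded v(1)] v(2) w(1)], rule that)
      obtain d' F where F: "form d' F" "F v1 \<noteq> 0" "\<And>v. F v \<noteq> 0 \<Longrightarrow> vec.dim (rker v \<inter> UNIV) \<le> vec.dim (rker v1 \<inter> UNIV)"
        by (rule rker_semicontinuous[OF vec.subspace_UNIV, of v1], rule that)
      \<comment> \<open>On the line from \<open>v\<close> to \<open>v1\<close> both \<open>B\<close>
        and the minor \<open>F\<close> become polynomials in \<open>t\<close>; where neither
        vanishes, the point lies in \<open>U\<close> and its rank is at least
        \<open>r\<close>.\<close>
      define \<phi> where "\<phi> x = (\<chi> k. x k)" for x :: "'m \<times> 'n \<Rightarrow> complex"
      have poly: "(\<lambda>x. \<phi> x $ k) \<in> polyfuns (coords UNIV)" for k by (simp add: \<phi>_def polyfuns.gen)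
      have line: "\<phi> (\<lambda>k. v $ k + t * (v1 $ k - v $ k)) = v + t *s (v1 - v)" for t by (simp add: \<phi>_def vec_eq_iff algebra_simps)
      obtain f where f: "\<And>t. B (v + t *s (v1 - v)) w = poly f t"
        using polyfuns_on_line[OF form_in_polyfuns[OF form_of_biform[OF B(1), of w] poly], of "($) v" "($) v1"]
        unfolding line by (elim exE) (rule that, simp)
      obtain g where g: "\<And>t. F (v + t *s (v1 - v)) = poly g t"
        using polyfuns_on_line[OF form_in_polyfuns[OF F(1) poly], of "($) v" "($) v1"]
        unfolding line by (elim exE) (rule that, simp)
      have "f \<noteq> 0" using f[of 0] B(2) by auto
      moreover have "g \<noteq> 0" using g[of 1] F(2) by auto
      ultimately have "f * g \<noteq> 0" by simp
      then obtain t where "poly (f * g) t \<noteq> 0" using poly_all_0_iff_0 by blast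
      then have t: "B (v + t *s (v1 - v)) w \<noteq> 0" "F (v + t *s (v1 - v)) \<noteq> 0" using f[of t] g[of t] by auto
      define u where "u = v + t *s (v1 - v)"
      have uT: "u \<in> ?T" unfolding u_def
        by (intro vec.subspace_add[OF T] vec.subspace_scale[OF T] vec.subspace_diff[OF T] v v1)
      have "vec.dim (rker u) \<le> vec.dim (rker v1)" using F(3)[OF t(2)] unfolding u_def by simp
      then have "r \<le> rank (mat_of u)" using rank_nullity[of u] rank_nullity[of v1] v1(2) by linarith
      moreover have "rank (mat_of u) \<le> r"
      proof -
        have "range ((*v) (mat_of u)) \<subseteq> lker w \<inter> L2" using uT by (auto simp: tensor_subspace_def)
        then show ?thesis unfolding rank_eq_dim_range using vec.dim_subset dl by metis
      qed
      ultimately have ru: "rank (mat_of u) = r" by simp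
      have u0: "u \<noteq> 0"
      proof
        assume "u = 0"
        then have "rker u = UNIV" by (simp add: rker_def)
        then have "vec.dim (rker u) = CARD('n)" by (metis vec_dim_card)
        then show False using rank_nullity[of u] ru r(1) by simp
      qed
      have "u \<in> tensor_subspace L1 L2" "perp u w"
        using uT perp_sym[of w u] unfolding tensor_subspace_Int perp_iff by blast+
      then have "(pt u, pt w) \<in> incidence" unfolding incidence_def using u0 w(1) ru
        by (intro CollectI exI[of _ u] exI[of _ w]) simp
      moreover have "(pt u, pt w) \<in> U" using B(3)[OF u0 w(1)] t(1) unfolding u_def by blast
      ultimately show ?thesis by blast
    qed
    moreover have "(p, pt w) \<in> topspace zariski2" using v w(1) by simp
    ultimately show "p \<in> {p. (p, pt w) \<in> zariski2 closure_of incidence}" unfolding in_closure_of by blast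
  qed
qed

text \<open>Where both kernels are minimal, the contact locus is the projective space of a tensor
  product of spaces of dimensions \<open>?k\<close> and \<open>r\<close>; such points are open and
  dense in the dual.\<close>

lemma rel_dual_defect_determinantal:
  assumes le: "r \<le> vec.dim L1" "r \<le> vec.dim L2"
  shows "rel_dual_defect Xr Zr = int ((r + (vec.dim L1 - CARD('m))) * r) - 1"
proof -
  let ?k = "r + (vec.dim L1 - CARD('m))"
  let ?Y = "degen_locus L1 L2 r"
  let ?D = "int (?k * r) - 1"
  let ?P = "\<lambda>v. vec.dim (rker v \<inter> L1) \<le> ?k \<and> vec.dim (lker v \<inter> L2) \<le> r"
  define U where "U = {pt v | v. v \<noteq> 0 \<and> degen L1 L2 r v \<and> ?P v}"
  have zd: "zdim (contact_locus h Xr Zr) = ?D" if h: "h \<in> U" for h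
  proof -
    obtain w where w: "h = pt w" "w \<noteq> 0" "degen L1 L2 r w" "vec.dim (rker w \<inter> L1) \<le> ?k" "vec.dim (lker w \<inter> L2) \<le> r"
      using h unfolding U_def mem_Collect_eq by (elim exE conjE) (rule that)
    have subs: "vec.subspace (rker w \<inter> L1)" "vec.subspace (lker w \<inter> L2)"
      by (intro vec.subspace_inter subspace_rker subspace_lker L1 L2)+
    have "vec.dim (rker w \<inter> L1) = ?k" using w(4) dim_rker_ge_of_degen[OF L1 w(3)] by linarith
    moreover have "vec.dim (lker w \<inter> L2) = r" using w(3,5) by (simp add: degen_def)
    ultimately show ?thesis
      unfolding w(1) contact_locus_determinantal[OF w(2,3,5)] zdim_proj[OF subspace_tensor_subspace[OF subs]]
        dim_tensor_subspace[OF subs] by simp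
  qed
  have opn: "openin (subtopology zariski ?Y) U"
  proof -
    \<comment> \<open>Products of the two semicontinuity minors exhibit \<open>U\<close> as the
      trace of a Zariski open set.\<close>
    define \<B> where "\<B> = {B. \<exists>d F. form d F \<and> (\<forall>v. F v \<noteq> 0 \<longrightarrow> ?P v) \<and> B = {p \<in> proj UNIV. \<exists>v\<in>p. F v \<noteq> 0}}"
    have "openin zariski (\<Union>\<B>)" unfolding \<B>_def using openin_zariski_form by (intro openin_Union) blast
    moreover have "U = \<Union>\<B> \<inter> ?Y"
    proof (intro set_eqI iffI)
      fix p assume "p \<in> U"
      then obtain v where v: "p = pt v" "v \<noteq> 0" "degen L1 L2 r v" "?P v"
        unfolding U_def mem_Collect_eq by (elim exE conjE) (rule that, simp_all)
      obtain d1 F1 where F1: "form d1 F1" "F1 v \<noteq> 0" "\<And>w. F1 w \<noteq> 0 \<Longrightarrow> vec.dim (rker w \<inter> L1) \<le> vec.dim (rker v \<inter> L1)"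
        by (rule rker_semicontinuous[OF L1, of v], rule that)
      obtain d2 F2 where F2: "form d2 F2" "F2 v \<noteq> 0" "\<And>w. F2 w \<noteq> 0 \<Longrightarrow> vec.dim (lker w \<inter> L2) \<le> vec.dim (lker v \<inter> L2)"
        by (rule lker_semicontinuous[OF L2, of v], rule that)
      have "?P w" if "F1 w * F2 w \<noteq> 0" for w
      proof -
        have "F1 w \<noteq> 0" "F2 w \<noteq> 0" using that by auto
        then show ?thesis using F1(3)[of w] F2(3)[of w] v(4) by linarith
      qed
      then have "{p \<in> proj UNIV. \<exists>v\<in>p. F1 v * F2 v \<noteq> 0} \<in> \<B>"
        unfolding \<B>_def by (intro CollectI exI[of _ "d1 + d2"] exI[of _ "\<lambda>v. F1 v * F2 v"] conjI form_mult F1(1) F2(1) refl) simp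
      moreover have "p \<in> {p \<in> proj UNIV. \<exists>v\<in>p. F1 v * F2 v \<noteq> 0}"
        using v(1,2) F1(2) F2(2) form_nonzero_on_pt[OF form_mult[OF F1(1) F2(1)], of v] by simp
      moreover have "p \<in> ?Y" unfolding degen_locus_def using v by (intro CollectI exI[of _ v] conjI)
      ultimately show "p \<in> \<Union>\<B> \<inter> ?Y" by (intro IntI UnionI)
    next
      fix p assume p: "p \<in> \<Union>\<B> \<inter> ?Y"
      from p obtain v where v: "p = pt v" "v \<noteq> 0" "degen L1 L2 r v"
        unfolding degen_locus_def by (elim IntE CollectE exE conjE) (rule that)
      from p obtain B where B: "B \<in> \<B>" "p \<in> B" by blast
      from B(1) obtain d F where F: "form d F" "\<forall>v. F v \<noteq> 0 \<longrightarrow> ?P v" "B = {p \<in> proj UNIV. \<exists>v\<in>p. F v \<noteq> 0}"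
        unfolding \<B>_def by (elim CollectE exE conjE) (rule that)
      have "F v \<noteq> 0" using B(2) form_nonzero_on_pt[OF F(1), of v] unfolding F(3) v(1) by simp
      then have "?P v" using F(2) by blast
      then show "p \<in> U" unfolding U_def using v by (intro CollectI exI[of _ v] conjI) simp_all
    qed
    ultimately show ?thesis unfolding openin_subtopology by blast
  qed
  have dense: "?Y \<subseteq> zariski closure_of U"
  proof
    fix p assume p: "p \<in> ?Y"
    have "\<exists>y. y \<in> U \<and> y \<in> T" if T: "p \<in> T" "openin zariski T" for T
    proof -
      obtain v where "v \<noteq> 0" "pt v \<in> T" "degen L1 L2 r v" "vec.dim (rker v \<inter> L1) \<le> ?k" "vec.dim (lker v \<inter> L2) \<le> r"
        using degen_locus_generic[OF L1 L2 le(1) r(2,3) le(2) p T(2,1)] by (elim exE conjE) (rule that)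
      then show ?thesis unfolding U_def by (intro exI[of _ "pt v"] conjI CollectI exI[of _ v]) simp_all
    qed
    moreover have "p \<in> topspace zariski" using p degen_locus_subset_proj[of L1 L2 r] by auto
    ultimately show "p \<in> zariski closure_of U" unfolding in_closure_of by blast
  qed
  have ne: "U \<noteq> {}"
  proof
    assume "U = {}"
    then have "?Y = {}" using dense by simp
    then show False using degen_locus_ne[OF L1 L2 le(1) r(2,3) le(2)] by blast
  qed
  show ?thesis unfolding rel_dual_defect_def rel_dual_determinantal
  proof (rule the_equality)
    show "\<exists>U. openin (subtopology zariski ?Y) U \<and> ?Y \<subseteq> zariski closure_of U \<and> (\<forall>h\<in>U. zdim (contact_locus h Xr Zr) = ?D)"
      using opn dense zd by (intro exI[of _ U] conjI ballI)
    \<comment> \<open>A competing dense set meets \<open>U\<close>, since \<open>U\<close> is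
      nonempty and open; at a common point the two dimensions coincide.\<close>
    fix d' assume "\<exists>U. openin (subtopology zariski ?Y) U \<and> ?Y \<subseteq> zariski closure_of U \<and> (\<forall>h\<in>U. zdim (contact_locus h Xr Zr) = d')"
    then obtain U' where U': "openin (subtopology zariski ?Y) U'" "?Y \<subseteq> zariski closure_of U'"
      "\<forall>h\<in>U'. zdim (contact_locus h Xr Zr) = d'" by (elim exE conjE) (rule that)
    obtain T where T: "openin zariski T" "U = T \<inter> ?Y" using opn unfolding openin_subtopology by blast
    obtain h where h: "h \<in> U" using ne by blast
    then have "h \<in> zariski closure_of U'" "h \<in> T" using T(2) U'(2) by auto
    then obtain y where y: "y \<in> U'" "y \<in> T" using T(1) unfolding in_closure_of by blast
    have "U' \<subseteq> ?Y" using openin_subset[OF U'(1)] by simp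
    then have "y \<in> U" using y T(2) by blast
    then show "d' = ?D" using zd U'(3) y(1) by metis
  qed
qed

end

text \<open>The absolute notions are the relative ones for \<open>Z = X\<close>, which arises from
  the full spaces.\<close>

lemma dual_variety_determinantal: "dual_variety Xr = degen_locus UNIV UNIV r"
proof -
  have "Xr \<inter> proj (tensor_subspace UNIV UNIV) = Xr"
    unfolding tensor_subspace_UNIV determinantal_def proj_def by blast
  then have "rel_conormal Xr (Xr \<inter> proj (tensor_subspace UNIV UNIV)) = conormal Xr"
    unfolding rel_conormal_def conormal_def smooth_locus_def by (simp add: Int_def conj_ac)
  then have "dual_variety Xr = rel_dual Xr (Xr \<inter> proj (tensor_subspace UNIV UNIV))"
    unfolding dual_variety_def rel_dual_def by simp
  then show ?thesis using rel_dual_determinantal[OF vec.subspace_UNIV vec.subspace_UNIV] by simp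
qed

end

theorem proposition4p1:
  fixes L1 :: "(complex ^ 'n::finite) set" and L2 :: "(complex ^ 'm::finite) set"
    and N M r :: nat and l1 l2 :: int
    and X Z :: "('m \<times> 'n) point set"
  assumes "CARD('n) = N + 1" and "CARD('m) = M + 1" and "M \<le> N"
    and "1 \<le> r" and "r \<le> M"
    and "vec.subspace L1" and "int (vec.dim L1) = l1 + 1"
    and "vec.subspace L2" and "int (vec.dim L2) = l2 + 1"
    and "X = determinantal r"
    and "Z = X \<inter> proj (tensor_subspace L1 L2)"
  shows "(min l1 l2 < int r - 1 \<longrightarrow> rel_dual X Z = {}) \<and>
    (min l1 l2 \<ge> int r - 1 \<longrightarrow>
       rel_dual_defect X Z = int r * max (l1 - int M) 0 + (int r)\<^sup>2 - 1 \<and>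
       zcodim (dual_variety X) (rel_dual X Z) =
         int r * (2 * int M - l1 - l2) + int r * max (l1 - int M) 0) \<and>
    (rel_dual X Z = dual_variety X \<longleftrightarrow> min l1 l2 \<ge> int M)"
proof -
  have r: "1 \<le> r" "r < CARD('m)" "CARD('m) \<le> CARD('n)" using assms by auto
  note L = assms(6,8)
  have rd: "rel_dual X Z = degen_locus L1 L2 r" unfolding assms(10,11) by (rule rel_dual_determinantal[OF r L])
  have dv: "dual_variety X = degen_locus UNIV UNIV r" unfolding assms(10) by (rule dual_variety_determinantal[OF r])
  define a b where "a = vec.dim L1" and "b = vec.dim L2"
  have ab: "l1 = int a - 1" "l2 = int b - 1" using assms(7,9) by (auto simp: a_def b_def)
  have b_le: "b \<le> CARD('m)" unfolding b_def using vec.dim_subset[OF subset_UNIV, of L2] vec_dim_card by metis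
  have UV: "vec.dim (UNIV :: (complex ^ 'n) set) = CARD('n)" "vec.dim (UNIV :: (complex ^ 'm) set) = CARD('m)"
    by (rule vec_dim_card)+
  have rU: "r \<le> vec.dim (UNIV :: (complex ^ 'n) set)" "r \<le> vec.dim (UNIV :: (complex ^ 'm) set)"
    using r unfolding UV by auto
  have empty: "degen_locus L1 L2 r = {}" if "\<not> (r \<le> a \<and> r \<le> b)"
  proof -
    have "\<not> degen L1 L2 r v" for v
      using that vec.dim_subset[of "rker v \<inter> L1" L1] vec.dim_subset[of "lker v \<inter> L2" L2]
      unfolding degen_def a_def b_def by force
    then show ?thesis unfolding degen_locus_def by simp
  qed
  have dual_ne: "degen_locus UNIV UNIV r \<noteq> ({} :: ('m \<times> 'n) point set)"
    by (rule degen_locus_ne[OF vec.subspace_UNIV vec.subspace_UNIV rU(1) r(2,3) rU(2)])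
  \<comment> \<open>The term (m - r)(n - r) is common to both dimensions; what remains compares
    \<open>min a CARD('m)\<close> and \<open>b\<close> with their values for the full spaces, both
    equal to \<open>CARD('m)\<close>.\<close>
  have codim: "zcodim (dual_variety X) (rel_dual X Z) = int r * (int CARD('m) - int (min a CARD('m))) + int r * (int CARD('m) - int b)"
    if "r \<le> a" "r \<le> b"
  proof -
    have "zdim (rel_dual X Z) = int (degen_dim CARD('m) CARD('n) (min a CARD('m)) b r) - 1"
      unfolding rd a_def b_def using that by (intro zdim_degen_locus L r) (simp_all add: a_def b_def)
    moreover have "zdim (dual_variety X) = int (degen_dim CARD('m) CARD('n) CARD('m) CARD('m) r) - 1"
      unfolding dv using zdim_degen_locus[OF vec.subspace_UNIV vec.subspace_UNIV rU(1) r(2,3) rU(2)] r(3)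
      unfolding UV by (simp add: min_absorb2)
    moreover have "int (degen_dim CARD('m) CARD('n) k b r) =
        int ((CARD('m) - r) * (CARD('n) - r)) + (int k - int r) * int r + (int b - int r) * int r"
      if "r \<le> k" "r \<le> b" for k b
      using that by (simp add: degen_dim_def of_nat_diff)
    moreover have "r \<le> min a CARD('m)" "r \<le> CARD('m)" using that r by simp_all
    ultimately have "zcodim (dual_variety X) (rel_dual X Z) =
        (int CARD('m) - int r) * int r + (int CARD('m) - int r) * int r
        - (int (min a CARD('m)) - int r) * int r - (int b - int r) * int r"
      using that(2) by (simp add: zcodim_def)
    then show ?thesis by (simp add: algebra_simps)
  qed
  have i: "rel_dual X Z = {}" if "min l1 l2 < int r - 1"
    unfolding rd using that ab by (intro empty) auto
  have ii: "rel_dual_defect X Z = int r * max (l1 - int M) 0 + (int r)\<^sup>2 - 1 \<and>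
       zcodim (dual_variety X) (rel_dual X Z) = int r * (2 * int M - l1 - l2) + int r * max (l1 - int M) 0"
    if "min l1 l2 \<ge> int r - 1"
  proof
    have le: "r \<le> a" "r \<le> b" using that ab by auto
    have m: "int CARD('m) = int M + 1" using assms(2) by simp
    \<comment> \<open>\<open>a\<close> exceeds l1 and \<open>CARD('m)\<close> exceeds M by one, so
      truncated subtraction of naturals is the maximum with 0.\<close>
    have max: "max (l1 - int M) 0 = int (a - CARD('m))" using ab m by auto
    have "int ((r + k) * r) - 1 = int r * int k + (int r)\<^sup>2 - 1" for k
      by (simp add: algebra_simps power2_eq_square)
    then show "rel_dual_defect X Z = int r * max (l1 - int M) 0 + (int r)\<^sup>2 - 1"
      unfolding assms(10,11) rel_dual_defect_determinantal[OF r L le[unfolded a_def b_def]] max a_def .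
    have mn: "int (min a CARD('m)) = l1 + 1 - max (l1 - int M) 0" using ab m by auto
    show "zcodim (dual_variety X) (rel_dual X Z) = int r * (2 * int M - l1 - l2) + int r * max (l1 - int M) 0"
      unfolding codim[OF le] mn unfolding m ab(2) by (simp add: algebra_simps)
  qed
  have iii: "rel_dual X Z = dual_variety X \<longleftrightarrow> min l1 l2 \<ge> int M"
  proof
    assume eq: "rel_dual X Z = dual_variety X"
    \<comment> \<open>Otherwise the relative dual would be empty, while the dual variety is
      not.\<close>
    have le: "r \<le> a" "r \<le> b" using empty eq dual_ne unfolding rd dv by blast+
    have "zcodim (dual_variety X) (rel_dual X Z) = 0" unfolding eq zcodim_def by simp
    \<comment> \<open>The codimension 0 is \<open>r\<close> times a sum of two nonnegative numbers,
      so both vanish.\<close>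
    then have "int r * ((int CARD('m) - int (min a CARD('m))) + (int CARD('m) - int b)) = 0"
      unfolding codim[OF le] by (simp only: distrib_left)
    then have "(int CARD('m) - int (min a CARD('m))) + (int CARD('m) - int b) = 0" using r by simp
    moreover have "int (min a CARD('m)) \<le> int CARD('m)" "int b \<le> int CARD('m)" using b_le by auto
    ultimately have "int (min a CARD('m)) = int CARD('m)" "int b = int CARD('m)" by linarith+
    then have "CARD('m) \<le> a" "CARD('m) \<le> b" by linarith+
    then show "min l1 l2 \<ge> int M" using ab assms(2) by auto
  next
    assume "min l1 l2 \<ge> int M"
    \<comment> \<open>\<open>b\<close> cannot exceed \<open>CARD('m)\<close>, so \<open>L2\<close>
      is the whole space. On the other side one subspace \<open>L'\<close> of dimension
      \<open>CARD('m)\<close> replaces both \<open>L1\<close> and the full space.\<close>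
    then have ge: "CARD('m) \<le> a" "CARD('m) = b" using ab assms(2) b_le by auto
    have L2U: "L2 = UNIV"
      using vec.subspace_dim_equal[OF L(2) vec.subspace_UNIV subset_UNIV] ge(2) unfolding UV b_def by simp
    obtain L' where L': "vec.subspace L'" "L' \<subseteq> L1" "vec.dim L' = CARD('m)"
      by (rule subspace_of_dim[OF L(1), of "CARD('m)"]) (use ge in \<open>auto simp: a_def\<close>)
    have "degen L1 L2 r v \<longleftrightarrow> degen UNIV UNIV r v" for v :: "complex ^ ('m \<times> 'n)"
      unfolding L2U
      using degen_shrink[OF L(1) L'(1,2), of UNIV r v] degen_shrink[OF vec.subspace_UNIV L'(1) subset_UNIV, of UNIV r v]
        L'(3) ge(1) r(3) unfolding a_def UV by (simp add: min_absorb2)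
    then show "rel_dual X Z = dual_variety X" unfolding rd dv degen_locus_def by simp
  qed
  show ?thesis using i ii iii by blast
qed

end
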